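(* Suppose that $k \in \mathbb{Z}^+$, $X$ is a Hausdorff space, and $R$ is an $\aleph_0$-universally-Baire quasi-order on $X$ whose incomparability relation is analytic. Then exactly one of the following holds: (1) There is a cover $(C_i)_{i<k}$ of $X$ by Borel $R$-chains. (2) There is an $R$-antichain of cardinality $k+1$.
   Context: The base theory is $\mathtt{ZF}+\mathtt{DC}$ (Zermelo–Fraenkel set theory with dependent choice). A binary relation $R$ on a set $X$ is a quasi-order if it is reflexive and transitive. Points $x,y \in X$ are $R$-comparable if $x \mathrel{R} y$ or $y \mathrel{R} x$, and $R$-incomparable otherwise; the incomparability relation of $R$ is the set of pairs $(x,y) \in X \times X$ such that $x$ and $y$ are $R$-incomparable. A set $Y \subseteq X$ is an $R$-chain if any two points of $Y$ are $R$-comparable, and an $R$-antichain if any two distinct points of $Y$ are $R$-incomparable. A subset of a topological space $Z$ is Borel if it is in the $\sigma$-algebra generated by the topology of $Z$; analytic if it is a continuous image of a closed subset of $\mathbb{N}^{\mathbb{N}}$; and $\aleph_0$-universally Baire if its preimage under every continuous function $\phi \colon 2^{\mathbb{N}} \to Z$ has the Baire property. Binary relations on $X$ are regarded as subsets of $X \times X$ with the product topology. *)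

theory Defs
  imports "HOL-Analysis.Analysis"
begin

definition borel_in :: "'a topology \<Rightarrow> 'a set \<Rightarrow> bool" where
  "borel_in Z A \<longleftrightarrow> A \<in> sigma_sets (topspace Z) {U. openin Z U}"

(* The type nat => nat carries the product of the discrete topologies, so it is
   Baire space. The closed set F may be empty, so the empty set is analytic. *)
definition analytic_in :: "'a topology \<Rightarrow> 'a set \<Rightarrow> bool" where
  "analytic_in Z A \<longleftrightarrow>
     (\<exists>(F :: (nat \<Rightarrow> nat) set) f. closed F \<and> continuous_map (top_of_set F) Z f \<and> f ` F = A)"

definition nowhere_dense :: "'a::topological_space set \<Rightarrow> bool" where
  "nowhere_dense A \<longleftrightarrow> interior (closure A) = {}"

definition meager :: "'a::topological_space set \<Rightarrow> bool" where
  "meager A \<longleftrightarrow> (\<exists>N :: nat \<Rightarrow> 'a set. (\<forall>n. nowhere_dense (N n)) \<and> A = (\<Union>n. N n))"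

definition baire_property :: "'a::topological_space set \<Rightarrow> bool" where
  "baire_property A \<longleftrightarrow> (\<exists>U. open U \<and> meager ((A - U) \<union> (U - A)))"

(* The type nat => bool carries the product of the discrete topologies, so it is
   Cantor space. *)
definition aleph0_universally_Baire_in :: "'a topology \<Rightarrow> 'a set \<Rightarrow> bool" where
  "aleph0_universally_Baire_in Z A \<longleftrightarrow> A \<subseteq> topspace Z \<and>
     (\<forall>\<phi> :: (nat \<Rightarrow> bool) \<Rightarrow> 'a. continuous_map euclidean Z \<phi> \<longrightarrow> baire_property (\<phi> -` A))"

definition incomparability :: "'a set \<Rightarrow> ('a \<times> 'a) set \<Rightarrow> ('a \<times> 'a) set" where
  "incomparability X R = {(x, y). x \<in> X \<and> y \<in> X \<and> \<not> ((x, y) \<in> R \<or> (y, x) \<in> R)}"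

definition antichain_on :: "'a set \<Rightarrow> ('a \<times> 'a) set \<Rightarrow> 'a set \<Rightarrow> bool" where
  "antichain_on X R A \<longleftrightarrow>
     A \<subseteq> X \<and> (\<forall>x\<in>A. \<forall>y\<in>A. x \<noteq> y \<longrightarrow> (x, y) \<in> incomparability X R)"

end

theory Submission
  imports Defs
begin

text \<open>Pull the quasi-order back to Baire space along a parametrization of the incomparable pairs. By
  Dilworth's theorem for finite sets and compactness the incomparability graph has a \<open>k\<close>-colouring.
  Consider Borel partial colourings that extend to a total one. If some of them is total, its colour classes are
  analytic chains, which separation enlarges to Borel chains. Otherwise a fusion builds a continuous
  map \<open>\<phi>\<close> from Cantor space such that at densely many scales \<open>m\<close> copies of the construction cannot all
  receive a given colour, with a certificate depending continuously on the point, whereas fewer than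
  \<open>m\<close> copies always can. By the Baire property, \<open>\<phi> z \<preceq> \<phi> w\<close> is decided on some rectangle
  up to a meager set. Extend the partial colouring to minimize the sets of possible colours of the points in the
  certificates: generic points that share a possible colour become comparable, and the certificates link all
  copies through such pairs. Then infinitely many generic points are linearly ordered in the same way by all
  copies, so \<open>\<phi> z \<preceq> \<phi> w\<close> depends on the order of \<open>z\<close> and \<open>w\<close>, contradicting that it is decided.\<close>

text \<open>Inconsistency of a partial colouring is finitary by compactness, and incomparability is
  coded by a closed set. So each finite inconsistency has one of countably many patterns, each with
  a closed set of witnesses. Hence the families that cannot receive a colour form analytic sets, and
  certificates survive the limits of the fusion. The number of copies is not prescribed: it is the
  least size of inconsistent families that extending the colouring cannot always destroy.
  Indestructibility supplies families whose leaves all stay uncoloured. Minimality is what links the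
  copies later, since every proper part of a family can still receive the colour. The total
  colourings come from compactness and carry no definability, so nothing is known about the Baire
  property of the set of points with given possible colours. The category argument therefore works
  with sets that are non-meager in every smaller neighbourhood, and uses the Baire property only for
  the relation and for the Borel colour classes.\<close>

type_synonym baire = "nat \<Rightarrow> nat"
type_synonym cantor = "nat \<Rightarrow> bool"
type_synonym pcol = "nat \<Rightarrow> baire set"

section \<open>Finite Dilworth theorem and compactness of colourings\<close>

locale quasi_order =
  fixes le :: "'a \<Rightarrow> 'a \<Rightarrow> bool" (infix "\<preceq>" 50)
  assumes le_refl: "x \<preceq> x"
    and le_trans: "x \<preceq> y \<Longrightarrow> y \<preceq> z \<Longrightarrow> x \<preceq> z"
begin

definition par :: "'a \<Rightarrow> 'a \<Rightarrow> bool" where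
  "par x y \<longleftrightarrow> \<not> x \<preceq> y \<and> \<not> y \<preceq> x"

definition anti :: "'a set \<Rightarrow> bool" where
  "anti A \<longleftrightarrow> (\<forall>x\<in>A. \<forall>y\<in>A. x \<noteq> y \<longrightarrow> par x y)"

lemma par_sym: "par x y \<Longrightarrow> par y x"
  by (auto simp: par_def)

lemma par_irrefl: "\<not> par x x"
  by (auto simp: par_def le_refl)

lemma finite_chain_has_max:
  assumes "finite S" "S \<noteq> {}" "\<forall>x\<in>S. \<forall>y\<in>S. \<not> par x y"
  shows "\<exists>m\<in>S. \<forall>x\<in>S. x \<preceq> m"
  using assms
proof (induction S rule: finite_ne_induct)
  case (singleton x)
  then show ?case by (auto simp: le_refl)
next
  case (insert x F)
  then obtain m where m: "m \<in> F" "\<forall>y\<in>F. y \<preceq> m" by auto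
  have "x \<preceq> m \<or> m \<preceq> x" using insert.prems m(1) by (auto simp: par_def)
  then show ?case
  proof
    assume "x \<preceq> m" then show ?thesis using m by auto
  next
    assume "m \<preceq> x" then show ?thesis using m le_trans le_refl by (metis insert_iff)
  qed
qed

lemma finite_has_maximal:
  assumes "finite S" "S \<noteq> {}"
  shows "\<exists>m\<in>S. \<forall>x\<in>S. m \<preceq> x \<longrightarrow> x \<preceq> m"
  using assms
proof (induction S rule: finite_ne_induct)
  case (singleton x)
  then show ?case by auto
next
  case (insert x F)
  then obtain m where m: "m \<in> F" "\<forall>y\<in>F. m \<preceq> y \<longrightarrow> y \<preceq> m" by auto
  show ?case
  proof (cases "m \<preceq> x")
    case True
    have "x \<preceq> y \<longrightarrow> y \<preceq> x" if "y \<in> insert x F" for y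
      using that True m le_trans le_refl by blast
    then show ?thesis by auto
  next
    case False then show ?thesis using m by auto
  qed
qed

text \<open>Galvin's proof: the largest elements of the colour classes that lie on a maximum antichain
  form an antichain themselves, so one of them is below the removed maximal element.\<close>

lemma dilworth_finite:
  assumes "finite F" and "\<forall>A\<subseteq>F. anti A \<longrightarrow> card A \<le> n"
  shows "\<exists>d::'a \<Rightarrow> nat. (\<forall>x\<in>F. d x < n) \<and> (\<forall>x\<in>F. \<forall>y\<in>F. par x y \<longrightarrow> d x \<noteq> d y)"
  using assms
proof (induction "card F" arbitrary: F n rule: less_induct)
  case less
  show ?case
  proof (cases "F = {}")
    case True then show ?thesis by simp
  next
    case False
    then obtain a where a: "a \<in> F" "\<forall>x\<in>F. a \<preceq> x \<longrightarrow> x \<preceq> a"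
      using finite_has_maximal less.prems(1) by blast
    have "anti {a}" by (simp add: anti_def)
    then have n1: "n \<ge> 1" using less.prems(2) a(1) by force
    \<comment> \<open>It suffices to find a chain \<open>K\<close> through \<open>a\<close> whose
      removal lowers the antichain bound by one; \<open>K\<close> then receives the last colour
      \<open>n - 1\<close>.\<close>
    have extend: ?thesis
      if K: "K \<subseteq> F" "a \<in> K" "\<forall>x\<in>K. \<forall>y\<in>K. \<not> par x y"
        and w: "\<forall>A\<subseteq>F - K. anti A \<longrightarrow> card A \<le> n - 1" for K
    proof -
      have "card (F - K) < card F"
        using K a(1) less.prems(1) by (intro psubset_card_mono) auto
      from less.hyps[OF this _ w] less.prems(1)
      obtain d where d: "\<forall>x\<in>F - K. d x < n - 1"
        "\<forall>x\<in>F - K. \<forall>y\<in>F - K. par x y \<longrightarrow> d x \<noteq> d y" by auto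
      show ?thesis
      proof (intro exI[of _ "\<lambda>x. if x \<in> K then n - 1 else d x"] conjI ballI impI)
        fix x assume "x \<in> F"
        then show "(if x \<in> K then n - 1 else d x) < n"
          using d(1) n1 by (cases "x \<in> K") force+
      next
        fix x y assume xy: "x \<in> F" "y \<in> F" "par x y"
        have "x \<in> K \<Longrightarrow> y \<notin> K" using K(3) xy(3) by blast
        moreover have "d x < n - 1" if "x \<notin> K" using d(1) xy(1) that by blast
        moreover have "d y < n - 1" if "y \<notin> K" using d(1) xy(2) that by blast
        moreover have "d x \<noteq> d y" if "x \<notin> K" "y \<notin> K" using d(2) xy that by blast
        ultimately show "(if x \<in> K then n - 1 else d x) \<noteq> (if y \<in> K then n - 1 else d y)"
          by (cases "x \<in> K"; cases "y \<in> K") auto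
      qed
    qed
    let ?P = "F - {a}"
    have finP: "finite ?P" using less.prems(1) by simp
    show ?thesis
    proof (cases "\<exists>A\<subseteq>?P. anti A \<and> card A = n")
      case False
      have "\<forall>A\<subseteq>?P. anti A \<longrightarrow> card A \<le> n - 1"
      proof (intro allI impI)
        fix A assume A: "A \<subseteq> ?P" "anti A"
        then have "card A \<le> n" using less.prems(2) by blast
        moreover have "card A \<noteq> n" using A False by blast
        ultimately show "card A \<le> n - 1" by linarith
      qed
      then show ?thesis using extend[of "{a}"] a(1) par_irrefl by auto
    next
      case True
      have "card ?P < card F" using a(1) less.prems(1) by (meson card_Diff1_less)
      moreover have "\<forall>A\<subseteq>?P. anti A \<longrightarrow> card A \<le> n" using less.prems(2) by blast
      ultimately obtain d where d: "\<forall>x\<in>?P. d x < n" "\<forall>x\<in>?P. \<forall>y\<in>?P. par x y \<longrightarrow> d x \<noteq> d y"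
        using less.hyps[of ?P n] finP by auto
      define S where "S = {x\<in>?P. \<exists>A\<subseteq>?P. anti A \<and> card A = n \<and> x \<in> A}"
      have meets: "\<exists>x\<in>A. d x = i" if A: "A \<subseteq> ?P" "anti A" "card A = n" and i: "i < n" for A i
      proof -
        have "inj_on d A" using A d(2) unfolding inj_on_def anti_def by blast
        then have "card (d ` A) = n" using A(3) by (simp add: card_image)
        moreover have "d ` A \<subseteq> {..<n}" using A(1) d(1) by auto
        ultimately have "d ` A = {..<n}" by (simp add: card_subset_eq)
        then have "i \<in> d ` A" using i by simp
        then show ?thesis by auto
      qed
      have "\<exists>m. m \<in> S \<and> d m = i \<and> (\<forall>x\<in>S. d x = i \<longrightarrow> x \<preceq> m)" if i: "i < n" for i
      proof -
        let ?S = "{x\<in>S. d x = i}"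
        have "finite ?S" using finP by (auto simp: S_def)
        moreover have "?S \<noteq> {}" using True meets[OF _ _ _ i] by (auto simp: S_def) blast
        moreover have "S \<subseteq> ?P" by (auto simp: S_def)
        then have "\<forall>x\<in>?S. \<forall>y\<in>?S. \<not> par x y" using d(2) by blast
        ultimately show ?thesis using finite_chain_has_max[of ?S] by auto
      qed
      then obtain m where m: "\<And>i. i < n \<Longrightarrow> m i \<in> S" "\<And>i. i < n \<Longrightarrow> d (m i) = i"
        "\<And>i x. i < n \<Longrightarrow> x \<in> S \<Longrightarrow> d x = i \<Longrightarrow> x \<preceq> m i" by metis
      have nle: "\<not> m i \<preceq> m j" if ij: "i < n" "j < n" "i \<noteq> j" for i j
      proof
        assume le: "m i \<preceq> m j"
        obtain A where A: "A \<subseteq> ?P" "anti A" "card A = n" "m i \<in> A"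
          using m(1)[OF ij(1)] by (auto simp: S_def)
        obtain y where y: "y \<in> A" "d y = j" using meets[OF A(1-3) ij(2)] by auto
        obtain B where B: "B \<subseteq> ?P" "anti B" "card B = n" "m j \<in> B"
          using m(1)[OF ij(2)] by (auto simp: S_def)
        obtain x where x: "x \<in> B" "d x = i" using meets[OF B(1-3) ij(1)] by auto
        have "x \<preceq> m i" using m(3)[OF ij(1), of x] x B by (auto simp: S_def)
        then have "x \<preceq> m j" using le le_trans by blast
        moreover have "x \<noteq> m j" using x(2) m(2)[OF ij(2)] ij(3) by auto
        ultimately show False using B(2,4) x(1) by (auto simp: anti_def par_def)
      qed
      have "\<exists>i<n. m i \<preceq> a"
      proof (rule ccontr)
        assume H: "\<not> ?thesis"
        have inj: "inj_on m {..<n}" using m(2) by (metis inj_onI lessThan_iff)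
        have sub: "m ` {..<n} \<subseteq> ?P" using m(1) by (auto simp: S_def)
        have "anti (insert a (m ` {..<n}))"
          using nle H a(2) sub unfolding anti_def par_def by (auto) blast+
        then have "card (insert a (m ` {..<n})) \<le> n" using less.prems(2) sub a(1) by blast
        moreover have "card (insert a (m ` {..<n})) = Suc n"
          using sub inj by (subst card_insert_disjoint) (auto simp: card_image)
        ultimately show False by simp
      qed
      then obtain i where i: "i < n" "m i \<preceq> a" by blast
      \<comment> \<open>An antichain of size \<open>n\<close> outside \<open>K\<close> would contain
        a point of colour \<open>i\<close>; that point lies in \<open>S\<close>, hence below
        \<open>m i\<close>, hence in \<open>K\<close>.\<close>
      define K where "K = insert a {x\<in>?P. d x = i \<and> x \<preceq> m i}"
      show ?thesis
      proof (rule extend)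
        show "K \<subseteq> F" "a \<in> K" using a(1) by (auto simp: K_def)
        show "\<forall>x\<in>K. \<forall>y\<in>K. \<not> par x y"
          using d(2) i(2) le_trans le_refl unfolding K_def par_def by auto
        show "\<forall>A\<subseteq>F - K. anti A \<longrightarrow> card A \<le> n - 1"
        proof (intro allI impI)
          fix A assume A: "A \<subseteq> F - K" "anti A"
          then have AP: "A \<subseteq> ?P" by (auto simp: K_def)
          have "card A \<le> n" using A less.prems(2) by blast
          moreover have "card A \<noteq> n"
          proof
            assume c: "card A = n"
            obtain x where x: "x \<in> A" "d x = i" using meets[OF AP A(2) c i(1)] by auto
            then have "x \<in> S" using AP A(2) c by (auto simp: S_def)
            then have "x \<preceq> m i" using m(3) i(1) x(2) by blast
            then show False using x A(1) AP by (auto simp: K_def)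
          qed
          ultimately show "card A \<le> n - 1" by linarith
        qed
      qed
    qed
  qed
qed

end

text \<open>Tychonoff: the \<open>k\<close>-valued functions form a compact product of finite
  discrete spaces. By \<open>loc\<close> the condition on a finite \<open>F\<close> depends on
  finitely many values and so is closed; by \<open>mono\<close> finitely many conditions follow from
  the one on their union.\<close>

lemma colouring_compactness:
  fixes ok :: "'a set \<Rightarrow> ('a \<Rightarrow> nat) \<Rightarrow> bool"
  assumes fin: "\<And>F. finite F \<Longrightarrow> \<exists>d. (\<forall>x. d x < k) \<and> ok F d"
    and mono: "\<And>F F' d. F \<subseteq> F' \<Longrightarrow> finite F' \<Longrightarrow> ok F' d \<Longrightarrow> ok F d"
    and loc: "\<And>F d d'. finite F \<Longrightarrow> (\<forall>x\<in>F. d x = d' x) \<Longrightarrow> ok F d \<Longrightarrow> ok F d'"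
  shows "\<exists>d. (\<forall>x. d x < k) \<and> (\<forall>F. finite F \<longrightarrow> ok F d)"
proof -
  let ?S = "PiE UNIV (\<lambda>_::'a. {..<k})"
  have "compactin (product_topology (\<lambda>_. euclidean) UNIV) ?S"
    by (subst compactin_PiE) (auto simp: finite_imp_compact)
  then have comp: "compact ?S" by (simp add: euclidean_product_topology)
  have openf: "open {d. d x = (v::nat)}" for x :: 'a and v
  proof -
    have "open ((\<lambda>d. d x) -` {v} :: ('a \<Rightarrow> nat) set)"
      by (intro open_vimage) (auto simp: open_discrete)
    then show ?thesis by (simp add: vimage_def)
  qed
  have closed: "closed {d. ok F d}" if F: "finite F" for F
  proof -
    have "open (- {d. ok F d})"
    proof (subst open_subopen, intro ballI)
      fix d assume "d \<in> - {d. ok F d}"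
      then have d: "\<not> ok F d" by simp
      let ?T = "\<Inter>x\<in>F. {d'. d' x = d x}"
      have "open ?T" using F openf by (intro open_INT) auto
      moreover have "?T \<subseteq> - {d. ok F d}" using loc[OF F, of _ d] d by auto
      ultimately show "\<exists>T. open T \<and> d \<in> T \<and> T \<subseteq> - {d. ok F d}" by blast
    qed
    then show ?thesis by (simp add: closed_def)
  qed
  have "?S \<inter> (\<Inter>F\<in>{F. finite F}. {d. ok F d}) \<noteq> {}"
  proof (rule compact_imp_fip_image[OF comp])
    fix I assume I: "finite I" "I \<subseteq> {F::'a set. finite F}"
    then have "finite (\<Union>I)" by auto
    from fin[OF this] obtain d where d: "\<forall>x. d x < k" "ok (\<Union>I) d" by blast
    have "ok F d" if "F \<in> I" for F
      using mono[OF _ \<open>finite (\<Union>I)\<close> d(2), of F] that by blast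
    then have "d \<in> ?S \<inter> (\<Inter>F\<in>I. {d. ok F d})" using d(1) by (auto simp: PiE_def)
    then show "?S \<inter> (\<Inter>F\<in>I. {d. ok F d}) \<noteq> {}" by blast
  next
    show "closed {d. ok F d}" if "F \<in> {F. finite F}" for F using closed that by simp
  qed
  then obtain d where "d \<in> ?S" "\<forall>F. finite F \<longrightarrow> ok F d" by auto
  then show ?thesis by (auto simp: PiE_def Pi_def)
qed

section \<open>Baire category in Cantor space\<close>

definition nbhd :: "nat \<Rightarrow> (nat \<Rightarrow> 'b) \<Rightarrow> (nat \<Rightarrow> 'b) set" where
  "nbhd n x = {y. \<forall>j<n. y j = x j}"

lemma nbhd_self [simp]: "x \<in> nbhd n x"
  by (simp add: nbhd_def)

lemma nbhd_mono: "n \<le> m \<Longrightarrow> y \<in> nbhd n x \<Longrightarrow> nbhd m y \<subseteq> nbhd n x"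
  by (auto simp: nbhd_def)

lemma nbhd_antimono: "n \<le> m \<Longrightarrow> nbhd m x \<subseteq> nbhd n x"
  by (auto simp: nbhd_def)

lemma open_nbhd: "open (nbhd n (x :: nat \<Rightarrow> 'b::discrete_topology))"
proof -
  have "nbhd n x = (\<Inter>j\<in>{..<n}. (\<lambda>y. y j) -` {x j})" by (auto simp: nbhd_def)
  also have "open \<dots>"
    by (intro open_INT ballI open_vimage continuous_on_product_coordinates open_discrete) auto
  finally show ?thesis .
qed

lemma open_imp_nbhd:
  fixes U :: "(nat \<Rightarrow> 'b::topological_space) set"
  assumes "open U" "x \<in> U"
  shows "\<exists>n. nbhd n x \<subseteq> U"
proof -
  have "openin (product_topology (\<lambda>_. euclidean) UNIV) U"
    using assms(1) by (simp add: open_fun_def)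
  from product_topology_open_contains_basis[OF this assms(2)]
  obtain X where X: "x \<in> (\<Pi>\<^sub>E i\<in>UNIV. X i)" "finite {i. X i \<noteq> topspace (euclidean :: 'b topology)}"
    "(\<Pi>\<^sub>E i\<in>UNIV. X i) \<subseteq> U" by blast
  obtain n where n: "\<forall>i\<in>{i. X i \<noteq> UNIV}. i < n"
    using X(2) finite_nat_set_iff_bounded[of "{i. X i \<noteq> UNIV}"] by auto
  have "y \<in> U" if y: "y \<in> nbhd n x" for y
  proof -
    have "y i \<in> X i" for i
    proof (cases "i < n")
      case True then show ?thesis using y X(1) by (auto simp: nbhd_def PiE_def)
    next
      case False then have "X i = UNIV" using n by auto
      then show ?thesis by simp
    qed
    then show ?thesis using X(3) by (auto simp: PiE_def)
  qed
  then show ?thesis by blast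
qed

lemma nowhere_dense_iff:
  fixes A :: "cantor set"
  shows "nowhere_dense A \<longleftrightarrow> (\<forall>n x. \<exists>m y. nbhd m y \<subseteq> nbhd n x \<and> nbhd m y \<inter> A = {})"
proof
  assume A: "nowhere_dense A"
  show "\<forall>n x. \<exists>m y. nbhd m y \<subseteq> nbhd n x \<and> nbhd m y \<inter> A = {}"
  proof (intro allI)
    fix n and x :: "nat \<Rightarrow> bool"
    have "\<not> nbhd n x \<subseteq> closure A"
    proof
      assume "nbhd n x \<subseteq> closure A"
      then have "nbhd n x \<subseteq> interior (closure A)" by (simp add: interior_maximal open_nbhd)
      then show False using A nbhd_self[of x n] unfolding nowhere_dense_def by blast
    qed
    then obtain y where y: "y \<in> nbhd n x" "y \<notin> closure A" by blast
    have "open (nbhd n x \<inter> - closure A)" by (intro open_Int open_nbhd) auto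
    from open_imp_nbhd[OF this, of y] y obtain m where "nbhd m y \<subseteq> nbhd n x \<inter> - closure A" by auto
    moreover have "- closure A \<subseteq> - A" using closure_subset by auto
    ultimately show "\<exists>m y. nbhd m y \<subseteq> nbhd n x \<and> nbhd m y \<inter> A = {}" by blast
  qed
next
  assume H: "\<forall>n x. \<exists>m y. nbhd m y \<subseteq> nbhd n x \<and> nbhd m y \<inter> A = {}"
  have False if p: "p \<in> interior (closure A)" for p
  proof -
    obtain n where n: "nbhd n p \<subseteq> interior (closure A)" using open_imp_nbhd[OF open_interior p] by blast
    obtain m y where my: "nbhd m y \<subseteq> nbhd n p" "nbhd m y \<inter> A = {}" using H by blast
    have "y \<in> closure A" using my(1) n interior_subset nbhd_self by blast
    then show False using my(2) open_nbhd[of m y] nbhd_self[of y m]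
      by (metis disjoint_iff open_Int_closure_eq_empty)
  qed
  then show "nowhere_dense A" by (auto simp: nowhere_dense_def)
qed

lemma nowhere_dense_subset: "nowhere_dense A \<Longrightarrow> B \<subseteq> A \<Longrightarrow> nowhere_dense B"
  unfolding nowhere_dense_def by (metis closure_mono interior_mono subset_empty)

lemma meager_subset: "meager A \<Longrightarrow> B \<subseteq> A \<Longrightarrow> meager B"
proof -
  assume "meager A" and BA: "B \<subseteq> A"
  then obtain N where N: "\<forall>n::nat. nowhere_dense (N n)" "A = (\<Union>n. N n)" by (auto simp: meager_def)
  show "meager B"
    unfolding meager_def
    by (intro exI[of _ "\<lambda>n. N n \<inter> B"] conjI allI nowhere_dense_subset[OF N(1)[rule_format]])
       (use N BA in auto)
qed

lemma meager_UN_nat: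
  assumes "\<And>n::nat. meager (A n)"
  shows "meager (\<Union>n. A n)"
proof -
  obtain N where N: "\<And>n m. nowhere_dense (N n (m::nat))" "\<And>n. A n = (\<Union>m. N n m)"
    using assms unfolding meager_def by metis
  have "(\<Union>n. A n) = (\<Union>i. N (fst (prod_decode i)) (snd (prod_decode i)))"
    unfolding N(2) by (auto) (metis fst_conv prod_encode_inverse snd_conv)
  then show ?thesis unfolding meager_def using N(1)
    by (intro exI[of _ "\<lambda>i. N (fst (prod_decode i)) (snd (prod_decode i))"]) auto
qed

lemma nowhere_dense_imp_meager: "nowhere_dense A \<Longrightarrow> meager A"
  unfolding meager_def by (intro exI[of _ "\<lambda>_. A"]) auto

lemma meager_empty [simp]: "meager {}"
  by (rule nowhere_dense_imp_meager) (simp add: nowhere_dense_def)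

lemma meager_UN:
  assumes "countable I" "\<And>i. i \<in> I \<Longrightarrow> meager (A i)"
  shows "meager (\<Union>i\<in>I. A i)"
proof (cases "I = {}")
  case False
  have "(\<Union>i\<in>I. A i) = (\<Union>n. A (from_nat_into I n))"
    using range_from_nat_into[OF False assms(1)] by (metis UN_simps(10) image_image)
  moreover have "meager (\<Union>n. A (from_nat_into I n))"
    by (intro meager_UN_nat assms(2) from_nat_into False)
  ultimately show ?thesis by simp
qed auto

lemma meager_Un: "meager A \<Longrightarrow> meager B \<Longrightarrow> meager (A \<union> B)"
  using meager_UN[of "{True, False}" "\<lambda>b. if b then A else B"] by (auto simp: Un_commute)

lemma nbhd_max_subset:
  "y \<in> nbhd n x \<Longrightarrow> y \<in> nbhd n' x' \<Longrightarrow> nbhd (max n n') y \<subseteq> nbhd n x \<inter> nbhd n' x'"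
  by (auto simp: nbhd_def)

text \<open>The Baire category theorem for Cantor space. The lengths of the nested neighbourhoods
  grow strictly, so stage \<open>Suc j\<close> has already fixed coordinate \<open>j\<close> of the
  limit point.\<close>

lemma not_meager_nbhd: "\<not> meager (nbhd n (x :: nat \<Rightarrow> bool))"
proof
  assume "meager (nbhd n x)"
  then obtain N where N: "\<forall>i::nat. nowhere_dense (N i)" "nbhd n x = (\<Union>i. N i)"
    by (auto simp: meager_def)
  have step: "\<exists>q. nbhd (fst q) (snd q) \<subseteq> nbhd (fst p) (snd p) \<and> fst q > fst p \<and>
      nbhd (fst q) (snd q) \<inter> N i = {}" for p :: "nat \<times> cantor" and i
  proof -
    obtain m y where my: "nbhd m y \<subseteq> nbhd (fst p) (snd p)" "nbhd m y \<inter> N i = {}"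
      using N(1) unfolding nowhere_dense_iff by blast
    have "nbhd (max m (Suc (fst p))) y \<subseteq> nbhd m y" by (rule nbhd_antimono) simp
    with my show ?thesis by (intro exI[of _ "(max m (Suc (fst p)), y)"]) auto
  qed
  obtain f where f: "f 0 = (n, x)"
    "\<And>i. nbhd (fst (f (Suc i))) (snd (f (Suc i))) \<subseteq> nbhd (fst (f i)) (snd (f i))"
    "\<And>i. fst (f (Suc i)) > fst (f i)"
    "\<And>i. nbhd (fst (f (Suc i))) (snd (f (Suc i))) \<inter> N i = {}"
    using dependent_nat_choice[of "\<lambda>i p. i = 0 \<longrightarrow> p = (n, x)" "\<lambda>i p q.
      nbhd (fst q) (snd q) \<subseteq> nbhd (fst p) (snd p) \<and> fst q > fst p \<and> nbhd (fst q) (snd q) \<inter> N i = {}"]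
      step by (auto simp: all_conj_distrib)
  have gt: "j < fst (f (Suc j))" for j
  proof (induction j)
    case 0 then show ?case using f(3)[of 0] by simp
  next
    case (Suc j) then show ?case using f(3)[of "Suc j"] by linarith
  qed
  have mono: "i \<le> i' \<Longrightarrow> nbhd (fst (f i')) (snd (f i')) \<subseteq> nbhd (fst (f i)) (snd (f i))" for i i'
    by (induction i' rule: dec_induct) (use f(2) in auto)
  have agree: "snd (f i') j = snd (f i) j" if "i \<le> i'" "j < fst (f i)" for i i' j
    using mono[OF that(1)] nbhd_self[of "snd (f i')" "fst (f i')"] that(2) by (auto simp: nbhd_def)
  define z where "z j = snd (f (Suc j)) j" for j
  have z: "z \<in> nbhd (fst (f i)) (snd (f i))" for i
    unfolding nbhd_def mem_Collect_eq
  proof (intro allI impI)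
    fix j assume j: "j < fst (f i)"
    show "z j = snd (f i) j"
      using agree[of i "Suc j" j] agree[of "Suc j" i j] j gt[of j] by (cases "i \<le> Suc j") (auto simp: z_def)
  qed
  have "z \<in> nbhd n x" using z[of 0] f(1) by simp
  then obtain i where "z \<in> N i" using N(2) by auto
  then show False using z[of "Suc i"] f(4)[of i] by blast
qed

lemma countable_nbhds: "countable (range (\<lambda>(n, x :: nat \<Rightarrow> bool). nbhd n x))"
proof -
  have "nbhd n x = (\<lambda>l. {y. \<forall>j<length l. y j = l ! j}) (map x [0..<n])" for n and x :: "nat \<Rightarrow> bool"
    by (auto simp: nbhd_def)
  then have "range (\<lambda>(n, x :: nat \<Rightarrow> bool). nbhd n x) \<subseteq> range (\<lambda>l. {y. \<forall>j<length l. y j = l ! j})"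
    by (clarify, blast)
  then show ?thesis by (rule countable_subset) simp
qed

text \<open>A form of the Banach category theorem.\<close>

lemma not_meager_localize:
  fixes A :: "cantor set"
  assumes "\<not> meager A"
  shows "\<exists>n x. \<forall>m y. nbhd m y \<subseteq> nbhd n x \<longrightarrow> \<not> meager (A \<inter> nbhd m y)"
proof (rule ccontr)
  assume "\<not> ?thesis"
  then have H: "\<forall>n x. \<exists>m y. nbhd m y \<subseteq> nbhd n x \<and> meager (A \<inter> nbhd m y)" by blast
  define I where "I = {V \<in> range (\<lambda>(n, x :: nat \<Rightarrow> bool). nbhd n x). meager (A \<inter> V)}"
  have "countable I" using countable_nbhds by (rule countable_subset[rotated]) (auto simp: I_def)
  then have "meager (\<Union>V\<in>I. A \<inter> V)" by (rule meager_UN) (auto simp: I_def)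
  moreover have "nowhere_dense (A - \<Union>I)"
    unfolding nowhere_dense_iff
  proof (intro allI)
    fix n and x :: "nat \<Rightarrow> bool"
    obtain m y where my: "nbhd m y \<subseteq> nbhd n x" "meager (A \<inter> nbhd m y)" using H by blast
    then have "nbhd m y \<in> I" by (auto simp: I_def)
    then show "\<exists>m y. nbhd m y \<subseteq> nbhd n x \<and> nbhd m y \<inter> (A - \<Union>I) = {}" using my(1) by blast
  qed
  ultimately have "meager ((\<Union>V\<in>I. A \<inter> V) \<union> (A - \<Union>I))"
    using meager_Un nowhere_dense_imp_meager by blast
  moreover have "A \<subseteq> (\<Union>V\<in>I. A \<inter> V) \<union> (A - \<Union>I)" by auto
  ultimately show False using assms meager_subset by blast
qed

text \<open>\<open>decided A\<close> is a form of the Baire property that is visibly closed under complements.\<close>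

definition decided :: "cantor set \<Rightarrow> bool" where
  "decided A \<longleftrightarrow> (\<forall>n x. \<exists>m y. nbhd m y \<subseteq> nbhd n x \<and> (meager (nbhd m y \<inter> A) \<or> meager (nbhd m y - A)))"

lemma decidedE:
  assumes "decided A"
  obtains m y where "nbhd m y \<subseteq> nbhd n x" "meager (nbhd m y \<inter> A) \<or> meager (nbhd m y - A)"
  using assms unfolding decided_def by blast

lemma decided_Compl: "decided A \<Longrightarrow> decided (- A)"
  unfolding decided_def Diff_eq by (auto simp: Un_commute disj_commute)

lemma decided_open: "open U \<Longrightarrow> decided U"
  unfolding decided_def
proof (intro allI)
  fix n and x :: "nat \<Rightarrow> bool" assume U: "open U"
  show "\<exists>m y. nbhd m y \<subseteq> nbhd n x \<and> (meager (nbhd m y \<inter> U) \<or> meager (nbhd m y - U))"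
  proof (cases "nbhd n x \<inter> U = {}")
    case True then show ?thesis by (intro exI[of _ n] exI[of _ x]) simp
  next
    case False
    then obtain y where y: "y \<in> nbhd n x \<inter> U" by blast
    obtain m where m: "nbhd m y \<subseteq> nbhd n x \<inter> U" using open_imp_nbhd[OF open_Int[OF open_nbhd U] y] by blast
    then have "nbhd m y - U = {}" by blast
    then have "meager (nbhd m y - U)" by (metis meager_empty)
    then show ?thesis using m by blast
  qed
qed

text \<open>Either some \<open>A i\<close> is comeager in a smaller neighbourhood, which settles the
  union, or every \<open>A i\<close> is meager in all of \<open>nbhd n x\<close>: a non-meager trace
  would be non-meager throughout a smaller neighbourhood, and deciding \<open>A i\<close> there
  gives the first case.\<close>

lemma decided_UN:
  assumes "\<And>n::nat. decided (A n)"
  shows "decided (\<Union>n. A n)"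
  unfolding decided_def
proof (intro allI)
  fix n and x :: "nat \<Rightarrow> bool"
  show "\<exists>m y. nbhd m y \<subseteq> nbhd n x \<and>
      (meager (nbhd m y \<inter> (\<Union>n. A n)) \<or> meager (nbhd m y - (\<Union>n. A n)))"
  proof (cases "\<exists>i m y. nbhd m y \<subseteq> nbhd n x \<and> meager (nbhd m y - A i)")
    case True
    then obtain i m y where *: "nbhd m y \<subseteq> nbhd n x" "meager (nbhd m y - A i)" by blast
    have "meager (nbhd m y - (\<Union>n. A n))" by (rule meager_subset[OF *(2)]) auto
    then show ?thesis using *(1) by blast
  next
    case False
    have "meager (nbhd n x \<inter> A i)" for i
    proof (rule ccontr)
      assume "\<not> meager (nbhd n x \<inter> A i)"
      then obtain n' x' where loc: "\<And>m y. nbhd m y \<subseteq> nbhd n' x' \<Longrightarrow> \<not> meager (nbhd n x \<inter> A i \<inter> nbhd m y)"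
        using not_meager_localize by blast
      have "nbhd n x \<inter> nbhd n' x' \<noteq> {}"
        using loc[of n' x'] by (metis Int_assoc Int_commute inf_bot_left meager_empty order_refl)
      then obtain y where y: "y \<in> nbhd n x" "y \<in> nbhd n' x'" by blast
      have sub: "nbhd (max n n') y \<subseteq> nbhd n x" "nbhd (max n n') y \<subseteq> nbhd n' x'"
        using nbhd_max_subset[OF y] by auto
      obtain m z where mz: "nbhd m z \<subseteq> nbhd (max n n') y"
        "meager (nbhd m z \<inter> A i) \<or> meager (nbhd m z - A i)" by (rule decidedE[OF assms[of i]])
      have "meager (nbhd m z \<inter> A i)" using mz sub(1) False by blast
      moreover have "nbhd n x \<inter> A i \<inter> nbhd m z \<subseteq> nbhd m z \<inter> A i" by blast
      ultimately show False using loc[of m z] mz(1) sub(2) meager_subset by blast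
    qed
    then have "meager (\<Union>i. nbhd n x \<inter> A i)" by (rule meager_UN_nat)
    then have "meager (nbhd n x \<inter> (\<Union>i. A i))" by (rule meager_subset) blast
    then show ?thesis by blast
  qed
qed

lemma decided_baire_property: "baire_property A \<Longrightarrow> decided A"
proof -
  assume "baire_property A"
  then obtain U where U: "open U" "meager ((A - U) \<union> (U - A))" by (auto simp: baire_property_def)
  show "decided A"
    unfolding decided_def
  proof (intro allI)
    fix n and x :: "nat \<Rightarrow> bool"
    show "\<exists>m y. nbhd m y \<subseteq> nbhd n x \<and> (meager (nbhd m y \<inter> A) \<or> meager (nbhd m y - A))"
    proof (cases "nbhd n x \<inter> U = {}")
      case True
      then have "nbhd n x \<inter> A \<subseteq> (A - U) \<union> (U - A)" by blast
      then show ?thesis using U(2) meager_subset by blast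
    next
      case False
      then obtain y where y: "y \<in> nbhd n x \<inter> U" by blast
      obtain m where m: "nbhd m y \<subseteq> nbhd n x \<inter> U"
        using open_imp_nbhd[OF open_Int[OF open_nbhd U(1)] y] by blast
      then have "nbhd m y - A \<subseteq> (A - U) \<union> (U - A)" by blast
      then show ?thesis using m U(2) meager_subset by blast
    qed
  qed
qed

lemma decided_sigma_sets:
  "A \<in> sigma_sets UNIV {U. open U} \<Longrightarrow> decided (f -` A)" if f: "continuous_on UNIV f"
proof (induction rule: sigma_sets.induct)
  case (Basic a)
  then show ?case by (intro decided_open open_vimage f) auto
next
  case Empty
  then show ?case by (auto intro: decided_open)
next
  case (Compl a)
  then show ?case by (simp add: Compl_eq_Diff_UNIV[symmetric] vimage_Compl decided_Compl)
next
  case (Union a)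
  then show ?case by (simp add: vimage_UN decided_UN)
qed

lemma decided_Int: "decided A \<Longrightarrow> decided B \<Longrightarrow> decided (A \<inter> B)"
proof -
  assume "decided A" "decided B"
  then have "decided (\<Union>n::nat. if n = 0 then - A else - B)"
    by (intro decided_UN) (auto intro: decided_Compl)
  moreover have "(\<Union>n::nat. if n = 0 then - A else - B) = - (A \<inter> B)"
    by (auto split: if_splits)
  ultimately show "decided (A \<inter> B)" using decided_Compl by fastforce
qed

text \<open>Where \<open>A\<close> is non-meager in every smaller neighbourhood,
  \<open>decided\<close> can only choose its second alternative.\<close>

lemma decided_not_meager:
  assumes "decided A" "\<not> meager (A \<inter> nbhd n x)"
  shows "\<exists>m y. nbhd m y \<subseteq> nbhd n x \<and> meager (nbhd m y - A)"
proof -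
  obtain n' x' where loc: "\<And>m y. nbhd m y \<subseteq> nbhd n' x' \<Longrightarrow> \<not> meager (A \<inter> nbhd n x \<inter> nbhd m y)"
    using not_meager_localize[OF assms(2)] by blast
  have "nbhd n x \<inter> nbhd n' x' \<noteq> {}"
    using loc[of n' x'] by (metis Int_assoc Int_commute inf_bot_left meager_empty order_refl)
  then obtain y where y: "y \<in> nbhd n x" "y \<in> nbhd n' x'" by blast
  have sub: "nbhd (max n n') y \<subseteq> nbhd n x" "nbhd (max n n') y \<subseteq> nbhd n' x'"
    using nbhd_max_subset[OF y] by auto
  obtain m z where mz: "nbhd m z \<subseteq> nbhd (max n n') y"
    "meager (nbhd m z \<inter> A) \<or> meager (nbhd m z - A)" by (rule decidedE[OF assms(1)])
  have "\<not> meager (nbhd m z \<inter> A)"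
  proof
    assume "meager (nbhd m z \<inter> A)"
    moreover have "A \<inter> nbhd n x \<inter> nbhd m z \<subseteq> nbhd m z \<inter> A" by blast
    ultimately show False using loc[of m z] mz(1) sub(2) meager_subset by blast
  qed
  then show ?thesis using mz sub(1) by blast
qed

section \<open>Prefix replacement and the Kuratowski-Ulam theorem\<close>

definition mix :: "nat \<Rightarrow> (nat \<Rightarrow> 'b) \<Rightarrow> (nat \<Rightarrow> 'b) \<Rightarrow> nat \<Rightarrow> 'b" where
  "mix n x y = (\<lambda>j. if j < n then x j else y j)"

lemma mix_in_nbhd: "m \<le> n \<Longrightarrow> x \<in> nbhd m u \<Longrightarrow> mix n x y \<in> nbhd m u"
  by (auto simp: mix_def nbhd_def)

text \<open>Prefixing is continuous and open onto \<open>nbhd n x\<close>, and preimages of nowhere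
  dense sets under such maps are nowhere dense.\<close>

lemma meager_vimage_mix:
  fixes A :: "cantor set"
  assumes "meager A"
  shows "meager {y. mix n x y \<in> A}"
proof -
  have nd: "nowhere_dense {y. mix n x y \<in> B}" if B: "nowhere_dense B" for B
    unfolding nowhere_dense_iff
  proof (intro allI)
    fix m u
    let ?m = "max m n"
    obtain m' v where v: "nbhd m' v \<subseteq> nbhd ?m (mix n x u)" "nbhd m' v \<inter> B = {}"
      using B unfolding nowhere_dense_iff by blast
    let ?M = "max m' ?m"
    have vin: "v \<in> nbhd ?m (mix n x u)" using v(1) nbhd_self by blast
    have "nbhd ?M (mix n u v) \<subseteq> nbhd m u"
    proof (rule nbhd_mono)
      show "mix n u v \<in> nbhd m u" using vin by (auto simp: nbhd_def mix_def)
    qed simp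
    moreover have "mix n x y \<notin> B" if y: "y \<in> nbhd ?M (mix n u v)" for y
    proof -
      have "mix n x y \<in> nbhd m' v" using y vin by (auto simp: nbhd_def mix_def split: if_splits)
      then show ?thesis using v(2) by blast
    qed
    ultimately show "\<exists>m' y. nbhd m' y \<subseteq> nbhd m u \<and> nbhd m' y \<inter> {y. mix n x y \<in> B} = {}" by blast
  qed
  obtain N where N: "\<forall>i::nat. nowhere_dense (N i)" "A = (\<Union>i. N i)"
    using assms by (auto simp: meager_def)
  have "{y. mix n x y \<in> A} = (\<Union>i. {y. mix n x y \<in> N i})" using N(2) by auto
  moreover have "meager (\<Union>i. {y. mix n x y \<in> N i})"
    by (intro meager_UN_nat nowhere_dense_imp_meager nd) (use N(1) in auto)
  ultimately show ?thesis by simp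
qed

text \<open>Interleaving codes the plane in Cantor space; the flag makes both orders of the coordinates available.\<close>

definition join :: "bool \<Rightarrow> (nat \<Rightarrow> 'b) \<Rightarrow> (nat \<Rightarrow> 'b) \<Rightarrow> nat \<Rightarrow> 'b" where
  "join b z w = (\<lambda>j. if even j = b then z (j div 2) else w (j div 2))"

lemma join_flip: "join (\<not> b) z w = join b w z"
  by (auto simp: join_def fun_eq_iff)

text \<open>\<open>E i V\<close> collects the \<open>w\<close> for which the section of
  \<open>N i\<close> is dense in \<open>V\<close>. Each such set is nowhere dense, only countably
  many basic \<open>V\<close> occur, and for \<open>w\<close> outside all of them every section is
  nowhere dense.\<close>

lemma kuratowski_ulam:
  fixes A :: "cantor set"
  assumes "meager A"
  shows "meager {w. \<not> meager {z. join b z w \<in> A}}"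
proof -
  obtain N where N: "\<forall>i::nat. nowhere_dense (N i)" "A = (\<Union>i. N i)"
    using assms by (auto simp: meager_def)
  define E where "E i V = {w. \<forall>m y. nbhd m y \<subseteq> V \<longrightarrow> (\<exists>z\<in>nbhd m y. join b z w \<in> N i)}" for i V
  have nd: "nowhere_dense (E i (nbhd n x))" for i n x
    unfolding nowhere_dense_iff
  proof (intro allI)
    fix n' u
    \<comment> \<open>An interleaved prefix of this length fixes \<open>max n n'\<close> coordinates
      of both factors, so the point \<open>v\<close> splits into \<open>z0\<close> near
      \<open>x\<close> and \<open>w0\<close> near \<open>u\<close>.\<close>
    let ?k = "2 * max n n'"
    obtain m v where v: "nbhd m v \<subseteq> nbhd ?k (join b x u)" "nbhd m v \<inter> N i = {}"
      using N(1) unfolding nowhere_dense_iff by blast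
    define z0 where "z0 = (\<lambda>j. v (2 * j + (if b then 0 else 1)))"
    define w0 where "w0 = (\<lambda>j. v (2 * j + (if b then 1 else 0)))"
    have v_eq: "v = join b z0 w0"
      by (auto simp: join_def z0_def w0_def fun_eq_iff elim!: evenE oddE)
    have vin: "v \<in> nbhd ?k (join b x u)" using v(1) nbhd_self by blast
    have "z0 j = x j" if "j < n" for j
    proof -
      have "v (2 * j + (if b then 0 else 1)) = join b x u (2 * j + (if b then 0 else 1))"
        using vin that by (auto simp: nbhd_def)
      then show ?thesis by (auto simp: z0_def join_def)
    qed
    then have z0: "z0 \<in> nbhd n x" by (simp add: nbhd_def)
    have "w0 j = u j" if "j < n'" for j
    proof -
      have "v (2 * j + (if b then 1 else 0)) = join b x u (2 * j + (if b then 1 else 0))"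
        using vin that by (auto simp: nbhd_def)
      then show ?thesis by (auto simp: w0_def join_def)
    qed
    then have w0: "w0 \<in> nbhd n' u" by (simp add: nbhd_def)
    let ?M = "max m (max n n')"
    have J: "join b z w \<notin> N i" if "z \<in> nbhd ?M z0" "w \<in> nbhd ?M w0" for z w
    proof -
      have "join b z w j = v j" if "j < m" for j
      proof -
        have "j div 2 < ?M" using that by linarith
        then have "z (j div 2) = z0 (j div 2)" "w (j div 2) = w0 (j div 2)"
          using \<open>z \<in> nbhd ?M z0\<close> \<open>w \<in> nbhd ?M w0\<close> by (auto simp: nbhd_def)
        then show ?thesis by (simp add: v_eq join_def)
      qed
      then have "join b z w \<in> nbhd m v" by (simp add: nbhd_def)
      then show ?thesis using v(2) by blast
    qed
    have "nbhd ?M z0 \<subseteq> nbhd n x" using z0 by (intro nbhd_mono) auto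
    then have "w \<notin> E i (nbhd n x)" if "w \<in> nbhd ?M w0" for w
      using J that unfolding E_def by blast
    then have "nbhd ?M w0 \<inter> E i (nbhd n x) = {}" by blast
    moreover have "nbhd ?M w0 \<subseteq> nbhd n' u" using w0 by (intro nbhd_mono) auto
    ultimately show "\<exists>m y. nbhd m y \<subseteq> nbhd n' u \<and> nbhd m y \<inter> E i (nbhd n x) = {}" by blast
  qed
  have "meager (\<Union>i. \<Union>V\<in>range (\<lambda>(n, x). nbhd n x). E i V)"
    by (intro meager_UN_nat meager_UN countable_nbhds) (use nd nowhere_dense_imp_meager in auto)
  moreover have "meager {z. join b z w \<in> A}" if w: "w \<notin> (\<Union>i. \<Union>V\<in>range (\<lambda>(n, x). nbhd n x). E i V)" for w
  proof -
    have "nowhere_dense {z. join b z w \<in> N i}" for i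
      unfolding nowhere_dense_iff
    proof (intro allI)
      fix n x
      have "w \<notin> E i (nbhd n x)" using w by auto
      then show "\<exists>m y. nbhd m y \<subseteq> nbhd n x \<and> nbhd m y \<inter> {z. join b z w \<in> N i} = {}"
        by (fastforce simp: E_def)
    qed
    then have "meager (\<Union>i. {z. join b z w \<in> N i})" by (intro meager_UN_nat nowhere_dense_imp_meager)
    then show ?thesis using N(2) by (simp add: Collect_ex_eq)
  qed
  then have "{w. \<not> meager {z. join b z w \<in> A}} \<subseteq> (\<Union>i. \<Union>V\<in>range (\<lambda>(n, x). nbhd n x). E i V)" by blast
  ultimately show ?thesis by (rule meager_subset)
qed

section \<open>Analytic sets and separation\<close>

text \<open>Analytic sets as projections of closed sets along Baire space: this form is closed under
  continuous preimages in arbitrary topological spaces.\<close>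

definition suslin :: "'a::topological_space set \<Rightarrow> bool" where
  "suslin A \<longleftrightarrow> (\<exists>K :: ('a \<times> baire) set. closed K \<and> A = fst ` K)"

lemma suslin_closed: "closed A \<Longrightarrow> suslin A"
  unfolding suslin_def
  by (intro exI[of _ "A \<times> UNIV"]) (auto intro: closed_Times)

lemma suslin_vimage:
  fixes g :: "'a::topological_space \<Rightarrow> 'b::topological_space"
  assumes "suslin A" "continuous_on UNIV g"
  shows "suslin (g -` A)"
proof -
  obtain K :: "('b \<times> baire) set" where K: "closed K" "A = fst ` K"
    using assms(1) by (auto simp: suslin_def)
  have "continuous_on UNIV (\<lambda>p::'a \<times> baire. (g (fst p), snd p))"
    by (intro continuous_intros continuous_on_compose2[OF assms(2)]) auto
  then have "closed ((\<lambda>p. (g (fst p), snd p)) -` K)" by (rule closed_vimage[OF K(1)])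
  moreover have "g -` A = fst ` ((\<lambda>p. (g (fst p), snd p)) -` K)"
  proof (intro set_eqI iffI)
    fix x assume "x \<in> g -` A"
    then obtain \<gamma> where "(g x, \<gamma>) \<in> K" using K(2) by auto
    then have "(x, \<gamma>) \<in> (\<lambda>p. (g (fst p), snd p)) -` K" by simp
    then show "x \<in> fst ` ((\<lambda>p. (g (fst p), snd p)) -` K)" by (rule image_eqI[rotated]) simp
  next
    fix x assume "x \<in> fst ` ((\<lambda>p. (g (fst p), snd p)) -` K)"
    then obtain \<gamma> where "(g x, \<gamma>) \<in> K" by auto
    then have "g x \<in> fst ` K" by (intro image_eqI[of _ _ "(g x, \<gamma>)"]) auto
    then show "x \<in> g -` A" using K(2) by simp
  qed
  ultimately show ?thesis unfolding suslin_def by blast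
qed

lemma continuous_coord: "continuous_on UNIV (\<lambda>p. snd p i :: 'b::topological_space)"
  for i :: 'i
  by (rule continuous_on_compose2[OF continuous_on_product_coordinates[of i] continuous_on_snd[OF continuous_on_id]]) auto

text \<open>The first entry of the code names one of the sets; the shifted code is the witness for
  it.\<close>

lemma suslin_UN_nat:
  assumes "\<And>n::nat. suslin (A n)"
  shows "suslin (\<Union>n. A n)"
proof -
  obtain K :: "nat \<Rightarrow> ('a \<times> baire) set" where K: "\<And>n. closed (K n)" "\<And>n. A n = fst ` K n"
    using assms unfolding suslin_def by metis
  let ?f = "\<lambda>p :: 'a \<times> baire. (fst p, \<lambda>m. snd p (Suc m))"
  have cf: "continuous_on UNIV ?f"
    by (intro continuous_intros continuous_on_coordinatewise_then_product continuous_coord)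
  have "closed (\<Inter>n. ((\<lambda>p. snd p 0) -` (- {n})) \<union> ?f -` K n)"
    by (intro closed_INT ballI closed_Un closed_vimage K cf continuous_coord)
       (auto simp: closed_def open_discrete)
  moreover have "(\<Union>n. A n) = fst ` (\<Inter>n. ((\<lambda>p. snd p 0) -` (- {n})) \<union> ?f -` K n)"
  proof safe
    fix n x assume "x \<in> A n"
    then obtain \<gamma> where \<gamma>: "(x, \<gamma>) \<in> K n" using K(2) by auto
    have "(x, case_nat n \<gamma>) \<in> (\<Inter>n. ((\<lambda>p. snd p 0) -` (- {n})) \<union> ?f -` K n)" using \<gamma> by auto
    then show "x \<in> fst ` (\<Inter>n. ((\<lambda>p. snd p 0) -` (- {n})) \<union> ?f -` K n)"
      by (rule image_eqI[rotated]) simp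
  next
    fix x \<gamma> assume "(x, \<gamma>) \<in> (\<Inter>n. ((\<lambda>p. snd p 0) -` (- {n})) \<union> ?f -` K n)"
    then have "(x, \<lambda>m. \<gamma> (Suc m)) \<in> K (\<gamma> 0)" by auto
    then show "fst (x, \<gamma>) \<in> (\<Union>n. A n)" using K(2) by force
  qed
  ultimately show ?thesis unfolding suslin_def by blast
qed

text \<open>One code packs witnesses for all the sets, as the rows given by
  \<open>prod_encode\<close>.\<close>

lemma suslin_INT_nat:
  assumes "\<And>n::nat. suslin (A n)"
  shows "suslin (\<Inter>n. A n)"
proof -
  obtain K :: "nat \<Rightarrow> ('a \<times> baire) set" where K: "\<And>n. closed (K n)" "\<And>n. A n = fst ` K n"
    using assms unfolding suslin_def by metis
  let ?f = "\<lambda>n (p :: 'a \<times> baire). (fst p, \<lambda>m. snd p (prod_encode (n, m)))"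
  have cf: "continuous_on UNIV (?f n)" for n
    by (intro continuous_intros continuous_on_coordinatewise_then_product continuous_coord)
  have "closed (\<Inter>n. ?f n -` K n)"
    by (intro closed_INT ballI closed_vimage K cf)
  moreover have "(\<Inter>n. A n) = fst ` (\<Inter>n. ?f n -` K n)"
  proof safe
    fix x assume "x \<in> (\<Inter>n. A n)"
    then have "\<forall>n. \<exists>\<gamma>. (x, \<gamma>) \<in> K n" using K(2) by force
    then obtain \<gamma> where \<gamma>: "\<And>n. (x, \<gamma> n) \<in> K n" by metis
    have "(x, \<lambda>i. \<gamma> (fst (prod_decode i)) (snd (prod_decode i))) \<in> (\<Inter>n. ?f n -` K n)"
      using \<gamma> by simp
    then show "x \<in> fst ` (\<Inter>n. ?f n -` K n)" by (rule image_eqI[rotated]) simp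
  next
    fix x \<gamma> n assume "(x, \<gamma>) \<in> (\<Inter>n. ?f n -` K n)"
    then have "(x, \<lambda>m. \<gamma> (prod_encode (n, m))) \<in> K n" by auto
    then show "fst (x, \<gamma>) \<in> A n" using K(2) by force
  qed
  ultimately show ?thesis unfolding suslin_def by blast
qed

lemma suslin_Int: "suslin A \<Longrightarrow> suslin B \<Longrightarrow> suslin (A \<inter> B)"
proof -
  assume "suslin A" "suslin B"
  then have "suslin (\<Inter>n::nat. if n = 0 then A else B)" by (intro suslin_INT_nat) auto
  moreover have "(\<Inter>n::nat. if n = 0 then A else B) = A \<inter> B"
    by (auto split: if_splits)
  ultimately show ?thesis by simp
qed

lemma suslin_UN_countable:
  assumes "\<And>i::'i::countable. suslin (A i)"
  shows "suslin (\<Union>i. A i)"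
proof -
  have "suslin (\<Union>n. A (from_nat n))" by (intro suslin_UN_nat assms)
  moreover have "(\<Union>n. A (from_nat n)) = (\<Union>i. A i)" by auto (metis from_nat_to_nat)
  ultimately show ?thesis by simp
qed

lemma join_simps [simp]:
  "join True z w (2 * m) = z m" "join True z w (Suc (2 * m)) = w m"
  by (auto simp: join_def)

text \<open>Even entries of the code describe \<open>y\<close> through \<open>h\<close>, odd entries
  are the witness for \<open>A\<close>.\<close>

lemma suslin_Ex:
  fixes A :: "('a::topological_space \<times> 'b::topological_space) set" and h :: "baire \<Rightarrow> 'b"
  assumes "suslin A" and h: "continuous_on UNIV h" "surj h"
  shows "suslin {x. \<exists>y. (x, y) \<in> A}"
proof -
  obtain K :: "(('a \<times> 'b) \<times> baire) set" where K: "closed K" "A = fst ` K"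
    using assms(1) by (auto simp: suslin_def)
  let ?f = "\<lambda>p :: 'a \<times> baire. ((fst p, h (\<lambda>m. snd p (2 * m))), \<lambda>m. snd p (Suc (2 * m)))"
  have "continuous_on UNIV ?f"
    by (intro continuous_intros continuous_on_compose2[OF h(1)]
        continuous_on_coordinatewise_then_product continuous_coord) auto
  then have "closed (?f -` K)" by (rule closed_vimage[OF K(1)])
  moreover have "{x. \<exists>y. (x, y) \<in> A} = fst ` (?f -` K)"
  proof (intro set_eqI iffI)
    fix x assume "x \<in> {x. \<exists>y. (x, y) \<in> A}"
    then obtain y where "(x, y) \<in> A" by blast
    then obtain \<gamma> where \<gamma>: "((x, y), \<gamma>) \<in> K" using K(2) by force
    obtain \<delta> where "y = h \<delta>" using h(2) by blast
    then have "(x, join True \<delta> \<gamma>) \<in> ?f -` K" using \<gamma> by simp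
    then show "x \<in> fst ` (?f -` K)" by (rule image_eqI[rotated]) simp
  next
    fix x assume "x \<in> fst ` (?f -` K)"
    then obtain \<gamma> where "((x, h (\<lambda>m. \<gamma> (2 * m))), \<lambda>m. \<gamma> (Suc (2 * m))) \<in> K" by auto
    then have "(x, h (\<lambda>m. \<gamma> (2 * m))) \<in> fst ` K" by (rule image_eqI[rotated]) simp
    then show "x \<in> {x. \<exists>y. (x, y) \<in> A}" using K(2) by auto
  qed
  ultimately show ?thesis unfolding suslin_def by blast
qed

text \<open>The graph of a continuous map into Baire space is closed, so the image is a
  projection.\<close>

lemma suslin_image:
  fixes f :: "'b::topological_space \<Rightarrow> baire" and h :: "baire \<Rightarrow> 'b"
  assumes "suslin A" and f: "continuous_on UNIV f" and h: "continuous_on UNIV h" "surj h"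
  shows "suslin (f ` A)"
proof -
  have "suslin ((snd :: baire \<times> 'b \<Rightarrow> 'b) -` A)"
    by (rule suslin_vimage[OF assms(1)]) (intro continuous_intros)
  moreover have "closed {p :: baire \<times> 'b. fst p = f (snd p)}"
  proof -
    have "closed (\<Inter>n. {p :: baire \<times> 'b. fst p n = f (snd p) n})"
      by (intro closed_INT ballI closed_Collect_eq
          continuous_on_compose2[OF continuous_on_product_coordinates continuous_on_fst[OF continuous_on_id]]
          continuous_on_compose2[OF continuous_on_product_then_coordinatewise[OF f]
            continuous_on_snd[OF continuous_on_id]]) auto
    moreover have "{p :: baire \<times> 'b. fst p = f (snd p)} = (\<Inter>n. {p. fst p n = f (snd p) n})"
      by (auto simp: fun_eq_iff)
    ultimately show ?thesis by simp
  qed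
  ultimately have "suslin (snd -` A \<inter> {p :: baire \<times> 'b. fst p = f (snd p)})"
    using suslin_Int suslin_closed by blast
  from suslin_Ex[OF this h] show ?thesis
    by (rule back_subst[of suslin]) auto
qed

text \<open>Certificates and configurations are families of points of Baire space over countable
  index types. Rearranging coordinates makes the space of such families a continuous image of Baire
  space, which is what projections and images along it require.\<close>

lemma baire_code2:
  "continuous_on UNIV (\<lambda>\<gamma> :: nat \<Rightarrow> nat. \<lambda>(i::'i::countable) n::nat. \<gamma> (to_nat (i, n)))"
  "surj (\<lambda>\<gamma> :: nat \<Rightarrow> nat. \<lambda>(i::'i::countable) n::nat. \<gamma> (to_nat (i, n)))"
proof -
  show "continuous_on UNIV (\<lambda>\<gamma> :: nat \<Rightarrow> nat. \<lambda>(i::'i::countable) n::nat. \<gamma> (to_nat (i, n)))"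
    by (intro continuous_on_coordinatewise_then_product continuous_on_product_coordinates)
  show "surj (\<lambda>\<gamma> :: nat \<Rightarrow> nat. \<lambda>(i::'i::countable) n::nat. \<gamma> (to_nat (i, n)))"
    by (rule surjI[of _ "\<lambda>u i. case from_nat i of (a, b) \<Rightarrow> u a b"]) simp
qed

lemma baire_code3:
  "continuous_on UNIV (\<lambda>\<gamma> :: nat \<Rightarrow> nat. \<lambda>(i::'i::countable) (j::'j::countable) n::nat. \<gamma> (to_nat (i, j, n)))"
  "surj (\<lambda>\<gamma> :: nat \<Rightarrow> nat. \<lambda>(i::'i::countable) (j::'j::countable) n::nat. \<gamma> (to_nat (i, j, n)))"
proof -
  show "continuous_on UNIV (\<lambda>\<gamma> :: nat \<Rightarrow> nat. \<lambda>(i::'i::countable) (j::'j::countable) n::nat. \<gamma> (to_nat (i, j, n)))"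
    by (intro continuous_on_coordinatewise_then_product continuous_on_product_coordinates)
  show "surj (\<lambda>\<gamma> :: nat \<Rightarrow> nat. \<lambda>(i::'i::countable) (j::'j::countable) n::nat. \<gamma> (to_nat (i, j, n)))"
    by (rule surjI[of _ "\<lambda>u i. case from_nat i of (a, b, c) \<Rightarrow> u a b c"]) simp
qed

lemma analytic_in_image_suslin:
  fixes A :: "baire set"
  assumes "suslin A" "continuous_map euclidean Z g"
  shows "analytic_in Z (g ` A)"
proof -
  obtain K :: "(baire \<times> baire) set" where K: "closed K" "A = fst ` K"
    using assms(1) by (auto simp: suslin_def)
  let ?e = "\<lambda>\<gamma> :: nat \<Rightarrow> nat. \<lambda>m. \<gamma> (2 * m)"
  let ?f = "\<lambda>\<gamma> :: nat \<Rightarrow> nat. (?e \<gamma>, \<lambda>m. \<gamma> (Suc (2 * m)))"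
  have ce: "continuous_on UNIV ?e"
    by (intro continuous_on_coordinatewise_then_product continuous_on_product_coordinates)
  have "continuous_on UNIV ?f"
    by (intro continuous_intros ce continuous_on_coordinatewise_then_product continuous_on_product_coordinates)
  then have "closed (?f -` K)" by (rule closed_vimage[OF K(1)])
  moreover have "continuous_map (top_of_set (?f -` K)) Z (g \<circ> ?e)"
  proof (rule continuous_map_compose[OF _ assms(2)])
    show "continuous_map (top_of_set (?f -` K)) euclidean ?e"
      using ce continuous_on_subset by (auto simp: continuous_map_iff_continuous)
  qed
  moreover have "(g \<circ> ?e) ` (?f -` K) = g ` A"
  proof safe
    fix \<gamma> assume "?f \<gamma> \<in> K"
    then have "?e \<gamma> \<in> A" using K(2) by force
    then show "(g \<circ> ?e) \<gamma> \<in> g ` A" by simp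
  next
    fix x assume "x \<in> A"
    then obtain \<gamma> where "(x, \<gamma>) \<in> K" using K(2) by force
    then have "join True x \<gamma> \<in> ?f -` K" by simp
    moreover have "g x = (g \<circ> ?e) (join True x \<gamma>)" by simp
    ultimately show "g x \<in> (g \<circ> ?e) ` (?f -` K)" by (intro image_eqI[where x = "join True x \<gamma>"]) simp_all
  qed
  ultimately show ?thesis unfolding analytic_in_def
    by (intro exI[of _ "?f -` K"] exI[of _ "g \<circ> ?e"] conjI)
qed

section \<open>Lusin separation and reflection\<close>

lemma borel_in_sigma_algebra: "sigma_algebra (topspace Z) {D. borel_in Z D}"
proof -
  have "{D. borel_in Z D} = sigma_sets (topspace Z) {U. openin Z U}" by (auto simp: borel_in_def)
  moreover have "sigma_algebra (topspace Z) (sigma_sets (topspace Z) {U. openin Z U})"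
    by (intro sigma_algebra_sigma_sets) (auto dest: openin_subset)
  ultimately show ?thesis by simp
qed

lemma borel_in_openin: "openin Z U \<Longrightarrow> borel_in Z U"
  by (auto simp: borel_in_def)

text \<open>Separability passes to countable unions on both sides. So if \<open>A\<close> and
  \<open>B\<close> are inseparable, one can fix one more coordinate at a time on both sides and keep
  inseparable images. The limit points have distinct images by disjointness, and Hausdorff
  neighbourhoods of these separate the images at some finite stage.\<close>

lemma lusin_separation:
  assumes Z: "Hausdorff_space Z" and A: "analytic_in Z A" and B: "analytic_in Z B" and disj: "A \<inter> B = {}"
  shows "\<exists>D. borel_in Z D \<and> A \<subseteq> D \<and> B \<inter> D = {}"
proof (rule ccontr)
  assume contra: "\<not> ?thesis"
  interpret sigma_algebra "topspace Z" "{D. borel_in Z D}" by (rule borel_in_sigma_algebra)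
  obtain F :: "baire set" and f where F: "closed F" "continuous_map (top_of_set F) Z f" "f ` F = A"
    using A by (auto simp: analytic_in_def)
  obtain G :: "baire set" and g where G: "closed G" "continuous_map (top_of_set G) Z g" "g ` G = B"
    using B by (auto simp: analytic_in_def)
  define sep where "sep P Q \<longleftrightarrow> (\<exists>D. borel_in Z D \<and> P \<subseteq> D \<and> Q \<inter> D = {})" for P Q
  have sep_UN: "sep (\<Union>a. P a) (\<Union>b. Q b)" if H: "\<And>a b. sep (P a) (Q b)" for P Q :: "nat \<Rightarrow> 'a set"
  proof -
    obtain D where D: "\<And>a b. borel_in Z (D a b)" "\<And>a b. P a \<subseteq> D a b" "\<And>a b. Q b \<inter> D a b = {}"
      using H unfolding sep_def by metis
    have "(\<Inter>b. D a b) \<in> {D. borel_in Z D}" for a by (rule countable_INT) (use D in auto)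
    then have "(\<Union>a. \<Inter>b. D a b) \<in> {D. borel_in Z D}" by (intro countable_nat_UN) auto
    then have "borel_in Z (\<Union>a. \<Inter>b. D a b)" by simp
    moreover have "P a \<subseteq> (\<Inter>b. D a b)" for a by (intro INT_greatest D(2))
    then have "(\<Union>a. P a) \<subseteq> (\<Union>a. \<Inter>b. D a b)" by (intro UN_mono) auto
    moreover have D3: "x \<notin> D a b" if "x \<in> Q b" for a b x using D(3) that by blast
    have "(\<Union>b. Q b) \<inter> (\<Union>a. \<Inter>b. D a b) = {}" using D3 by (simp add: disjoint_iff) metis
    ultimately show ?thesis unfolding sep_def by blast
  qed
  define bad where "bad n x y \<longleftrightarrow> \<not> sep (f ` (F \<inter> nbhd n x)) (g ` (G \<inter> nbhd n y))" for n x y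
  have split: "nbhd n x = (\<Union>a. nbhd (Suc n) (x(n := a)))" for n and x :: "nat \<Rightarrow> nat"
    by (auto simp: nbhd_def less_Suc_eq)
  have step: "\<exists>a b. bad (Suc n) (x(n := a)) (y(n := b))" if "bad n x y" for n x y
  proof (rule ccontr)
    assume "\<not> ?thesis"
    then have "sep (\<Union>a. f ` (F \<inter> nbhd (Suc n) (x(n := a)))) (\<Union>b. g ` (G \<inter> nbhd (Suc n) (y(n := b))))"
      by (intro sep_UN) (auto simp: bad_def)
    moreover have "(\<Union>a. f ` (F \<inter> nbhd (Suc n) (x(n := a)))) = f ` (F \<inter> nbhd n x)"
      using split[of n x] by blast
    moreover have "(\<Union>b. g ` (G \<inter> nbhd (Suc n) (y(n := b)))) = g ` (G \<inter> nbhd n y)"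
      using split[of n y] by blast
    ultimately have "sep (f ` (F \<inter> nbhd n x)) (g ` (G \<inter> nbhd n y))" by simp
    then show False using that by (simp add: bad_def)
  qed
  have bad0: "bad 0 x y" for x y
  proof -
    have "F \<inter> nbhd 0 x = F" "G \<inter> nbhd 0 y = G" by (auto simp: nbhd_def)
    then show ?thesis using contra F(3) G(3) unfolding bad_def sep_def by simp
  qed
  have "\<exists>p. \<forall>n. bad n (fst (p n)) (snd (p n)) \<and>
      (\<exists>a b. p (Suc n) = ((fst (p n))(n := a), (snd (p n))(n := b)))"
  proof (rule dependent_nat_choice)
    show "\<exists>q. bad 0 (fst q) (snd q)" using bad0 by auto
  next
    fix q :: "baire \<times> baire" and n
    assume "bad n (fst q) (snd q)"
    from step[OF this] obtain a b where "bad (Suc n) ((fst q)(n := a)) ((snd q)(n := b))" by blast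
    then show "\<exists>r. bad (Suc n) (fst r) (snd r) \<and> (\<exists>a b. r = ((fst q)(n := a), (snd q)(n := b)))"
      by (intro exI[of _ "((fst q)(n := a), (snd q)(n := b))"]) auto
  qed
  then obtain p where p: "\<And>n. bad n (fst (p n)) (snd (p n))"
    "\<And>n. \<exists>a b. p (Suc n) = ((fst (p n))(n := a), (snd (p n))(n := b))" by blast
  define \<alpha> where "\<alpha> n = fst (p (Suc n)) n" for n
  define \<beta> where "\<beta> n = snd (p (Suc n)) n" for n
  have stab: "fst (p m) j = \<alpha> j \<and> snd (p m) j = \<beta> j" if "Suc j \<le> m" for m j
    using that
  proof (induction m rule: dec_induct)
    case base then show ?case by (simp add: \<alpha>_def \<beta>_def)
  next
    case (step m)
    obtain a b where "p (Suc m) = ((fst (p m))(m := a), (snd (p m))(m := b))" using p(2) by blast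
    then show ?case using step by simp
  qed
  then have "nbhd n (fst (p n)) = nbhd n \<alpha>" "nbhd n (snd (p n)) = nbhd n \<beta>" for n
    by (auto simp: nbhd_def)
  then have badn: "bad n \<alpha> \<beta>" for n using p(1)[of n] by (simp add: bad_def)
  have "\<alpha> \<in> F"
  proof (rule ccontr)
    assume "\<alpha> \<notin> F"
    then obtain n where "nbhd n \<alpha> \<subseteq> - F" using open_imp_nbhd[of "- F" \<alpha>] F(1) by auto
    then have "F \<inter> nbhd n \<alpha> = {}" by blast
    then have "sep (f ` (F \<inter> nbhd n \<alpha>)) (g ` (G \<inter> nbhd n \<beta>))"
      unfolding sep_def using empty_sets by (intro exI[of _ "{}"]) simp
    then show False using badn by (simp add: bad_def)
  qed
  have "\<beta> \<in> G"
  proof (rule ccontr)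
    assume "\<beta> \<notin> G"
    then obtain n where "nbhd n \<beta> \<subseteq> - G" using open_imp_nbhd[of "- G" \<beta>] G(1) by auto
    then have "G \<inter> nbhd n \<beta> = {}" by blast
    moreover have "f ` (F \<inter> nbhd n \<alpha>) \<subseteq> topspace Z" using F(2) by (auto simp: continuous_map_def)
    ultimately have "sep (f ` (F \<inter> nbhd n \<alpha>)) (g ` (G \<inter> nbhd n \<beta>))"
      unfolding sep_def by (intro exI[of _ "topspace Z"]) (auto intro: borel_in_openin)
    then show False using badn by (simp add: bad_def)
  qed
  have "f \<alpha> \<noteq> g \<beta>" "f \<alpha> \<in> topspace Z" "g \<beta> \<in> topspace Z"
    using \<open>\<alpha> \<in> F\<close> \<open>\<beta> \<in> G\<close> F G disj by (auto simp: continuous_map_def)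
  then obtain U V where UV: "openin Z U" "openin Z V" "f \<alpha> \<in> U" "g \<beta> \<in> V" "disjnt U V"
    using Z unfolding Hausdorff_space_def by metis
  have near: "\<exists>n. f ` (F \<inter> nbhd n \<alpha>) \<subseteq> U"
    if "continuous_map (top_of_set F) Z f" "\<alpha> \<in> F" "openin Z U" "f \<alpha> \<in> U"
    for F :: "baire set" and f U \<alpha>
  proof -
    have "openin (top_of_set F) {x \<in> topspace (top_of_set F). f x \<in> U}"
      using that(1,3) by (rule openin_continuous_map_preimage)
    then obtain W where W: "open W" "{x \<in> F. f x \<in> U} = F \<inter> W" by (auto simp: openin_open)
    then have "\<alpha> \<in> W" using that by blast
    then obtain n where "nbhd n \<alpha> \<subseteq> W" using open_imp_nbhd W(1) by blast
    then show ?thesis using W(2) by blast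
  qed
  obtain n1 where n1: "f ` (F \<inter> nbhd n1 \<alpha>) \<subseteq> U" using near[OF F(2) \<open>\<alpha> \<in> F\<close> UV(1,3)] by blast
  obtain n2 where n2: "g ` (G \<inter> nbhd n2 \<beta>) \<subseteq> V" using near[OF G(2) \<open>\<beta> \<in> G\<close> UV(2,4)] by blast
  let ?n = "max n1 n2"
  have "f ` (F \<inter> nbhd ?n \<alpha>) \<subseteq> U"
    by (rule order_trans[OF _ n1]) (intro image_mono Int_mono nbhd_antimono; simp)
  moreover have "g ` (G \<inter> nbhd ?n \<beta>) \<subseteq> V"
    by (rule order_trans[OF _ n2]) (intro image_mono Int_mono nbhd_antimono; simp)
  ultimately have "sep (f ` (F \<inter> nbhd ?n \<alpha>)) (g ` (G \<inter> nbhd ?n \<beta>))"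
    unfolding sep_def using UV by (intro exI[of _ U]) (auto intro: borel_in_openin simp: disjnt_def)
  then show False using badn by (simp add: bad_def)
qed

lemma borel_in_euclidean_iff: "borel_in euclidean D \<longleftrightarrow> D \<in> sets borel"
  by (simp add: borel_in_def sets_borel)

text \<open>The induction carries the complement along, so that complements cost nothing and unions
  are matched by intersections. Open sets are countable unions of the closed sets of points whose
  neighbourhood of length \<open>n\<close> stays inside.\<close>

lemma suslin_borel:
  fixes D :: "baire set"
  assumes "D \<in> sets borel"
  shows "suslin D"
proof -
  have op: "suslin U" if U: "open U" for U :: "baire set"
  proof -
    have "closed {x. nbhd n x \<subseteq> U}" for n
    proof -
      have "- {x. nbhd n x \<subseteq> U} = (\<Union>x\<in>- {x. nbhd n x \<subseteq> U}. nbhd n x)"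
        by (auto simp: nbhd_def)
      also have "open \<dots>" by (intro open_UN ballI open_nbhd)
      finally show ?thesis by (simp add: closed_def)
    qed
    then have "suslin (\<Union>n. {x. nbhd n x \<subseteq> U})" by (intro suslin_UN_nat suslin_closed)
    moreover have "(\<Union>n. {x. nbhd n x \<subseteq> U}) = U" using open_imp_nbhd[OF U] nbhd_self by blast
    ultimately show ?thesis by simp
  qed
  have "D \<in> sigma_sets UNIV {U. open U}" using assms by (simp add: sets_borel)
  then have "suslin D \<and> suslin (- D)"
  proof (induction rule: sigma_sets.induct)
    case (Basic U)
    then show ?case by (auto intro: op suslin_closed)
  next
    case Empty
    then show ?case by (auto intro: suslin_closed)
  next
    case (Compl a)
    then show ?case by (simp add: Compl_eq_Diff_UNIV[symmetric])
  next
    case (Union a)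
    then have "suslin (\<Union>i. a i)" "suslin (\<Inter>i. - a i)"
      by (auto intro!: suslin_UN_nat suslin_INT_nat)
    then show ?case by simp
  qed
  then show ?thesis by blast
qed

lemma Hausdorff_baire: "Hausdorff_space (euclidean :: baire topology)"
proof -
  have "Hausdorff_space (euclidean :: nat topology)"
    unfolding Hausdorff_space_def
    by (auto simp: disjnt_def open_discrete intro!: exI[of _ "{x}" for x])
  then have "Hausdorff_space (product_topology (\<lambda>_::nat. euclidean :: nat topology) UNIV)"
    by (simp add: Hausdorff_space_product_topology)
  then show ?thesis by (simp add: euclidean_product_topology)
qed

lemma separation_suslin:
  fixes A B :: "baire set"
  assumes "suslin A" "suslin B" "A \<inter> B = {}"
  shows "\<exists>D\<in>sets borel. A \<subseteq> D \<and> B \<inter> D = {}"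
proof -
  have "analytic_in euclidean A" "analytic_in euclidean B"
    using analytic_in_image_suslin[of _ euclidean id] assms(1,2) by (auto simp: image_id[unfolded id_def])
  from lusin_separation[OF Hausdorff_baire this assms(3)] show ?thesis
    by (auto simp: borel_in_euclidean_iff)
qed

text \<open>First reflection for finitary analytic hypergraphs, one coordinate at a time.\<close>

lemma borel_independent_hull:
  fixes A :: "baire set" and H :: "nat \<Rightarrow> (nat \<Rightarrow> nat \<Rightarrow> nat) set"
  assumes A: "suslin A" and H: "\<And>M. suslin (H M)"
    and indep: "\<And>M x. x \<in> H M \<Longrightarrow> \<exists>l<M. x l \<notin> A"
  shows "\<exists>D\<in>sets borel. A \<subseteq> D \<and> (\<forall>M. \<forall>x\<in>H M. \<exists>l<M. x l \<notin> D)"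
proof -
  \<comment> \<open>After \<open>j\<close> steps the first \<open>j\<close> coordinates are
    restricted only to Borel sets \<open>Ds l\<close>, while the others are still restricted to
    \<open>A\<close>, and no hyperedge survives.\<close>
  have *: "\<exists>Ds. (\<forall>l. Ds l \<in> sets borel \<and> A \<subseteq> Ds l) \<and>
      \<not> (\<exists>x\<in>H M. (\<forall>l<j. x l \<in> Ds l) \<and> (\<forall>l. j \<le> l \<and> l < M \<longrightarrow> x l \<in> A))" if "j \<le> M" for j M
    using that
  proof (induction j)
    case 0
    then show ?case using indep by (intro exI[of _ "\<lambda>_. UNIV"]) auto
  next
    case (Suc j)
    then obtain Ds where Ds: "\<And>l. Ds l \<in> sets borel" "\<And>l. A \<subseteq> Ds l"
      "\<not> (\<exists>x\<in>H M. (\<forall>l<j. x l \<in> Ds l) \<and> (\<forall>l. j \<le> l \<and> l < M \<longrightarrow> x l \<in> A))" by auto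
    \<comment> \<open>Coordinate \<open>j\<close> is left free: the values it can take when all
      other coordinates are restricted form a Suslin set disjoint from \<open>A\<close>, to be
      separated from \<open>A\<close>.\<close>
    let ?C = "\<lambda>l. if l < j then Ds l else if j < l \<and> l < M then A else UNIV"
    let ?B = "H M \<inter> (\<Inter>l. (\<lambda>x. x l) -` ?C l)"
    have "suslin ?B"
      by (intro suslin_Int H suslin_INT_nat suslin_vimage continuous_on_product_coordinates)
         (auto intro: suslin_borel Ds A)
    then have sB: "suslin ((\<lambda>x. x j) ` ?B)"
      by (rule suslin_image[OF _ continuous_on_product_coordinates baire_code2])
    have dB: "A \<inter> (\<lambda>x. x j) ` ?B = {}"
    proof (rule ccontr)
      assume "\<not> ?thesis"
      then obtain x where x: "x \<in> ?B" "x j \<in> A" by blast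
      have C: "x l \<in> ?C l" for l using x(1) by simp
      have "(\<forall>l<j. x l \<in> Ds l) \<and> (\<forall>l. j \<le> l \<and> l < M \<longrightarrow> x l \<in> A)"
      proof (intro conjI allI impI)
        fix l assume "l < j" then show "x l \<in> Ds l" using C[of l] by simp
      next
        fix l assume "j \<le> l \<and> l < M" then show "x l \<in> A" using C[of l] x(2) by (cases "l = j") auto
      qed
      then show False using Ds(3) x(1) by blast
    qed
    obtain D where D: "D \<in> sets borel" "A \<subseteq> D" "(\<lambda>x. x j) ` ?B \<inter> D = {}"
      using separation_suslin[OF A sB dB] by (elim bexE conjE)
    show ?case
    proof (intro exI[of _ "Ds(j := D)"] conjI allI)
      show "\<not> (\<exists>x\<in>H M. (\<forall>l<Suc j. x l \<in> (Ds(j := D)) l) \<and> (\<forall>l. Suc j \<le> l \<and> l < M \<longrightarrow> x l \<in> A))"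
      proof
        assume "\<exists>x\<in>H M. (\<forall>l<Suc j. x l \<in> (Ds(j := D)) l) \<and> (\<forall>l. Suc j \<le> l \<and> l < M \<longrightarrow> x l \<in> A)"
        then obtain x where x: "x \<in> H M" "\<forall>l<Suc j. x l \<in> (Ds(j := D)) l" "\<forall>l. Suc j \<le> l \<and> l < M \<longrightarrow> x l \<in> A"
          by blast
        have "x l \<in> ?C l" for l using x(2)[rule_format, of l] x(3)[rule_format, of l] by auto
        then have "x \<in> ?B" using x(1) by simp
        moreover have "x j \<in> D" using x(2)[rule_format, of j] by simp
        ultimately show False using D(3) by blast
      qed
    qed (use Ds D in auto)
  qed
  have "\<forall>M. \<exists>Ds. (\<forall>l. Ds l \<in> sets borel \<and> A \<subseteq> Ds l) \<and> \<not> (\<exists>x\<in>H M. \<forall>l<M. x l \<in> Ds l)"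
  proof
    fix M
    obtain Ds where "\<forall>l. Ds l \<in> sets borel \<and> A \<subseteq> Ds l"
      "\<not> (\<exists>x\<in>H M. (\<forall>l<M. x l \<in> Ds l) \<and> (\<forall>l. M \<le> l \<and> l < M \<longrightarrow> x l \<in> A))" using *[of M M] by blast
    then show "\<exists>Ds. (\<forall>l. Ds l \<in> sets borel \<and> A \<subseteq> Ds l) \<and> \<not> (\<exists>x\<in>H M. \<forall>l<M. x l \<in> Ds l)"
      by (intro exI[of _ Ds]) auto
  qed
  then obtain Ds where Ds: "\<And>M l. Ds M l \<in> sets borel" "\<And>M l. A \<subseteq> Ds M l"
    "\<And>M. \<not> (\<exists>x\<in>H M. \<forall>l<M. x l \<in> Ds M l)" by metis
  \<comment> \<open>Intersecting over all sizes and coordinates leaves one Borel set that serves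
    every hyperedge.\<close>
  have "(\<Inter>M. \<Inter>l. Ds M l) \<in> sets borel" using Ds(1) by (intro sets.countable_INT) auto
  moreover have "A \<subseteq> (\<Inter>M. \<Inter>l. Ds M l)" using Ds(2) by blast
  moreover have "\<exists>l<M. x l \<notin> (\<Inter>M. \<Inter>l. Ds M l)" if x: "x \<in> H M" for M x
  proof -
    obtain l where l: "l < M" "x l \<notin> Ds M l" using Ds(3)[of M] x by auto
    then have "x l \<notin> (\<Inter>M. \<Inter>l. Ds M l)" by auto
    then show ?thesis using l(1) by auto
  qed
  ultimately show ?thesis by (intro bexI[of _ "\<Inter>M. \<Inter>l. Ds M l"] conjI allI ballI)
qed

section \<open>Borel partial colourings\<close>

datatype idx = Vx nat | Ed nat nat | Mb nat nat

instance idx :: countable by countable_datatype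

text \<open>The situation after pulling back to Baire space, under the assumption that no large
  antichain exists. \<open>K\<close> is a closed code for incomparability, and
  \<open>decided_le\<close> is the form in which the universal Baire property is used.\<close>

locale analytic_quasi_order = quasi_order le for le :: "baire \<Rightarrow> baire \<Rightarrow> bool" (infix "\<preceq>" 50) +
  fixes k :: nat and K :: "(baire \<times> baire \<times> baire) set"
  assumes k_pos: "k > 0"
    and closed_K: "closed K"
    and par_iff: "par x y \<longleftrightarrow> (\<exists>\<gamma>. (x, y, \<gamma>) \<in> K)"
    and decided_le: "\<And>f g :: cantor \<Rightarrow> baire. continuous_on UNIV f \<Longrightarrow> continuous_on UNIV g \<Longrightarrow>
      decided {z. f z \<preceq> g z}"
    and anti_card: "finite A \<Longrightarrow> anti A \<Longrightarrow> card A \<le> k"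
begin

definition col :: "pcol \<Rightarrow> (baire \<Rightarrow> nat) \<Rightarrow> bool" where
  "col c d \<longleftrightarrow> (\<forall>x. d x < k) \<and> (\<forall>x y. par x y \<longrightarrow> d x \<noteq> d y) \<and> (\<forall>j<k. \<forall>x\<in>c j. d x = j)"

definition fcol :: "pcol \<Rightarrow> baire set \<Rightarrow> (baire \<Rightarrow> nat) \<Rightarrow> bool" where
  "fcol c F d \<longleftrightarrow> (\<forall>x\<in>F. d x < k) \<and> (\<forall>x\<in>F. \<forall>y\<in>F. par x y \<longrightarrow> d x \<noteq> d y) \<and> (\<forall>j<k. \<forall>x\<in>F \<inter> c j. d x = j)"

text \<open>Only the partial colouring has to be Borel; the total colouring that extends it is an
  arbitrary function.\<close>

definition good :: "pcol \<Rightarrow> bool" where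
  "good c \<longleftrightarrow> (\<forall>j. c j \<in> sets borel) \<and> (\<exists>d. col c d)"

definition cdom :: "pcol \<Rightarrow> baire set" where
  "cdom c = (\<Union>j<k. c j)"

definition add :: "pcol \<Rightarrow> nat \<Rightarrow> baire set \<Rightarrow> nat \<Rightarrow> baire set" where
  "add c i P = c(i := c i \<union> P)"

text \<open>\<open>inc\<close> stands for inconsistent. By \<open>inc_iff\<close> its negation says
  that adding \<open>P\<close> to the class \<open>i\<close> keeps the colouring extendable.\<close>

definition inc :: "pcol \<Rightarrow> nat \<Rightarrow> baire set \<Rightarrow> bool" where
  "inc c i P \<longleftrightarrow> \<not> (\<exists>d. col c d \<and> (\<forall>x\<in>P. d x = i))"

lemma col_antimono: "c \<le> c' \<Longrightarrow> col c' d \<Longrightarrow> col c d"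
  unfolding col_def le_fun_def by blast

lemma cdom_mono: "c \<le> c' \<Longrightarrow> cdom c \<subseteq> cdom c'"
  unfolding cdom_def le_fun_def by blast

lemma le_add: "c \<le> add c i P"
  by (auto simp: add_def le_fun_def)

lemma add_mono: "c \<le> c' \<Longrightarrow> add c i P \<le> add c' i P"
  by (auto simp: add_def le_fun_def)

lemma col_add: "i < k \<Longrightarrow> col (add c i P) d \<longleftrightarrow> col c d \<and> (\<forall>x\<in>P. d x = i)"
  by (auto simp: col_def add_def)

lemma inc_iff: "i < k \<Longrightarrow> inc c i P \<longleftrightarrow> \<not> (\<exists>d. col (add c i P) d)"
  by (simp add: inc_def col_add)

lemma inc_mono: "c \<le> c' \<Longrightarrow> P \<subseteq> P' \<Longrightarrow> inc c i P \<Longrightarrow> inc c' i P'"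
  unfolding inc_def using col_antimono by blast

lemma fcol_mono: "F \<subseteq> F' \<Longrightarrow> fcol c F' d \<Longrightarrow> fcol c F d"
  unfolding fcol_def by blast

lemma fcol_cong: "\<forall>x\<in>F. d x = d' x \<Longrightarrow> fcol c F d \<Longrightarrow> fcol c F d'"
  unfolding fcol_def by auto

section \<open>Compactness, certificates and Borel extension of colourings\<close>

lemma col_compact:
  assumes fin: "\<And>F. finite F \<Longrightarrow> \<exists>d. fcol c F d"
  shows "\<exists>d. col c d"
proof -
  have "\<exists>d. (\<forall>x. d x < k) \<and> (\<forall>F. finite F \<longrightarrow> fcol c F d)"
  proof (rule colouring_compactness)
    fix F :: "baire set" assume "finite F"
    then obtain d where d: "fcol c F d" using fin by blast
    then have "fcol c F (\<lambda>x. if x \<in> F then d x else 0)" by (rule fcol_cong[rotated]) simp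
    moreover have "\<forall>x. (if x \<in> F then d x else 0) < k" using d k_pos by (auto simp: fcol_def)
    ultimately show "\<exists>d. (\<forall>x. d x < k) \<and> fcol c F d"
      by (intro exI[of _ "\<lambda>x. if x \<in> F then d x else 0"] conjI)
  qed (auto intro: fcol_mono fcol_cong)
  then obtain d where d: "\<forall>x. d x < k" "\<And>F. finite F \<Longrightarrow> fcol c F d" by blast
  have "d x \<noteq> d y" if "par x y" for x y
    using d(2)[of "{x, y}"] that by (auto simp: fcol_def)
  moreover have "d x = j" if "j < k" "x \<in> c j" for x j
    using d(2)[of "{x}"] that by (auto simp: fcol_def)
  ultimately have "col c d" using d(1) unfolding col_def by blast
  then show ?thesis by blast
qed

text \<open>The bound on antichains enters here: Dilworth's theorem colours finite sets, and
  compactness makes the colouring total.\<close>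

lemma good_empty: "good (\<lambda>_. {})"
proof -
  have "\<exists>d. fcol (\<lambda>_. {}) F d" if F: "finite F" for F
  proof -
    have "\<forall>A\<subseteq>F. anti A \<longrightarrow> card A \<le> k" using anti_card finite_subset[OF _ F] by blast
    from dilworth_finite[OF F this] show ?thesis by (auto simp: fcol_def)
  qed
  then have "\<exists>d. col (\<lambda>_. {}) d" by (rule col_compact)
  then show ?thesis by (simp add: good_def)
qed

lemma chain_le:
  assumes "\<And>n. c n \<le> c (Suc n)" "n \<le> m"
  shows "c n \<le> (c m :: nat \<Rightarrow> baire set)"
  using assms lift_Suc_mono_le by blast

text \<open>By compactness only a finite \<open>F\<close> matters, and every constraint that the
  union puts on \<open>F\<close> is present at one common stage.\<close>

lemma col_UN_chain:
  assumes mono: "\<And>n. c n \<le> c (Suc n)" and ex: "\<And>n. \<exists>d. col (c n) d"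
  shows "\<exists>d. col (\<lambda>j. \<Union>n. c n j) d"
proof (rule col_compact)
  fix F :: "baire set" assume F: "finite F"
  have "\<exists>n. \<forall>j<k. x \<in> (\<Union>n. c n j) \<longrightarrow> x \<in> c n j" for x
  proof -
    have "\<forall>j. \<exists>n. x \<in> (\<Union>n. c n j) \<longrightarrow> x \<in> c n j" by blast
    then obtain f where f: "\<And>j. x \<in> (\<Union>n. c n j) \<Longrightarrow> x \<in> c (f j) j" by metis
    have "x \<in> c (Max (f ` {..<k})) j" if "j < k" "x \<in> (\<Union>n. c n j)" for j
    proof -
      have "f j \<le> Max (f ` {..<k})" using that(1) by (intro Max_ge) auto
      then have "c (f j) j \<subseteq> c (Max (f ` {..<k})) j" using chain_le[of c] mono by (auto simp: le_fun_def)
      then show ?thesis using f[OF that(2)] by blast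
    qed
    then show ?thesis by blast
  qed
  then obtain g where g: "\<And>x j. j < k \<Longrightarrow> x \<in> (\<Union>n. c n j) \<Longrightarrow> x \<in> c (g x) j" by metis
  obtain N where N: "\<forall>x\<in>F. g x \<le> N" using F finite_nat_set_iff_bounded_le[of "g ` F"] by auto
  obtain d where d: "col (c N) d" using ex by blast
  have "d x = j" if "x \<in> F" "j < k" "x \<in> (\<Union>n. c n j)" for x j
  proof -
    have "c (g x) \<le> c N" using chain_le[of c] mono N that(1) by blast
    then have "x \<in> c N j" using g[OF that(2,3)] by (auto simp: le_fun_def)
    then show ?thesis using d that(2) by (auto simp: col_def)
  qed
  then have "fcol (\<lambda>j. \<Union>n. c n j) F d"
    using d by (auto simp: fcol_def col_def)
  then show "\<exists>d. fcol (\<lambda>j. \<Union>n. c n j) F d" by blast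
qed

lemma good_UN_chain:
  assumes "\<And>n. c n \<le> c (Suc n)" "\<And>n. good (c n)"
  shows "good (\<lambda>j. \<Union>n. c n j)"
  using assms col_UN_chain[of c] unfolding good_def by (auto intro!: sets.countable_UN)

lemma chain_le_UN: "c n \<le> (\<lambda>j. \<Union>n. c n j)"
  by (auto simp: le_fun_def)

text \<open>An inconsistency with the union appears at a finite stage. This makes it possible to
  treat all inconsistencies of a limit colouring by countable bookkeeping.\<close>

lemma inc_UN_chain:
  assumes "\<And>n. c n \<le> c (Suc n)" "i < k" "inc (\<lambda>j. \<Union>n. c n j) i P"
  shows "\<exists>n. inc (c n) i P"
proof (rule ccontr)
  assume "\<not> ?thesis"
  then have "\<exists>d. col (add (c n) i P) d" for n using inc_iff[OF assms(2)] by blast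
  then have "\<exists>d. col (\<lambda>j. \<Union>n. add (c n) i P j) d"
    by (intro col_UN_chain add_mono assms(1))
  moreover have "(\<lambda>j. \<Union>n. add (c n) i P j) = add (\<lambda>j. \<Union>n. c n j) i P"
    by (auto simp: add_def fun_eq_iff)
  ultimately show False using assms(3) inc_iff[OF assms(2)] by simp
qed

lemma not_col_finite: "\<not> (\<exists>d. col c d) \<Longrightarrow> \<exists>F. finite F \<and> \<not> (\<exists>d. fcol c F d)"
  using col_compact by blast

lemma inc_finite_subset:
  assumes "i < k" "inc c i P"
  shows "\<exists>Q\<subseteq>P. finite Q \<and> inc c i Q"
proof -
  obtain F where F: "finite F" "\<not> (\<exists>d. fcol (add c i P) F d)"
    using not_col_finite[of "add c i P"] assms(2) inc_iff[OF assms(1)] by auto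
  have "inc c i (F \<inter> P)"
    unfolding inc_def
  proof
    assume "\<exists>d. col c d \<and> (\<forall>x\<in>F \<inter> P. d x = i)"
    then obtain d where "col c d" "\<forall>x\<in>F \<inter> P. d x = i" by blast
    then have "fcol (add c i P) F d" by (auto simp: fcol_def col_def add_def)
    then show False using F(2) by blast
  qed
  then show ?thesis using F(1) by (intro exI[of _ "F \<inter> P"]) auto
qed

text \<open>A finite certificate for \<open>inc\<close>: vertices \<open>Vx a\<close>, edges \<open>E\<close> and membership constraints \<open>M\<close>,
  together with codes \<open>Ed\<close> and \<open>Mb\<close> witnessing them, such that no colouring of the indices obeys the
  pattern and is constantly \<open>i\<close> on the first \<open>m\<close> vertices.\<close>

definition wit :: "(nat \<Rightarrow> (baire \<times> baire) set) \<Rightarrow> (nat \<times> nat) list \<Rightarrow> (nat \<times> nat) list \<Rightarrow>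
    (idx \<Rightarrow> nat \<Rightarrow> nat) \<Rightarrow> bool" where
  "wit Ks E M w \<longleftrightarrow> (\<forall>(a, b)\<in>set E. (w (Vx a), w (Vx b), w (Ed a b)) \<in> K) \<and>
     (\<forall>(a, j)\<in>set M. (w (Vx a), w (Mb a j)) \<in> Ks j)"

definition valid :: "nat \<Rightarrow> nat \<Rightarrow> (nat \<times> nat) list \<Rightarrow> (nat \<times> nat) list \<Rightarrow> bool" where
  "valid m i E M \<longleftrightarrow> (\<forall>(a, j)\<in>set M. j < k) \<and>
     \<not> (\<exists>h. (\<forall>a. h a < k) \<and> (\<forall>(a, b)\<in>set E. h a \<noteq> h b) \<and> (\<forall>(a, j)\<in>set M. h a = j) \<and> (\<forall>l<m. h l = i))"

definition code :: "pcol \<Rightarrow> (nat \<Rightarrow> (baire \<times> baire) set) \<Rightarrow> bool" where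
  "code c Ks \<longleftrightarrow> (\<forall>j. closed (Ks j) \<and> c j = fst ` Ks j)"

lemma good_code: "good c \<Longrightarrow> \<exists>Ks. code c Ks"
proof -
  assume "good c"
  then have "\<forall>j. \<exists>Kj :: (baire \<times> baire) set. closed Kj \<and> c j = fst ` Kj"
    using suslin_borel by (auto simp: good_def suslin_def)
  then show ?thesis unfolding code_def by (rule choice)
qed

lemma wit_par: "wit Ks E M w \<Longrightarrow> (a, b) \<in> set E \<Longrightarrow> par (w (Vx a)) (w (Vx b))"
  unfolding wit_def using par_iff by blast

lemma wit_mem: "code c Ks \<Longrightarrow> wit Ks E M w \<Longrightarrow> (a, j) \<in> set M \<Longrightarrow> w (Vx a) \<in> c j"
  unfolding wit_def code_def by (metis (no_types, lifting) case_prodD fst_conv imageI)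

lemma wit_sound:
  assumes "code c Ks" "wit Ks E M w" "valid m i E M"
  shows "inc c i ((\<lambda>l. w (Vx l)) ` {..<m})"
  unfolding inc_def
proof
  assume "\<exists>d. col c d \<and> (\<forall>x\<in>(\<lambda>l. w (Vx l)) ` {..<m}. d x = i)"
  then obtain d where d: "col c d" "\<forall>l<m. d (w (Vx l)) = i" by auto
  have "\<forall>(a, b)\<in>set E. d (w (Vx a)) \<noteq> d (w (Vx b))"
    using wit_par[OF assms(2)] d(1) unfolding col_def by blast
  moreover have "\<forall>(a, j)\<in>set M. d (w (Vx a)) = j"
    using wit_mem[OF assms(1,2)] d(1) assms(3) unfolding col_def valid_def by blast
  moreover have "\<forall>a. d (w (Vx a)) < k" using d(1) by (simp add: col_def)
  ultimately show False
    using assms(3) d(2) unfolding valid_def by (elim conjE notE) (intro exI[of _ "\<lambda>a. d (w (Vx a))"] conjI)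
qed

text \<open>Compactness yields a finite \<open>F\<close> that cannot be coloured. Its points outside
  the family become further vertices, and the certificate lists all incomparabilities and all
  memberships among the vertices.\<close>

lemma wit_complete:
  assumes "code c Ks" "i < k" "inc c i (x ` {..<m})"
  shows "\<exists>E M w. valid m i E M \<and> wit Ks E M w \<and> (\<forall>l<m. w (Vx l) = x l)"
proof -
  obtain F where F: "finite F" "\<not> (\<exists>d. fcol (add c i (x ` {..<m})) F d)"
    using not_col_finite[of "add c i (x ` {..<m})"] assms(3) inc_iff[OF assms(2)] by auto
  define G where "G = F - x ` {..<m}"
  have finG: "finite G" using F(1) by (simp add: G_def)
  obtain f where f: "bij_betw f {0..<card G} G" using ex_bij_betw_nat_finite[OF finG] by blast
  define v where "v a = (if a < m then x a else f (a - m))" for a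
  define N where "N = m + card G"
  have "finite {(a, b). a < N \<and> b < N \<and> par (v a) (v b)}"
    by (rule finite_subset[of _ "{..<N} \<times> {..<N}"]) auto
  then obtain E where E: "set E = {(a, b). a < N \<and> b < N \<and> par (v a) (v b)}" using finite_list by blast
  have "finite {(a, j). a < N \<and> j < k \<and> v a \<in> c j}"
    by (rule finite_subset[of _ "{..<N} \<times> {..<k}"]) auto
  then obtain M where M: "set M = {(a, j). a < N \<and> j < k \<and> v a \<in> c j}" using finite_list by blast
  define w where "w p = (case p of Vx a \<Rightarrow> v a | Ed a b \<Rightarrow> SOME \<gamma>. (v a, v b, \<gamma>) \<in> K
      | Mb a j \<Rightarrow> SOME \<gamma>. (v a, \<gamma>) \<in> Ks j)" for p
  have "valid m i E M"
    unfolding valid_def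
  proof (intro conjI notI)
    show "\<forall>(a, j)\<in>set M. j < k" using M by auto
    assume "\<exists>h. (\<forall>a. h a < k) \<and> (\<forall>(a, b)\<in>set E. h a \<noteq> h b) \<and> (\<forall>(a, j)\<in>set M. h a = j) \<and> (\<forall>l<m. h l = i)"
    then obtain h where h': "(\<forall>a. h a < k) \<and> (\<forall>(a, b)\<in>set E. h a \<noteq> h b) \<and> (\<forall>(a, j)\<in>set M. h a = j) \<and> (\<forall>l<m. h l = i)" ..
    have h: "\<And>a. h a < k" "\<And>a b. (a, b) \<in> set E \<Longrightarrow> h a \<noteq> h b"
      "\<And>a j. (a, j) \<in> set M \<Longrightarrow> h a = j" "\<And>l. l < m \<Longrightarrow> h l = i" using h' by auto
    \<comment> \<open>A colouring \<open>h\<close> of the indices would colour \<open>F\<close>: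
      points of the family get \<open>i\<close>, the others the colour of their vertex number, which
      is shifted by \<open>m\<close>.\<close>
    define d where "d p = (if p \<in> x ` {..<m} then i else h (m + inv_into {0..<card G} f p))" for p
    have idx: "\<exists>a<N. p = v a \<and> d p = h a" if "p \<in> F" for p
    proof (cases "p \<in> x ` {..<m}")
      case True
      then obtain a where "a < m" "p = x a" by auto
      then show ?thesis using True h(4) by (intro exI[of _ a]) (auto simp: v_def d_def N_def)
    next
      case False
      then have "p \<in> G" using that by (simp add: G_def)
      then have "inv_into {0..<card G} f p < card G" "f (inv_into {0..<card G} f p) = p"
        using bij_betw_apply[OF bij_betw_inv_into[OF f]] bij_betw_inv_into_right[OF f] by auto
      then show ?thesis using False
        by (intro exI[of _ "m + inv_into {0..<card G} f p"]) (auto simp: v_def d_def N_def)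
    qed
    have "fcol (add c i (x ` {..<m})) F d"
      unfolding fcol_def
    proof (intro conjI ballI allI impI)
      fix p assume "p \<in> F" then show "d p < k" using idx h(1) by metis
    next
      fix p q assume pq: "p \<in> F" "q \<in> F" "par p q"
      obtain a where a: "a < N" "p = v a" "d p = h a" using idx[OF pq(1)] by blast
      obtain b where b: "b < N" "q = v b" "d q = h b" using idx[OF pq(2)] by blast
      have "(a, b) \<in> set E" using E a b pq(3) by auto
      then show "d p \<noteq> d q" using h(2) a b by auto
    next
      fix j p assume j: "j < k" and p: "p \<in> F \<inter> add c i (x ` {..<m}) j"
      show "d p = j"
      proof (cases "p \<in> c j")
        case True
        obtain a where a: "a < N" "p = v a" "d p = h a" using idx p by blast
        then have "(a, j) \<in> set M" using M j True by auto
        then show ?thesis using h(3) a by auto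
      next
        case False
        then have "j = i" "p \<in> x ` {..<m}" using p by (auto simp: add_def split: if_splits)
        then show ?thesis by (simp add: d_def)
      qed
    qed
    then show False using F(2) by blast
  qed
  moreover have "wit Ks E M w"
    unfolding wit_def
  proof (intro conjI ballI; clarify)
    fix a b assume "(a, b) \<in> set E"
    then have "\<exists>\<gamma>. (v a, v b, \<gamma>) \<in> K" using E par_iff by auto
    then have "(v a, v b, SOME \<gamma>. (v a, v b, \<gamma>) \<in> K) \<in> K" by (rule someI_ex)
    then show "(w (Vx a), w (Vx b), w (Ed a b)) \<in> K" by (simp add: w_def)
  next
    fix a j assume "(a, j) \<in> set M"
    then have "v a \<in> c j" using M by auto
    then have "v a \<in> fst ` Ks j" using assms(1) by (simp add: code_def)
    then have "\<exists>\<gamma>. (v a, \<gamma>) \<in> Ks j" by auto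
    then have "(v a, SOME \<gamma>. (v a, \<gamma>) \<in> Ks j) \<in> Ks j" by (rule someI_ex)
    then show "(w (Vx a), w (Mb a j)) \<in> Ks j" by (simp add: w_def)
  qed
  moreover have "\<forall>l<m. w (Vx l) = x l" by (simp add: w_def v_def)
  ultimately show ?thesis by (intro exI[of _ E] exI[of _ M] exI[of _ w] conjI)
qed

lemma closed_wit:
  assumes "code c Ks"
  shows "closed {w. wit Ks E M w}"
proof -
  have c3: "closed {w :: idx \<Rightarrow> nat \<Rightarrow> nat. (w p, w q, w r) \<in> K}" for p q r
  proof -
    have "closed ((\<lambda>w :: idx \<Rightarrow> nat \<Rightarrow> nat. (w p, w q, w r)) -` K)"
      by (intro closed_vimage closed_K continuous_intros continuous_on_product_coordinates)
    then show ?thesis by (simp add: vimage_def)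
  qed
  have c2: "closed {w :: idx \<Rightarrow> nat \<Rightarrow> nat. (w p, w q) \<in> Ks j}" for p q j
  proof -
    have "closed ((\<lambda>w :: idx \<Rightarrow> nat \<Rightarrow> nat. (w p, w q)) -` Ks j)"
      using assms unfolding code_def
      by (intro closed_vimage continuous_intros continuous_on_product_coordinates) auto
    then show ?thesis by (simp add: vimage_def)
  qed
  have "{w. wit Ks E M w} = (\<Inter>(a, b)\<in>set E. {w. (w (Vx a), w (Vx b), w (Ed a b)) \<in> K}) \<inter>
      (\<Inter>(a, j)\<in>set M. {w. (w (Vx a), w (Mb a j)) \<in> Ks j})"
    unfolding wit_def by auto
  moreover have "closed (\<Inter>(a, b)\<in>set E. {w. (w (Vx a), w (Vx b), w (Ed a b)) \<in> K})"
    by (rule closed_INT) (auto intro: c3)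
  moreover have "closed (\<Inter>(a, j)\<in>set M. {w. (w (Vx a), w (Mb a j)) \<in> Ks j})"
    by (rule closed_INT) (auto intro: c2)
  ultimately show ?thesis by (simp add: closed_Int)
qed

lemma closed_coord_eq:
  fixes f g :: "'z::topological_space \<Rightarrow> nat \<Rightarrow> nat"
  assumes "continuous_on UNIV f" "continuous_on UNIV g"
  shows "closed {z. f z = g z}"
proof -
  have "closed (\<Inter>n. {z. f z n = g z n})"
    by (intro closed_INT ballI closed_Collect_eq[OF continuous_on_product_then_coordinatewise[OF assms(1)]
        continuous_on_product_then_coordinatewise[OF assms(2)]])
  moreover have "{z. f z = g z} = (\<Inter>n. {z. f z n = g z n})" by (auto simp: fun_eq_iff)
  ultimately show ?thesis by simp
qed

text \<open>\<open>H M\<close> consists of the \<open>M\<close>-tuples with a certificate that they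
  cannot all get the colour \<open>i\<close>: countably many patterns, each with a closed witness
  set, hence Suslin. A Borel set containing no hyperedge is consistent, because inconsistency is
  witnessed by finitely many points.\<close>

lemma good_hull:
  assumes c: "good c" and i: "i < k" and A: "suslin A" and cons: "\<not> inc c i A"
  shows "\<exists>D. A \<subseteq> D \<and> good (add c i D)"
proof -
  obtain Ks where Ks: "code c Ks" using good_code[OF c] by blast
  define H where "H M = (\<Union>EM :: (nat \<times> nat) list \<times> (nat \<times> nat) list.
      {x. \<exists>w. valid M i (fst EM) (snd EM) \<and> wit Ks (fst EM) (snd EM) w \<and> (\<forall>l<M. w (Vx l) = x l)})" for M
  have susl: "suslin (H M)" for M
    unfolding H_def
  proof (rule suslin_UN_countable)
    fix EM :: "(nat \<times> nat) list \<times> (nat \<times> nat) list"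
    let ?C = "{p :: (nat \<Rightarrow> nat \<Rightarrow> nat) \<times> (idx \<Rightarrow> nat \<Rightarrow> nat). valid M i (fst EM) (snd EM) \<and>
        wit Ks (fst EM) (snd EM) (snd p) \<and> (\<forall>l<M. snd p (Vx l) = fst p l)}"
    have c1: "closed {p :: (nat \<Rightarrow> nat \<Rightarrow> nat) \<times> (idx \<Rightarrow> nat \<Rightarrow> nat). snd p (Vx l) = fst p l}" for l
      by (intro closed_coord_eq continuous_on_compose2[OF continuous_on_product_coordinates continuous_on_snd[OF continuous_on_id]]
        continuous_on_compose2[OF continuous_on_product_coordinates continuous_on_fst[OF continuous_on_id]]) auto
    have "closed ?C"
    proof (cases "valid M i (fst EM) (snd EM)")
      case True
      have "?C = snd -` {w. wit Ks (fst EM) (snd EM) w} \<inter> (\<Inter>l\<in>{..<M}. {p. snd p (Vx l) = fst p l})"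
        using True by auto
      moreover have "closed (snd -` {w. wit Ks (fst EM) (snd EM) w} :: ((nat \<Rightarrow> nat \<Rightarrow> nat) \<times> (idx \<Rightarrow> nat \<Rightarrow> nat)) set)"
        by (intro closed_vimage closed_wit[OF Ks] continuous_intros)
      moreover have "closed (\<Inter>l\<in>{..<M}. {p :: (nat \<Rightarrow> nat \<Rightarrow> nat) \<times> (idx \<Rightarrow> nat \<Rightarrow> nat). snd p (Vx l) = fst p l})"
        by (intro closed_INT ballI c1)
      ultimately show ?thesis by (simp add: closed_Int)
    qed simp
    from suslin_Ex[OF suslin_closed[OF this] baire_code2]
    show "suslin {x. \<exists>w. valid M i (fst EM) (snd EM) \<and> wit Ks (fst EM) (snd EM) w \<and> (\<forall>l<M. w (Vx l) = x l)}"
      by simp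
  qed
  have "\<exists>l<M. x l \<notin> A" if "x \<in> H M" for M x
  proof (rule ccontr)
    assume "\<not> ?thesis"
    then have "x ` {..<M} \<subseteq> A" by auto
    from that obtain EM w where w': "valid M i (fst EM) (snd EM) \<and> wit Ks (fst EM) (snd EM) w \<and> (\<forall>l<M. w (Vx l) = x l)"
      unfolding H_def by blast
    define E L where "E = fst EM" and "L = snd EM"
    have w: "valid M i E L" "wit Ks E L w" "\<forall>l<M. w (Vx l) = x l" using w' by (auto simp: E_def L_def)
    have "inc c i ((\<lambda>l. w (Vx l)) ` {..<M})" by (rule wit_sound[OF Ks w(2,1)])
    moreover have "(\<lambda>l. w (Vx l)) ` {..<M} \<subseteq> A" using w(3) \<open>x ` {..<M} \<subseteq> A\<close> by auto
    ultimately show False using cons inc_mono[OF order_refl] by blast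
  qed
  from borel_independent_hull[of A H, OF A susl this]
  obtain D where D: "D \<in> sets borel" "A \<subseteq> D" "\<And>M x. x \<in> H M \<Longrightarrow> \<exists>l<M. x l \<notin> D" by auto
  have "\<not> inc c i D"
  proof
    assume "inc c i D"
    then obtain Q where Q: "Q \<subseteq> D" "finite Q" "inc c i Q" using inc_finite_subset[OF i] by blast
    obtain x where x: "bij_betw x {0..<card Q} Q" using ex_bij_betw_nat_finite[OF Q(2)] by blast
    then have xQ: "x ` {..<card Q} = Q" by (simp add: bij_betw_def lessThan_atLeast0)
    then obtain E L w where "valid (card Q) i E L" "wit Ks E L w" "\<forall>l<card Q. w (Vx l) = x l"
      using wit_complete[OF Ks i, of x "card Q"] Q(3) by auto
    then have "\<exists>w. valid (card Q) i (fst (E, L)) (snd (E, L)) \<and> wit Ks (fst (E, L)) (snd (E, L)) w \<and>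
        (\<forall>l<card Q. w (Vx l) = x l)" by auto
    then have "x \<in> H (card Q)" unfolding H_def by blast
    then show False using D(3) xQ Q(1) by blast
  qed
  then have "good (add c i D)" using c D(1) inc_iff[OF i] by (auto simp: good_def add_def)
  then show ?thesis using D(2) by blast
qed

end

section \<open>Configurations and the amalgamation step\<close>

text \<open>A configuration \<open>u\<close> assigns to each node a family of points and codes; the points of interest sit at
  the leaves, under the index \<open>Vx 0\<close>.\<close>

type_synonym cfg = "nat list \<Rightarrow> idx \<Rightarrow> nat \<Rightarrow> nat"

definition leaf :: "nat list \<Rightarrow> cfg \<Rightarrow> nat \<Rightarrow> nat" where
  "leaf t u = u t (Vx 0)"

definition subtree :: "nat list \<Rightarrow> cfg \<Rightarrow> cfg" where
  "subtree p u = (\<lambda>y. u (p @ y))"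

lemma continuous_leaf: "continuous_on UNIV (leaf t)"
  unfolding leaf_def
  by (rule continuous_on_product_then_coordinatewise[OF continuous_on_product_coordinates])

lemma continuous_subtree: "continuous_on UNIV (subtree p)"
  unfolding subtree_def
  by (rule continuous_on_coordinatewise_then_product) (rule continuous_on_product_coordinates)

context analytic_quasi_order
begin

definition avoid :: "nat list set \<Rightarrow> cfg \<Rightarrow> pcol \<Rightarrow> bool" where
  "avoid T u c \<longleftrightarrow> (\<forall>t\<in>T. leaf t u \<notin> cdom c)"

text \<open>The largeness notion of the construction: no good extension of \<open>c\<close> can
  colour some leaf of every configuration in \<open>C\<close>.\<close>

definition bad :: "cfg set \<Rightarrow> nat list set \<Rightarrow> pcol \<Rightarrow> bool" where
  "bad C T c \<longleftrightarrow> (\<forall>c'. c \<le> c' \<longrightarrow> good c' \<longrightarrow> (\<exists>u\<in>C. avoid T u c'))"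

lemma avoid_antimono: "c \<le> c' \<Longrightarrow> avoid T u c' \<Longrightarrow> avoid T u c"
  unfolding avoid_def using cdom_mono by blast

lemma iterate:
  assumes c: "good c"
    and step: "\<And>n c'. c \<le> c' \<Longrightarrow> good c' \<Longrightarrow> \<exists>c''. c' \<le> c'' \<and> good c'' \<and> Q n c' c''"
  shows "\<exists>cs. cs 0 = c \<and> (\<forall>n. good (cs n) \<and> cs n \<le> cs (Suc n) \<and> Q n (cs n) (cs (Suc n)))"
proof -
  have "\<exists>cs. \<forall>n. (good (cs n) \<and> c \<le> cs n \<and> (n = 0 \<longrightarrow> cs n = c)) \<and> (cs n \<le> cs (Suc n) \<and> Q n (cs n) (cs (Suc n)))"
  proof (rule dependent_nat_choice)
    show "\<exists>c'. good c' \<and> c \<le> c' \<and> (0 = (0::nat) \<longrightarrow> c' = c)" using c by blast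
  next
    fix c' and n :: nat
    assume "good c' \<and> c \<le> c' \<and> (n = 0 \<longrightarrow> c' = c)"
    then have c': "good c'" "c \<le> c'" by auto
    obtain c'' where c'': "c' \<le> c''" "good c''" "Q n c' c''" using step[OF c'(2,1)] by blast
    have "c \<le> c''" using c'(2) c''(1) by (rule order_trans)
    then show "\<exists>c''. (good c'' \<and> c \<le> c'' \<and> (Suc n = 0 \<longrightarrow> c'' = c)) \<and> c' \<le> c'' \<and> Q n c' c''"
      using c'' by (intro exI[of _ c'']) simp
  qed
  then obtain cs where "\<forall>n. (good (cs n) \<and> c \<le> cs n \<and> (n = 0 \<longrightarrow> cs n = c)) \<and>
    (cs n \<le> cs (Suc n) \<and> Q n (cs n) (cs (Suc n)))" ..
  then show ?thesis by (intro exI[of _ cs]) simp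
qed

text \<open>Smallness is closed under countable unions: if each \<open>D n\<close> could be
  destroyed after any extension, the union of successive extensions would destroy
  \<open>C\<close>.\<close>

lemma bad_split:
  assumes c: "good c" and b: "bad C T c" and cover: "C \<subseteq> (\<Union>n::nat. D n)"
  shows "\<exists>n c'. c \<le> c' \<and> good c' \<and> bad (D n) T c'"
proof (rule ccontr)
  assume contra: "\<not> ?thesis"
  have "\<exists>c''. c' \<le> c'' \<and> good c'' \<and> (\<forall>u\<in>D n. \<not> avoid T u c'')" if "c \<le> c'" "good c'" for n c'
    using contra that unfolding bad_def by blast
  from iterate[of c "\<lambda>n c' c''. \<forall>u\<in>D n. \<not> avoid T u c''", OF c this]
  obtain cs where cs0: "cs 0 = c" and csn: "\<forall>n. good (cs n) \<and> cs n \<le> cs (Suc n) \<and> (\<forall>u\<in>D n. \<not> avoid T u (cs (Suc n)))"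
    by blast
  have cs: "\<And>n. good (cs n)" "\<And>n. cs n \<le> cs (Suc n)" "\<And>n u. u \<in> D n \<Longrightarrow> \<not> avoid T u (cs (Suc n))"
    using csn by blast+
  let ?c = "\<lambda>j. \<Union>n. cs n j"
  have "good ?c" using cs(1,2) by (intro good_UN_chain)
  moreover have "c \<le> ?c" using chain_le_UN[of cs 0] cs0 by simp
  ultimately obtain u where u: "u \<in> C" "avoid T u ?c" using b unfolding bad_def by blast
  then obtain n where "u \<in> D n" using cover by blast
  then show False using cs(3) avoid_antimono[OF chain_le_UN u(2)] by blast
qed

definition edges :: "cfg set \<Rightarrow> nat list \<Rightarrow> nat \<Rightarrow> nat \<Rightarrow> pcol \<Rightarrow> cfg set set" where
  "edges C s m i c = {U. U \<subseteq> C \<and> finite U \<and> card U = m \<and> inc c i (leaf s ` U)}"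

text \<open>The inconsistent families are those for \<open>c'\<close>, whereas they are destroyed by
  \<open>c''\<close>. Further ones may arise with respect to \<open>c''\<close>;
  \<open>kill_all\<close> deals with these.\<close>

definition killable :: "cfg set \<Rightarrow> nat list set \<Rightarrow> nat list \<Rightarrow> nat \<Rightarrow> nat \<Rightarrow> pcol \<Rightarrow> bool" where
  "killable C T s i m c \<longleftrightarrow> (\<forall>c'. c \<le> c' \<longrightarrow> good c' \<longrightarrow>
     (\<exists>c''. c' \<le> c'' \<and> good c'' \<and> (\<forall>U\<in>edges C s m i c'. \<exists>u\<in>U. \<not> avoid T u c'')))"

text \<open>Each size is treated at infinitely many stages of an increasing chain, and an
  inconsistency of the limit already holds from some finite stage on.\<close>

lemma kill_all:
  assumes i: "i < k" and c0: "good c0" "c \<le> c0" and K: "\<And>m. m \<in> ms \<Longrightarrow> killable C T s i m c"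
  shows "\<exists>c1. c0 \<le> c1 \<and> good c1 \<and> (\<forall>m\<in>ms. \<forall>U\<in>edges C s m i c1. \<exists>u\<in>U. \<not> avoid T u c1)"
proof -
  define Q where "Q n c' c'' \<longleftrightarrow> (fst (prod_decode n) \<in> ms \<longrightarrow>
      (\<forall>U\<in>edges C s (fst (prod_decode n)) i c'. \<exists>u\<in>U. \<not> avoid T u c''))" for n c' c''
  have "\<exists>c''. c' \<le> c'' \<and> good c'' \<and> Q n c' c''" if c': "c0 \<le> c'" "good c'" for n c'
  proof (cases "fst (prod_decode n) \<in> ms")
    case True
    have "c \<le> c'" using c0(2) c'(1) by (rule order_trans)
    then show ?thesis using K[OF True] c'(2) unfolding killable_def Q_def by blast
  next
    case False
    then show ?thesis using c' by (intro exI[of _ c']) (simp add: Q_def)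
  qed
  from iterate[of c0 Q, OF c0(1) this]
  obtain cs where cs0: "cs 0 = c0" and csn: "\<forall>n. good (cs n) \<and> cs n \<le> cs (Suc n) \<and> Q n (cs n) (cs (Suc n))"
    by blast
  have cs: "\<And>n. good (cs n)" "\<And>n. cs n \<le> cs (Suc n)" "\<And>n. Q n (cs n) (cs (Suc n))"
    using csn by blast+
  let ?c = "\<lambda>j. \<Union>n. cs n j"
  have good: "good ?c" using cs(1,2) by (intro good_UN_chain)
  have le: "c0 \<le> ?c" using chain_le_UN[of cs 0] cs0 by simp
  have "\<exists>u\<in>U. \<not> avoid T u ?c" if m: "m \<in> ms" and U: "U \<in> edges C s m i ?c" for m U
  proof -
    have "inc ?c i (leaf s ` U)" using U by (simp add: edges_def)
    then obtain n where n: "inc (cs n) i (leaf s ` U)" using inc_UN_chain[of cs, OF cs(2) i] by blast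
    \<comment> \<open>This stage treats size \<open>m\<close> and, since \<open>n \<le> j\<close>,
      comes after the inconsistency has appeared.\<close>
    define j where "j = prod_encode (m, n)"
    have "n \<le> j" unfolding j_def by (rule le_prod_encode_2)
    then have "cs n \<le> cs j" using chain_le[of cs, OF cs(2)] by blast
    then have "inc (cs j) i (leaf s ` U)" using n inc_mono by blast
    then have "U \<in> edges C s m i (cs j)" using U by (simp add: edges_def)
    then obtain u where "u \<in> U" "\<not> avoid T u (cs (Suc j))"
      using cs(3)[of j] m unfolding Q_def j_def by auto
    then show ?thesis using avoid_antimono[OF chain_le_UN[of cs "Suc j"], of T u] by (intro bexI[of _ u]) auto
  qed
  then show ?thesis using good le by (intro exI[of _ ?c] conjI ballI)
qed

lemma suslin_roots:
  assumes "closed C" "good c"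
  shows "suslin (leaf s ` {u\<in>C. avoid T u c})"
proof -
  have "cdom c \<in> sets borel" using assms(2) unfolding cdom_def good_def by (intro sets.finite_UN) auto
  then have "suslin (- cdom c)" by (intro suslin_borel) auto
  then have s1: "suslin (leaf t -` (- cdom c))" for t by (rule suslin_vimage[OF _ continuous_leaf])
  have "suslin (\<Inter>n. if from_nat n \<in> T then leaf (from_nat n) -` (- cdom c) else UNIV)"
    by (rule suslin_INT_nat) (auto intro: s1 suslin_closed)
  then have "suslin (C \<inter> (\<Inter>n. if from_nat n \<in> T then leaf (from_nat n) -` (- cdom c) else UNIV))"
    by (rule suslin_Int[OF suslin_closed[OF assms(1)]])
  moreover have "C \<inter> (\<Inter>n. if from_nat n \<in> T then leaf (from_nat n) -` (- cdom c) else UNIV) = {u\<in>C. avoid T u c}"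
  proof (intro set_eqI iffI)
    fix u assume u: "u \<in> C \<inter> (\<Inter>n. if from_nat n \<in> T then leaf (from_nat n) -` (- cdom c) else UNIV)"
    have "leaf t u \<notin> cdom c" if "t \<in> T" for t
    proof -
      have "u \<in> (if from_nat (to_nat t) \<in> T then leaf (from_nat (to_nat t)) -` (- cdom c) else UNIV)"
        using u by blast
      then show ?thesis using that by simp
    qed
    then show "u \<in> {u\<in>C. avoid T u c}" using u by (auto simp: avoid_def)
  next
    fix u assume "u \<in> {u\<in>C. avoid T u c}"
    then show "u \<in> C \<inter> (\<Inter>n. if from_nat n \<in> T then leaf (from_nat n) -` (- cdom c) else UNIV)"
      by (auto simp: avoid_def)
  qed
  ultimately have "suslin {u\<in>C. avoid T u c}" by simp
  then show ?thesis by (rule suslin_image[OF _ continuous_leaf baire_code3])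
qed

text \<open>If the monochromatic inconsistencies of every size could be destroyed, all roots could be given the
  colour \<open>i\<close> at once.\<close>

lemma ex_not_killable:
  assumes C: "closed C" and c: "good c" "bad C T c" and s: "s \<in> T" and i: "i < k"
  shows "\<exists>m. \<not> killable C T s i m c"
proof (rule ccontr)
  assume "\<not> ?thesis"
  then have "killable C T s i m c" for m by blast
  from kill_all[OF i c(1) order_refl this, of UNIV]
  obtain c1 where c1: "c \<le> c1" "good c1" "\<And>m U. U \<in> edges C s m i c1 \<Longrightarrow> \<exists>u\<in>U. \<not> avoid T u c1" by blast
  let ?A = "leaf s ` {u\<in>C. avoid T u c1}"
  have "\<not> inc c1 i ?A"
  proof
    assume "inc c1 i ?A"
    then obtain Q where Q: "Q \<subseteq> ?A" "finite Q" "inc c1 i Q" using inc_finite_subset[OF i] by blast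
    obtain U where U: "U \<subseteq> {u\<in>C. avoid T u c1}" "finite U" "Q = leaf s ` U"
      using finite_subset_image[OF Q(2,1)] by blast
    then have "U \<in> edges C s (card U) i c1" using Q(3) by (auto simp: edges_def)
    then show False using c1(3) U(1) by blast
  qed
  from good_hull[OF c1(2) i suslin_roots[OF C c1(2)] this]
  obtain D where D: "?A \<subseteq> D" "good (add c1 i D)" by blast
  \<comment> \<open>Giving \<open>D\<close> the colour \<open>i\<close> colours the
    \<open>s\<close>-leaf of every configuration that still avoids \<open>c1\<close>, which
    contradicts \<open>bad\<close>.\<close>
  have "c \<le> add c1 i D" using c1(1) le_add order_trans by blast
  then obtain u where u: "u \<in> C" "avoid T u (add c1 i D)" using c(2) D(2) unfolding bad_def by blast
  have "leaf s u \<in> D" using D(1) u avoid_antimono[OF le_add u(2)] by blast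
  then have "leaf s u \<in> cdom (add c1 i D)" using i by (auto simp: cdom_def add_def)
  then show False using u(2) s by (auto simp: avoid_def)
qed

text \<open>For the least size \<open>m\<close> that is not killable there is an extension after
  which uncoloured inconsistent families of \<open>m\<close> configurations always remain. Such a
  family is joined under a new root that stores a certificate. As there are countably many patterns
  and finite value lists, \<open>bad_split\<close> fixes the certificate pattern and the coordinates
  in \<open>Q m\<close>. The list depends on \<open>m\<close> because the shape of the new tree
  does. The last clause is the minimality of \<open>m\<close>.\<close>

lemma amalgamation_step:
  fixes Q :: "nat \<Rightarrow> (nat list \<times> idx \<times> nat) list"
  assumes C: "closed C" and c: "good c" "bad C T c" and s: "s \<in> T" and i: "i < k"
  shows "\<exists>c' m E M C'. c \<le> c' \<and> good c' \<and> closed C' \<and> m \<ge> 1 \<and> valid m i E M \<and>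
    bad C' {l # t |l t. l < m \<and> t \<in> T} c' \<and>
    (\<forall>u\<in>C'. (\<forall>l<m. subtree [l] u \<in> C) \<and> (\<forall>l<m. u [] (Vx l) = leaf (l # s) u) \<and>
      (\<forall>(a, b)\<in>set E. par (u [] (Vx a)) (u [] (Vx b))) \<and> (\<forall>(a, j)\<in>set M. u [] (Vx a) \<in> c' j)) \<and>
    (\<forall>u\<in>C'. \<forall>v\<in>C'. \<forall>(y, p, n)\<in>set (Q m). u y p n = v y p n) \<and>
    (\<forall>c0. c' \<le> c0 \<longrightarrow> good c0 \<longrightarrow> (\<exists>c1. c0 \<le> c1 \<and> good c1 \<and>
      (\<forall>U. U \<subseteq> C \<longrightarrow> finite U \<longrightarrow> card U < m \<longrightarrow> (\<forall>u\<in>U. avoid T u c1) \<longrightarrow> \<not> inc c1 i (leaf s ` U))))"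
proof -
  define m where "m = (LEAST m. \<not> killable C T s i m c)"
  have m: "\<not> killable C T s i m c"
    unfolding m_def by (rule LeastI_ex[of "\<lambda>m. \<not> killable C T s i m c", OF ex_not_killable[OF C c s i]])
  have small: "killable C T s i m' c" if "m' < m" for m'
    using not_less_Least[of m' "\<lambda>m. \<not> killable C T s i m c"] that unfolding m_def by (rule_tac ccontr) simp
  \<comment> \<open>The empty family is never inconsistent with a good colouring, so at least one
    copy is joined.\<close>
  have "edges C s 0 i c' = {}" if "good c'" for c'
    using that by (auto simp: edges_def inc_def good_def)
  then have "killable C T s i 0 c" unfolding killable_def by blast
  then have m1: "m \<ge> 1" using m by (cases m) auto
  obtain c' where c': "c \<le> c'" "good c'"
    and no_kill: "\<not> (\<exists>c''. c' \<le> c'' \<and> good c'' \<and> (\<forall>U\<in>edges C s m i c'. \<exists>u\<in>U. \<not> avoid T u c''))"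
    using m unfolding killable_def not_all not_imp by (elim exE conjE)
  have hit: "\<exists>U\<in>edges C s m i c'. \<forall>u\<in>U. avoid T u c''" if "c' \<le> c''" "good c''" for c''
  proof (rule ccontr)
    assume "\<not> ?thesis"
    then have "\<forall>U\<in>edges C s m i c'. \<exists>u\<in>U. \<not> avoid T u c''" by simp
    then show False using no_kill that by (elim notE) (intro exI[of _ c''] conjI)
  qed
  obtain Ks where Ks: "code c' Ks" using good_code[OF c'(2)] by blast
  let ?T = "{l # t |l t. l < m \<and> t \<in> T}"
  define D where "D E M vals = {u. valid m i E M \<and> (\<forall>l<m. subtree [l] u \<in> C) \<and> (\<forall>l<m. u [] (Vx l) = leaf (l # s) u) \<and>
    wit Ks E M (u []) \<and> (\<forall>q<length (Q m). (case Q m ! q of (y, p, n) \<Rightarrow> u y p n) = vals ! q)}" for E M and vals :: "nat list"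
  define D' where "D' z = (case from_nat z of (E, M, vals) \<Rightarrow> D E M vals)" for z
  have closedD: "closed (D E M vals)" for E M vals
  proof (cases "valid m i E M")
    case True
    have 1: "closed {u. subtree [l] u \<in> C}" for l
      using closed_vimage[OF C continuous_subtree] by (simp add: vimage_def)
    have 2: "closed {u :: cfg. u [] (Vx l) = leaf (l # s) u}" for l
      by (intro closed_coord_eq continuous_leaf
          continuous_on_product_then_coordinatewise[OF continuous_on_product_coordinates])
    have 3: "closed {u :: cfg. wit Ks E M (u [])}"
      using closed_vimage[OF closed_wit[OF Ks] continuous_on_product_coordinates] by (simp add: vimage_def)
    have 4: "closed {u :: cfg. (case q of (y, p, n) \<Rightarrow> u y p n) = v}" for q v
    proof -
      obtain y p n where q: "q = (y, p, n)" by (cases q)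
      have "closed {u :: cfg. u y p n = v}"
        by (intro closed_Collect_eq continuous_on_const
          continuous_on_product_then_coordinatewise[OF continuous_on_product_then_coordinatewise[OF continuous_on_product_coordinates]])
      then show ?thesis by (simp add: q)
    qed
    have "D E M vals = (\<Inter>l\<in>{..<m}. {u. subtree [l] u \<in> C}) \<inter> (\<Inter>l\<in>{..<m}. {u. u [] (Vx l) = leaf (l # s) u}) \<inter>
      {u. wit Ks E M (u [])} \<inter> (\<Inter>q\<in>{..<length (Q m)}. {u. (case Q m ! q of (y, p, n) \<Rightarrow> u y p n) = vals ! q})"
      unfolding D_def using True by auto
    moreover have "closed \<dots>"
      by (intro closed_Int closed_INT ballI 1 2 3 4)
    ultimately show ?thesis by simp
  next
    case False
    then have "D E M vals = {}" by (auto simp: D_def)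
    then show ?thesis by simp
  qed
  have "bad (\<Union>z. D' z) ?T c'"
    unfolding bad_def
  proof (intro allI impI)
    fix c'' assume "c' \<le> c''" "good c''"
    then obtain U where U: "U \<in> edges C s m i c'" "\<forall>u\<in>U. avoid T u c''" using hit by blast
    then have U': "U \<subseteq> C" "finite U" "card U = m" "inc c' i (leaf s ` U)" by (auto simp: edges_def)
    obtain f where "bij_betw f {0..<card U} U" using ex_bij_betw_nat_finite[OF U'(2)] by blast
    then have f: "f ` {..<m} = U" using U'(3) by (simp add: bij_betw_def lessThan_atLeast0)
    then have "(\<lambda>l. leaf s (f l)) ` {..<m} = leaf s ` U" by (metis image_image)
    then have "inc c' i ((\<lambda>l. leaf s (f l)) ` {..<m})" using U'(4) by simp
    from wit_complete[OF Ks i this] obtain E M w where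
      w: "valid m i E M" "wit Ks E M w" "\<forall>l<m. w (Vx l) = leaf s (f l)" by blast
    \<comment> \<open>The root carries the certificate, and the \<open>l\<close>-th subtree is the
      \<open>l\<close>-th configuration of the family.\<close>
    define u where "u y = (case y of [] \<Rightarrow> w | l # y' \<Rightarrow> f l y')" for y
    define vals where "vals = map (\<lambda>(y, p, n). u y p n) (Q m)"
    have fU: "f l \<in> U" if "l < m" for l using f that by blast
    have subu: "subtree [l] u = f l" for l by (simp add: subtree_def u_def)
    have "u \<in> D E M vals"
      unfolding D_def using w fU U'(1) by (auto simp: subu vals_def leaf_def u_def split: prod.split)
    then have "u \<in> D' (to_nat (E, M, vals))" by (simp add: D'_def)
    moreover have "avoid ?T u c''"
      using U(2) fU by (auto simp: avoid_def leaf_def u_def)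
    ultimately show "\<exists>u\<in>\<Union>z. D' z. avoid ?T u c''" by blast
  qed
  from bad_split[OF c'(2) this order_refl]
  obtain z c'' where c'': "c' \<le> c''" "good c''" "bad (D' z) ?T c''" by blast
  obtain E M :: "(nat \<times> nat) list" and vals :: "nat list" where z: "from_nat z = (E, M, vals)"
    by (cases "from_nat z :: (nat \<times> nat) list \<times> (nat \<times> nat) list \<times> nat list")
  then have D'z: "D' z = D E M vals" by (simp add: D'_def)
  obtain u where "u \<in> D E M vals" using c''(3)[unfolded bad_def, rule_format, OF order_refl c''(2)] D'z by auto
  then have val: "valid m i E M" by (simp add: D_def)
  have ccle: "c \<le> c''" using c'(1) c''(1) by (rule order_trans)
  have props: "(\<forall>l<m. subtree [l] u \<in> C) \<and> (\<forall>l<m. u [] (Vx l) = leaf (l # s) u) \<and>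
      (\<forall>(a, b)\<in>set E. par (u [] (Vx a)) (u [] (Vx b))) \<and> (\<forall>(a, j)\<in>set M. u [] (Vx a) \<in> c'' j)"
    if u: "u \<in> D E M vals" for u
  proof -
    have w: "wit Ks E M (u [])" using u by (simp add: D_def)
    have "\<forall>(a, b)\<in>set E. par (u [] (Vx a)) (u [] (Vx b))" using wit_par[OF w] by auto
    moreover have "\<forall>(a, j)\<in>set M. u [] (Vx a) \<in> c'' j"
      using wit_mem[OF Ks w] c''(1) by (auto simp: le_fun_def)
    ultimately show ?thesis using u by (simp add: D_def)
  qed
  have agree: "\<forall>(y, p, n)\<in>set (Q m). u y p n = v y p n" if uv: "u \<in> D E M vals" "v \<in> D E M vals" for u v
  proof
    fix q assume "q \<in> set (Q m)"
    then obtain r where r: "r < length (Q m)" "Q m ! r = q" by (auto simp: in_set_conv_nth)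
    have "(case q of (y, p, n) \<Rightarrow> u y p n) = vals ! r" "(case q of (y, p, n) \<Rightarrow> v y p n) = vals ! r"
      using uv r by (auto simp: D_def)
    then show "case q of (y, p, n) \<Rightarrow> u y p n = v y p n" by (cases q) simp
  qed
  have P2: "\<exists>c1. c0 \<le> c1 \<and> good c1 \<and>
      (\<forall>U. U \<subseteq> C \<longrightarrow> finite U \<longrightarrow> card U < m \<longrightarrow> (\<forall>u\<in>U. avoid T u c1) \<longrightarrow> \<not> inc c1 i (leaf s ` U))"
    if c0: "c'' \<le> c0" "good c0" for c0
  proof -
    have "c \<le> c0" using ccle c0(1) by (rule order_trans)
    from kill_all[OF i c0(2) this, of "{..<m}" C T s] small
    obtain c1 where c1': "c0 \<le> c1 \<and> good c1 \<and> (\<forall>m'\<in>{..<m}. \<forall>U\<in>edges C s m' i c1. \<exists>u\<in>U. \<not> avoid T u c1)"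
      by (auto simp del: ball_simps)
    have c1: "c0 \<le> c1" "good c1" "\<And>m' U. m' < m \<Longrightarrow> U \<in> edges C s m' i c1 \<Longrightarrow> \<exists>u\<in>U. \<not> avoid T u c1"
      using c1' by auto
    have "\<not> inc c1 i (leaf s ` U)" if "U \<subseteq> C" "finite U" "card U < m" "\<forall>u\<in>U. avoid T u c1" for U
      using c1(3)[OF that(3), of U] that by (auto simp: edges_def)
    then show ?thesis using c1(1,2) by (intro exI[of _ c1] conjI allI impI)
  qed
  have props': "\<forall>u\<in>D E M vals. (\<forall>l<m. subtree [l] u \<in> C) \<and> (\<forall>l<m. u [] (Vx l) = leaf (l # s) u) \<and>
      (\<forall>(a, b)\<in>set E. par (u [] (Vx a)) (u [] (Vx b))) \<and> (\<forall>(a, j)\<in>set M. u [] (Vx a) \<in> c'' j)"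
    by (intro ballI props)
  have agree': "\<forall>u\<in>D E M vals. \<forall>v\<in>D E M vals. \<forall>(y, p, n)\<in>set (Q m). u y p n = v y p n"
    by (intro ballI[of "D E M vals"] agree)
  have P2': "\<forall>c0. c'' \<le> c0 \<longrightarrow> good c0 \<longrightarrow> (\<exists>c1. c0 \<le> c1 \<and> good c1 \<and>
      (\<forall>U. U \<subseteq> C \<longrightarrow> finite U \<longrightarrow> card U < m \<longrightarrow> (\<forall>u\<in>U. avoid T u c1) \<longrightarrow> \<not> inc c1 i (leaf s ` U)))"
    by (intro allI impI P2)
  show ?thesis
    using c''(3)[unfolded D'z]
    by (intro exI[of _ c''] exI[of _ m] exI[of _ E] exI[of _ M] exI[of _ "D E M vals"] conjI
        ccle c''(2) closedD m1 val props' agree' P2')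
qed

end

text \<open>Stage \<open>N\<close> of the fusion: \<open>Ts N\<close> is the set of leaves (addresses with the latest step first), \<open>Cs N\<close> a
  closed set of configurations on it, and stage \<open>N + 1\<close> joins \<open>ms N\<close> copies at the leaf \<open>ss N\<close> by the
  certificate \<open>Es N\<close>, \<open>Ms N\<close> that these leaves cannot all receive the colour \<open>cl N\<close>.\<close>

locale fusion = analytic_quasi_order le k K
  for le :: "baire \<Rightarrow> baire \<Rightarrow> bool" (infix "\<preceq>" 50) and k K +
  fixes cs :: "nat \<Rightarrow> nat \<Rightarrow> baire set" and Cs :: "nat \<Rightarrow> cfg set" and Ts :: "nat \<Rightarrow> nat list set"
    and ms :: "nat \<Rightarrow> nat" and ss :: "nat \<Rightarrow> nat list" and cl :: "nat \<Rightarrow> nat"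
    and Es Ms :: "nat \<Rightarrow> (nat \<times> nat) list"
  assumes good_cs: "good (cs N)"
    and cs_Suc: "cs N \<le> cs (Suc N)"
    and closed_Cs: "closed (Cs N)"
    and Cs_nonempty: "Cs N \<noteq> {}"
    and Ts_0: "Ts 0 = {[]}"
    and Ts_Suc: "Ts (Suc N) = {l # t |l t. l < ms N \<and> t \<in> Ts N}"
    and ms_pos: "ms N \<ge> 1"
    and ss_in: "ss N \<in> Ts N"
    and cl_less: "cl N < k"
    and valid_EM: "valid (ms N) (cl N) (Es N) (Ms N)"
    and dense_ss: "\<And>i n \<sigma>. i < k \<Longrightarrow> \<sigma> \<in> Ts n \<Longrightarrow> \<exists>N\<ge>n. cl N = i \<and> (\<exists>r. ss N = r @ \<sigma>)"
    and Cs_subtree: "\<And>u. u \<in> Cs (Suc N) \<Longrightarrow> l < ms N \<Longrightarrow> subtree [l] u \<in> Cs N"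
    and Cs_copy: "\<And>u. u \<in> Cs (Suc N) \<Longrightarrow> l < ms N \<Longrightarrow> u [] (Vx l) = leaf (l # ss N) u"
    and Cs_par: "\<And>u. u \<in> Cs (Suc N) \<Longrightarrow> (a, b) \<in> set (Es N) \<Longrightarrow> par (u [] (Vx a)) (u [] (Vx b))"
    and Cs_mem: "\<And>u. u \<in> Cs (Suc N) \<Longrightarrow> (a, j) \<in> set (Ms N) \<Longrightarrow> u [] (Vx a) \<in> cs (Suc N) j"
    and Cs_agree: "\<And>u v t r y p n. u \<in> Cs (Suc N) \<Longrightarrow> v \<in> Cs (Suc N) \<Longrightarrow> t \<in> Ts (Suc N) \<Longrightarrow> r \<le> Suc N \<Longrightarrow>
      to_nat (y, p, n) \<le> N \<Longrightarrow> u (take r t @ y) p n = v (take r t @ y) p n"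
    and small_free: "\<And>c0. cs (Suc N) \<le> c0 \<Longrightarrow> good c0 \<Longrightarrow> \<exists>c1. c0 \<le> c1 \<and> good c1 \<and>
      (\<forall>U. U \<subseteq> Cs N \<longrightarrow> finite U \<longrightarrow> card U < ms N \<longrightarrow> (\<forall>u\<in>U. avoid (Ts N) u c1) \<longrightarrow>
        \<not> inc c1 (cl N) (leaf (ss N) ` U))"

section \<open>Existence of the fusion\<close>

context analytic_quasi_order
begin

text \<open>Bookkeeping: the first component of \<open>prod_decode N\<close> codes a leaf and a
  colour, so that every such pair recurs beyond every stage.\<close>

definition target :: "nat \<Rightarrow> nat list" where
  "target N = fst (from_nat (fst (prod_decode N)) :: nat list \<times> nat)"

definition sel :: "nat \<Rightarrow> nat list set \<Rightarrow> nat list" where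
  "sel N T = (SOME t. t \<in> T \<and>
     ((\<exists>t'\<in>T. \<exists>r. t' = r @ target N) \<longrightarrow>
      (\<exists>r. t = r @ target N)))"

definition colr :: "nat \<Rightarrow> nat" where
  "colr N = snd (from_nat (fst (prod_decode N)) :: nat list \<times> nat) mod k"

lemma sel:
  assumes "T \<noteq> {}"
  shows "sel N T \<in> T"
    and "t' \<in> T \<Longrightarrow> t' = r @ target N \<Longrightarrow>
      \<exists>r. sel N T = r @ target N"
proof -
  have "\<exists>t. t \<in> T \<and> ((\<exists>t'\<in>T. \<exists>r. t' = r @ target N) \<longrightarrow>
      (\<exists>r. t = r @ target N))"
    using assms by (cases "\<exists>t'\<in>T. \<exists>r. t' = r @ target N") auto
  from someI_ex[OF this] have *: "sel N T \<in> T \<and> ((\<exists>t'\<in>T. \<exists>r. t' = r @ target N) \<longrightarrow>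
      (\<exists>r. sel N T = r @ target N))"
    unfolding sel_def .
  show "sel N T \<in> T" using * by simp
  show "\<exists>r. sel N T = r @ target N"
    if "t' \<in> T" "t' = r @ target N"
    using * that by blast
qed

lemma ex_fusion:
  assumes no: "\<not> (\<exists>c. good c \<and> cdom c = UNIV)"
  shows "\<exists>cs Cs Ts ms ss cl Es Ms. fusion le k K cs Cs Ts ms ss cl Es Ms"
proof -
  define NT where "NT m T = {l # t |l t. l < m \<and> t \<in> T}" for m :: nat and T :: "nat list set"
  define Inv where "Inv st \<longleftrightarrow> good (fst st) \<and> closed (fst (snd st)) \<and> finite (snd (snd st)) \<and> snd (snd st) \<noteq> {} \<and>
      bad (fst (snd st)) (snd (snd st)) (fst st)" for st :: "pcol \<times> cfg set \<times> nat list set"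
  define Stp where "Stp N st st' m E M \<longleftrightarrow> fst st \<le> fst st' \<and> snd (snd st') = NT m (snd (snd st)) \<and> m \<ge> 1 \<and>
      valid m (colr N) E M \<and>
      (\<forall>u\<in>fst (snd st'). (\<forall>l<m. subtree [l] u \<in> fst (snd st)) \<and>
        (\<forall>l<m. u [] (Vx l) = leaf (l # sel N (snd (snd st))) u) \<and>
        (\<forall>(a, b)\<in>set E. par (u [] (Vx a)) (u [] (Vx b))) \<and> (\<forall>(a, j)\<in>set M. u [] (Vx a) \<in> fst st' j)) \<and>
      (\<forall>u\<in>fst (snd st'). \<forall>v\<in>fst (snd st'). \<forall>t\<in>snd (snd st'). \<forall>r\<le>Suc N. \<forall>y p n. to_nat (y, p, n) \<le> N \<longrightarrow>
         u (take r t @ y) p n = v (take r t @ y) p n) \<and>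
      (\<forall>c0. fst st' \<le> c0 \<longrightarrow> good c0 \<longrightarrow> (\<exists>c1. c0 \<le> c1 \<and> good c1 \<and>
        (\<forall>U. U \<subseteq> fst (snd st) \<longrightarrow> finite U \<longrightarrow> card U < m \<longrightarrow> (\<forall>u\<in>U. avoid (snd (snd st)) u c1) \<longrightarrow>
          \<not> inc c1 (colr N) (leaf (sel N (snd (snd st))) ` U))))"
    for N and st st' :: "pcol \<times> cfg set \<times> nat list set" and m E M
  have "\<exists>f. \<forall>N. (Inv (f N) \<and> (N = 0 \<longrightarrow> snd (snd (f N)) = {[]})) \<and> (\<exists>m E M. Stp N (f N) (f (Suc N)) m E M)"
  proof (rule dependent_nat_choice)
    \<comment> \<open>A good colouring is never total, so an uncoloured point, taken as constant
      configuration, avoids it.\<close>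
    have "bad UNIV {[]} (\<lambda>_. {})"
      unfolding bad_def
    proof (intro allI impI)
      fix c' assume "good c'"
      then obtain x where "x \<notin> cdom c'" using no by blast
      then have "avoid {[]} (\<lambda>_ _. x) c'" by (simp add: avoid_def leaf_def)
      then show "\<exists>u\<in>UNIV. avoid {[]} u c'" by blast
    qed
    then show "\<exists>st. Inv st \<and> (0 = (0::nat) \<longrightarrow> snd (snd st) = {[]})"
      by (intro exI[of _ "(\<lambda>_. {}, UNIV, {[]})"]) (simp add: Inv_def good_empty)
  next
    fix st :: "pcol \<times> cfg set \<times> nat list set" and N :: nat
    assume A: "Inv st \<and> (N = 0 \<longrightarrow> snd (snd st) = {[]})"
    obtain c C T where st: "st = (c, C, T)" by (cases st)
    have inv: "good c" "closed C" "finite T" "T \<noteq> {}" "bad C T c" using A by (auto simp: Inv_def st)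
    \<comment> \<open>With the latest step first, \<open>take r t\<close> is the node of a copy of
      stage \<open>Suc N - r\<close>. In each such copy all coordinates with code at most
      \<open>N\<close> are frozen; this makes the fusion converge.\<close>
    define S where "S m = {(take r t @ y, p, n) |t r y p n. t \<in> NT m T \<and> r \<le> Suc N \<and> to_nat (y, p::idx, n::nat) \<le> N}" for m
    have finNT: "finite (NT m T)" for m
    proof -
      have "NT m T = (\<lambda>(l, t). l # t) ` ({..<m} \<times> T)" by (auto simp: NT_def)
      then show ?thesis using inv(3) by simp
    qed
    have "finite (S m)" for m
    proof (rule finite_subset)
      show "S m \<subseteq> (\<lambda>(t, r, e). case from_nat e of (y, p, n) \<Rightarrow> (take r t @ y, p, n)) ` (NT m T \<times> {..Suc N} \<times> {..N})"
      proof
        fix q assume "q \<in> S m"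
        then obtain t r y p n where "q = (take r t @ y, p, n)" "t \<in> NT m T" "r \<le> Suc N" "to_nat (y, p, n) \<le> N"
          unfolding S_def by blast
        then show "q \<in> (\<lambda>(t, r, e). case from_nat e of (y, p, n) \<Rightarrow> (take r t @ y, p, n)) ` (NT m T \<times> {..Suc N} \<times> {..N})"
          by (intro image_eqI[of _ _ "(t, r, to_nat (y, p, n))"]) auto
      qed
    qed (use finNT in auto)
    then have "\<forall>m. \<exists>xs. set xs = S m" using finite_list by blast
    then obtain Q where Q: "\<And>m. set (Q m) = S m" by metis
    have i: "colr N < k" using k_pos by (simp add: colr_def)
    from amalgamation_step[OF inv(2,1,5) sel(1)[OF inv(4), of N] i, where Q = Q]
    obtain c' m E M C' where R: "c \<le> c'" "good c'" "closed C'" "m \<ge> 1" "valid m (colr N) E M"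
      "bad C' (NT m T) c'"
      "\<forall>u\<in>C'. (\<forall>l<m. subtree [l] u \<in> C) \<and> (\<forall>l<m. u [] (Vx l) = leaf (l # sel N T) u) \<and>
      (\<forall>(a, b)\<in>set E. par (u [] (Vx a)) (u [] (Vx b))) \<and> (\<forall>(a, j)\<in>set M. u [] (Vx a) \<in> c' j)"
      "\<forall>u\<in>C'. \<forall>v\<in>C'. \<forall>(y, p, n)\<in>set (Q m). u y p n = v y p n"
      "\<forall>c0. c' \<le> c0 \<longrightarrow> good c0 \<longrightarrow> (\<exists>c1. c0 \<le> c1 \<and> good c1 \<and>
      (\<forall>U. U \<subseteq> C \<longrightarrow> finite U \<longrightarrow> card U < m \<longrightarrow> (\<forall>u\<in>U. avoid T u c1) \<longrightarrow> \<not> inc c1 (colr N) (leaf (sel N T) ` U)))"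
      unfolding NT_def[symmetric] by (elim exE conjE) (rule that)
    have "u (take r t @ y) p n = v (take r t @ y) p n"
      if "u \<in> C'" "v \<in> C'" "t \<in> NT m T" "r \<le> Suc N" "to_nat (y, p, n) \<le> N" for u v t r y p n
    proof -
      have "(take r t @ y, p, n) \<in> set (Q m)" unfolding Q S_def using that(3-5) by blast
      then show ?thesis using R(8) that(1,2) by fastforce
    qed
    then have "Stp N st (c', C', NT m T) m E M"
      unfolding Stp_def st fst_conv snd_conv
      by (intro conjI R(1) refl R(4) R(5) R(7) R(9)) (intro ballI allI impI; blast)
    moreover have "Inv (c', C', NT m T)"
    proof -
      have "NT m T \<noteq> {}" using R(4) inv(4) by (auto simp: NT_def intro!: exI[of _ 0])
      then show ?thesis using R finNT by (simp add: Inv_def)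
    qed
    ultimately show "\<exists>st'. (Inv st' \<and> (Suc N = 0 \<longrightarrow> snd (snd st') = {[]})) \<and> (\<exists>m E M. Stp N st st' m E M)"
      by (intro exI[of _ "(c', C', NT m T)"]) blast
  qed
  then obtain f where f': "\<forall>N. (Inv (f N) \<and> (N = 0 \<longrightarrow> snd (snd (f N)) = {[]})) \<and> (\<exists>m E M. Stp N (f N) (f (Suc N)) m E M)" ..
  have f: "Inv (f N)" "snd (snd (f 0)) = {[]}" "\<exists>m E M. Stp N (f N) (f (Suc N)) m E M" for N
    using f'[rule_format, of N] f'[rule_format, of 0] by (simp_all del: split_paired_Ex)
  from f(3) obtain ms Es Ms where Stp: "\<And>N. Stp N (f N) (f (Suc N)) (ms N) (Es N) (Ms N)" by metis
  define cs where "cs N = fst (f N)" for N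
  define Cs where "Cs N = fst (snd (f N))" for N
  define Ts where "Ts N = snd (snd (f N))" for N
  have inv: "good (cs N)" "closed (Cs N)" "finite (Ts N)" "Ts N \<noteq> {}" "bad (Cs N) (Ts N) (cs N)" for N
    using f(1)[of N] by (auto simp: Inv_def cs_def Cs_def Ts_def)
  note S = Stp[unfolded Stp_def, folded cs_def Cs_def Ts_def]
  have TSuc: "Ts (Suc N) = {l # t |l t. l < ms N \<and> t \<in> Ts N}" for N using S[of N] by (simp add: NT_def)
  have m1: "ms N \<ge> 1" for N using S[of N] by simp
  have ext: "\<exists>r. r @ \<sigma> \<in> Ts N" if "\<sigma> \<in> Ts n" "n \<le> N" for \<sigma> n N
    using that(2)
  proof (induction N rule: dec_induct)
    case base then show ?case using that(1) by (intro exI[of _ "[]"]) simp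
  next
    case (step N)
    then obtain r where "r @ \<sigma> \<in> Ts N" by blast
    then have "(0 # r) @ \<sigma> \<in> Ts (Suc N)" using m1[of N] by (auto simp: TSuc)
    then show ?case by blast
  qed
  have "fusion le k K cs Cs Ts ms (\<lambda>N. sel N (Ts N)) colr Es Ms"
  proof unfold_locales
    fix N
    show "good (cs N)" "closed (Cs N)" by (rule inv)+
    show "cs N \<le> cs (Suc N)" using S[of N] by simp
    show "Cs N \<noteq> {}" using inv(5)[of N] inv(1)[of N] by (auto simp: bad_def)
    show "Ts 0 = {[]}" using f(2) by (simp add: Ts_def)
    show "Ts (Suc N) = {l # t |l t. l < ms N \<and> t \<in> Ts N}" by (rule TSuc)
    show "1 \<le> ms N" by (rule m1)
    show "sel N (Ts N) \<in> Ts N" by (rule sel(1)[OF inv(4)])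
    show "colr N < k" using k_pos by (simp add: colr_def)
    show "valid (ms N) (colr N) (Es N) (Ms N)" using S[of N] by simp
  next
    fix i n \<sigma> assume i: "i < k" and \<sigma>: "\<sigma> \<in> Ts n"
    define N where "N = prod_encode (to_nat (\<sigma>, i), n)"
    have N: "n \<le> N" unfolding N_def by (rule le_prod_encode_2)
    have z: "(from_nat (fst (prod_decode N)) :: nat list \<times> nat) = (\<sigma>, i)" by (simp add: N_def)
    have "colr N = i" using i z by (simp add: colr_def)
    moreover obtain r where r: "r @ \<sigma> \<in> Ts N" using ext[OF \<sigma> N] by (elim exE)
    have "\<exists>r. sel N (Ts N) = r @ \<sigma>" by (rule sel(2)[OF inv(4) r, of r N, unfolded target_def z fst_conv, OF refl])
    ultimately show "\<exists>N\<ge>n. colr N = i \<and> (\<exists>r. sel N (Ts N) = r @ \<sigma>)" using N by (intro exI[of _ N] conjI)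
  next
    fix N u assume u: "u \<in> Cs (Suc N)"
    note Su = S[of N, THEN conjunct2, THEN conjunct2, THEN conjunct2, THEN conjunct2, THEN conjunct1, rule_format, OF u]
    show "subtree [l] u \<in> Cs N" if "l < ms N" for l using Su that by simp
    show "u [] (Vx l) = leaf (l # sel N (Ts N)) u" if "l < ms N" for l using Su that by simp
    show "par (u [] (Vx a)) (u [] (Vx b))" if "(a, b) \<in> set (Es N)" for a b using Su that by auto
    show "u [] (Vx a) \<in> cs (Suc N) j" if "(a, j) \<in> set (Ms N)" for a j using Su that by auto
  next
    fix N :: nat and u v :: cfg and t y :: "nat list" and r n :: nat and p :: idx
    assume "u \<in> Cs (Suc N)" "v \<in> Cs (Suc N)" "t \<in> Ts (Suc N)" "r \<le> Suc N" "to_nat (y, p, n) \<le> N"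
    then show "u (take r t @ y) p n = v (take r t @ y) p n"
      using S[of N, THEN conjunct2, THEN conjunct2, THEN conjunct2, THEN conjunct2, THEN conjunct2, THEN conjunct1]
      by simp
  next
    fix N c0 assume "cs (Suc N) \<le> c0" "good c0"
    then show "\<exists>c1. c0 \<le> c1 \<and> good c1 \<and>
      (\<forall>U. U \<subseteq> Cs N \<longrightarrow> finite U \<longrightarrow> card U < ms N \<longrightarrow> (\<forall>u\<in>U. avoid (Ts N) u c1) \<longrightarrow>
        \<not> inc c1 (colr N) (leaf (sel N (Ts N)) ` U))"
      using S[of N, THEN conjunct2, THEN conjunct2, THEN conjunct2, THEN conjunct2, THEN conjunct2, THEN conjunct2]
      by simp
  qed
  then show ?thesis by (intro exI)
qed

end

section \<open>Ordering of generic points\<close>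

context quasi_order
begin

text \<open>Indices rather than values are enumerated, since different indices may have equal or
  equivalent values.\<close>

lemma sort_indices:
  fixes f :: "nat \<Rightarrow> 'a"
  assumes "finite S" "card S = n" "\<And>i i'. i \<in> S \<Longrightarrow> i' \<in> S \<Longrightarrow> \<not> par (f i) (f i')"
  shows "\<exists>e. (\<forall>a<n. e a \<in> S) \<and> (\<forall>a b. a < b \<and> b < n \<longrightarrow> e a \<noteq> e b \<and> f (e a) \<preceq> f (e b))"
  using assms
proof (induction n arbitrary: S)
  case 0
  then show ?case by simp
next
  case (Suc n)
  have "S \<noteq> {}" using Suc.prems(2) by auto
  then obtain m where m: "m \<in> S" "\<forall>x\<in>S. f x \<preceq> f m"
    using finite_chain_has_max[of "f ` S"] Suc.prems(1,3) by auto
  have "card (S - {m}) = n" using Suc.prems(1,2) m(1) by simp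
  from Suc.IH[OF _ this] Suc.prems(1,3)
  obtain e where e: "\<forall>a<n. e a \<in> S - {m}" "\<forall>a b. a < b \<and> b < n \<longrightarrow> e a \<noteq> e b \<and> f (e a) \<preceq> f (e b)"
    by auto
  show ?case
  proof (intro exI[of _ "e(n := m)"] conjI allI impI)
    fix a assume "a < Suc n"
    then show "(e(n := m)) a \<in> S" using e(1) m(1) by (cases "a = n") auto
  next
    fix a b assume ab: "a < b \<and> b < Suc n"
    then have "e a \<in> S - {m}" using e(1) by auto
    then show "(e(n := m)) a \<noteq> (e(n := m)) b" "f ((e(n := m)) a) \<preceq> f ((e(n := m)) b)"
      using ab e(2) m(2) by (cases "b = n"; auto)+
  qed
qed

text \<open>All vertex functions of a connected pattern order generic points in the same way, hence a vertex
  function can be compared with any other one along the sorted points; a fixed answer \<open>b\<close> for all pairs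
  is impossible.\<close>

lemma order_core:
  fixes P :: "'j \<Rightarrow> 'z \<Rightarrow> 'a" and zs :: "nat \<Rightarrow> 'z"
  assumes adj_sym: "\<And>j l. (j, l) \<in> Adj \<Longrightarrow> (l, j) \<in> Adj"
    and adj_par: "\<And>j l z. (j, l) \<in> Adj \<Longrightarrow> par (P j z) (P l z)"
    and conn: "(j1, j2) \<in> Adj ^^ q" and nonempty: "(j1, j0) \<in> Adj"
    and cross: "\<And>i i' j l. i \<noteq> i' \<Longrightarrow> (j, l) \<in> Adj \<Longrightarrow> \<not> par (P j (zs i)) (P l (zs i'))"
    and self: "\<And>i i' j l. i \<noteq> i' \<Longrightarrow> (j, l) \<in> Adj \<Longrightarrow> \<not> par (P j (zs i)) (P j (zs i'))"
    and rel: "\<And>i i'. i \<noteq> i' \<Longrightarrow> P j1 (zs i) \<preceq> P j2 (zs i') \<longleftrightarrow> b"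
  shows False
proof -
  define X where "X j i = P j (zs i)" for j i
  have par: "par (X j i) (X l i)" if "(j, l) \<in> Adj" for j l i
    using adj_par[OF that] by (simp add: X_def)
  have cr: "X j i \<preceq> X l i' \<or> X l i' \<preceq> X j i" if "i \<noteq> i'" "(j, l) \<in> Adj" for i i' j l
    using cross[OF that] by (auto simp: X_def par_def)
  have se: "X j i \<preceq> X j i' \<or> X j i' \<preceq> X j i" if "i \<noteq> i'" "(j, l) \<in> Adj" for i i' j l
    using self[OF that] by (auto simp: X_def par_def)
  \<comment> \<open>If the values of \<open>j\<close> at \<open>i\<close> and \<open>i'\<close> were
    equivalent, comparability of \<open>X j i\<close> with \<open>X l i'\<close> would make
    \<open>X j i'\<close> comparable with \<open>X l i'\<close>.\<close>
  have strict: "\<not> X j i' \<preceq> X j i" if "i \<noteq> i'" "(j, l) \<in> Adj" "X j i \<preceq> X j i'" for i i' j l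
  proof
    assume le: "X j i' \<preceq> X j i"
    have "X j i \<preceq> X l i' \<or> X l i' \<preceq> X j i" by (rule cr[OF that(1,2)])
    then have "X j i' \<preceq> X l i' \<or> X l i' \<preceq> X j i'" using le that(3) le_trans by blast
    then show False using par[OF that(2), of i'] by (auto simp: par_def)
  qed
  \<comment> \<open>Adjacent vertex functions order \<open>i\<close> and \<open>i'\<close> alike:
    each opposite comparison would compare \<open>X j\<close> and \<open>X l\<close> at the same
    index.\<close>
  have trans: "X j i \<preceq> X l i'" "X l i \<preceq> X j i'" "X l i \<preceq> X l i'"
    if ii: "i \<noteq> i'" and jl: "(j, l) \<in> Adj" and le: "X j i \<preceq> X j i'" for i i' j l
  proof -
    have np: "\<not> X j i \<preceq> X l i" "\<not> X l i \<preceq> X j i" "\<not> X j i' \<preceq> X l i'" "\<not> X l i' \<preceq> X j i'"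
      using par[OF jl] by (auto simp: par_def)
    show 1: "X j i \<preceq> X l i'" using cr[OF ii jl] np(4) le le_trans by blast
    show "X l i \<preceq> X j i'" using cr[OF ii[symmetric] jl] np(1) le le_trans by blast
    show "X l i \<preceq> X l i'" using se[OF ii adj_sym[OF jl]] np(1) 1 le_trans by blast
  qed
  have npX: "\<not> par (X j1 i) (X j1 i')" for i i'
    using se[OF _ nonempty, of i i'] le_refl by (cases "i = i'") (auto simp: par_def)
  \<comment> \<open>A walk of length \<open>q\<close> leads from position \<open>0\<close> to
    position \<open>q\<close>; one further position is needed for a point strictly above.\<close>
  have "\<exists>e. (\<forall>a<q + 2. e a \<in> {..<q + 2}) \<and> (\<forall>a b. a < b \<and> b < q + 2 \<longrightarrow> e a \<noteq> e b \<and> X j1 (e a) \<preceq> X j1 (e b))"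
    by (rule sort_indices) (use npX in auto)
  then obtain e where "(\<forall>a<q + 2. e a \<in> {..<q + 2}) \<and> (\<forall>a b. a < b \<and> b < q + 2 \<longrightarrow> e a \<noteq> e b \<and> X j1 (e a) \<preceq> X j1 (e b))" ..
  then have e: "\<And>a b. a < b \<Longrightarrow> b < q + 2 \<Longrightarrow> e a \<noteq> e b \<and> X j1 (e a) \<preceq> X j1 (e b)" by simp
  \<comment> \<open>Each edge of the walk costs one position in the sorted list.\<close>
  have chain: "(\<forall>a b. a < b \<longrightarrow> b < q + 2 \<longrightarrow> X l (e a) \<preceq> X l (e b)) \<and>
      (\<forall>a b. a + q' \<le> b \<longrightarrow> b < q + 2 \<longrightarrow> X j1 (e a) \<preceq> X l (e b) \<and> X l (e a) \<preceq> X j1 (e b))"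
    if "(j1, l) \<in> Adj ^^ q'" for q' l
    using that
  proof (induction q' arbitrary: l)
    case 0
    then have l: "l = j1" by simp
    have "X j1 (e a) \<preceq> X j1 (e b)" if "a \<le> b" "b < q + 2" for a b
      using e[of a b] that le_refl by (cases "a = b") auto
    then show ?case unfolding l by simp
  next
    case (Suc q')
    then obtain l0 where l0: "(j1, l0) \<in> Adj ^^ q'" "(l0, l) \<in> Adj" by auto
    note IH = Suc.IH[OF l0(1)]
    have m0: "X l0 (e a) \<preceq> X l0 (e b)" if "a < b" "b < q + 2" for a b using IH that by blast
    have T: "X l0 (e a) \<preceq> X l (e b)" "X l (e a) \<preceq> X l0 (e b)" "X l (e a) \<preceq> X l (e b)"
      if "a < b" "b < q + 2" for a b
      using trans[OF _ l0(2) m0[OF that]] e[OF that] by blast+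
    have "X j1 (e a) \<preceq> X l (e b)" "X l (e a) \<preceq> X j1 (e b)" if ab: "a + Suc q' \<le> b" "b < q + 2" for a b
    proof -
      obtain b' where b': "b = Suc b'" using ab by (cases b) auto
      have "X j1 (e a) \<preceq> X l0 (e b')" using IH ab b' by auto
      moreover have "X l0 (e b') \<preceq> X l (e b)" using T(1)[of b' b] ab b' by auto
      ultimately show "X j1 (e a) \<preceq> X l (e b)" by (rule le_trans)
      have "X l (e a) \<preceq> X l0 (e (Suc a))" using T(2)[of a "Suc a"] ab by auto
      moreover have "X l0 (e (Suc a)) \<preceq> X j1 (e b)" using IH ab by auto
      ultimately show "X l (e a) \<preceq> X j1 (e b)" by (rule le_trans)
    qed
    then show ?case using T(3) by blast
  qed
  note ch = chain[OF conn, THEN conjunct2, rule_format]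
  have ne: "e 0 \<noteq> e (q + 1)" "e q \<noteq> e (q + 1)" using e[of 0 "q + 1"] e[of q "q + 1"] by auto
  show False
  proof (cases b)
    case False
    have "X j1 (e 0) \<preceq> X j2 (e (q + 1))" using ch[of 0 "q + 1"] by simp
    then show False using rel[OF ne(1)] False by (simp add: X_def)
  next
    case True
    have "X j1 (e (q + 1)) \<preceq> X j2 (e 0)" using rel[OF ne(1)[symmetric]] True by (simp add: X_def)
    moreover have "X j2 (e 0) \<preceq> X j1 (e q)" using ch[of 0 q] by simp
    ultimately have "X j1 (e (q + 1)) \<preceq> X j1 (e q)" by (rule le_trans)
    moreover have "X j1 (e q) \<preceq> X j1 (e (q + 1))" using e[of q "q + 1"] by simp
    ultimately show False using strict[OF ne(2) nonempty] by blast
  qed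
qed

end

lemma tendsto_fun:
  fixes f :: "'x \<Rightarrow> 'i \<Rightarrow> 'b::topological_space"
  assumes "\<And>i. ((\<lambda>n. f n i) \<longlongrightarrow> l i) F"
  shows "(f \<longlongrightarrow> l) F"
proof -
  have "limitin (product_topology (\<lambda>_. euclidean) UNIV) f l F"
    using assms by (simp add: limitin_componentwise limitin_canonical_iff)
  then show ?thesis by (simp add: euclidean_product_topology limitin_canonical_iff)
qed

lemma continuous_finite_dep:
  fixes f :: "cantor \<Rightarrow> 'b::topological_space"
  assumes "\<And>z z'. (\<forall>j<m. z j = z' j) \<Longrightarrow> f z = f z'"
  shows "continuous_on UNIV f"
proof -
  have "open (f -` U)" for U
  proof -
    have "f -` U = (\<Union>z\<in>f -` U. nbhd m z)"
      using assms by (auto simp: nbhd_def)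
    also have "open \<dots>" by (intro open_UN ballI open_nbhd)
    finally show ?thesis .
  qed
  then show ?thesis by (simp add: continuous_on_open_vimage)
qed

section \<open>The limit of the fusion and the map from Cantor space\<close>

context fusion
begin

definition adm :: "baire \<Rightarrow> bool" where
  "adm w \<longleftrightarrow> (\<forall>j. w j < ms j)"

text \<open>The address, inside a configuration of stage \<open>N\<close>, of the copy of stage
  \<open>n\<close> that the branch \<open>w\<close> selects; the reversal puts the latest step
  first.\<close>

definition path :: "baire \<Rightarrow> nat \<Rightarrow> nat \<Rightarrow> nat list" where
  "path w n N = map w (rev [n..<N])"

lemma path_same [simp]: "path w n n = []"
  by (simp add: path_def)

lemma path_Suc: "n \<le> N \<Longrightarrow> path w n (Suc N) = w N # path w n N"
  by (simp add: path_def)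

lemma length_path [simp]: "length (path w n N) = N - n"
  by (simp add: path_def)

lemma path_append: "n \<le> m \<Longrightarrow> m \<le> N \<Longrightarrow> path w m N @ path w n m = path w n N"
  unfolding path_def by (metis map_append rev_append upt_add_eq_append le_add_diff_inverse)

lemma path_cong: "(\<And>j. n \<le> j \<Longrightarrow> j < N \<Longrightarrow> w j = w' j) \<Longrightarrow> path w n N = path w' n N"
  by (simp add: path_def)

lemma path_in_Ts: "adm w \<Longrightarrow> path w 0 N \<in> Ts N"
  by (induction N) (auto simp: Ts_0 Ts_Suc path_Suc adm_def)

lemma take_path: "n \<le> N \<Longrightarrow> take (N - n) (path w 0 N) = path w n N"
  using path_append[of 0 n N w] by (metis append_eq_conv_conj length_path le0)

lemma Ts_path: "t \<in> Ts N \<Longrightarrow> \<exists>w. adm w \<and> path w 0 N = t"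
proof (induction N arbitrary: t)
  case 0
  have "adm (\<lambda>_. 0)" using ms_pos by (auto simp: adm_def Suc_le_eq)
  then show ?case using 0 by (auto simp: Ts_0)
next
  case (Suc N)
  then obtain l t' where t: "t = l # t'" "l < ms N" "t' \<in> Ts N" by (auto simp: Ts_Suc)
  obtain w where w: "adm w" "path w 0 N = t'" using Suc.IH[OF t(3)] by blast
  have "adm (w(N := l))" using w(1) t(2) by (auto simp: adm_def)
  moreover have "path (w(N := l)) 0 (Suc N) = t"
    using t(1) w(2) path_cong[of 0 N "w(N := l)" w] by (simp add: path_Suc)
  ultimately show ?case by blast
qed

lemma finite_Ts: "finite (Ts N)"
proof (induction N)
  case (Suc N)
  have "Ts (Suc N) = (\<lambda>(l, t). l # t) ` ({..<ms N} \<times> Ts N)" by (auto simp: Ts_Suc)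
  then show ?case using Suc by simp
qed (simp add: Ts_0)

lemma subtree_subtree: "subtree p (subtree q u) = subtree (q @ p) u"
  by (simp add: subtree_def)

lemma subtree_Nil [simp]: "subtree [] u = u"
  by (simp add: subtree_def)

lemma subtree_path_in:
  assumes "adm w" "n \<le> N" "u \<in> Cs N"
  shows "subtree (path w n N) u \<in> Cs n"
  using assms(2,3)
proof (induction N arbitrary: u rule: dec_induct)
  case base then show ?case by simp
next
  case (step N)
  have "subtree [w N] u \<in> Cs N" using step.prems assms(1) Cs_subtree by (simp add: adm_def)
  then have "subtree (path w n N) (subtree [w N] u) \<in> Cs n" by (rule step.IH)
  then show ?case using step.hyps by (simp add: subtree_subtree path_Suc)
qed

definition rep :: "nat \<Rightarrow> cfg" where
  "rep N = (SOME u. u \<in> Cs N)"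

lemma rep_in: "rep N \<in> Cs N"
  unfolding rep_def using Cs_nonempty[of N] by (simp add: some_in_eq)

text \<open>The stage-\<open>n\<close> configuration that the branch converges to. A coordinate is
  frozen as soon as the stage exceeds its code, so an arbitrary representative of that stage gives
  its value.\<close>

definition lim :: "nat \<Rightarrow> baire \<Rightarrow> cfg" where
  "lim n w = (\<lambda>y p i. let N = max n (Suc (to_nat (y, p, i))) in rep N (path w n N @ y) p i)"

text \<open>The stage-\<open>N\<close> part of \<open>v\<close> along the branch lies in
  \<open>Cs N\<close>, and \<open>Cs_agree\<close> says that all members of \<open>Cs N\<close>
  agree at this coordinate.\<close>

lemma stable:
  assumes w: "adm w" and N: "n \<le> N" "to_nat (y, p, i) < N" "N \<le> N'" and uv: "u \<in> Cs N" "v \<in> Cs N'"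
  shows "v (path w n N' @ y) p i = u (path w n N @ y) p i"
proof -
  obtain N0 where N0: "N = Suc N0" using N(2) by (cases N) auto
  have "subtree (path w N N') v \<in> Cs N" by (rule subtree_path_in[OF w N(3) uv(2)])
  then have "subtree (path w N N') v (take (N - n) (path w 0 N) @ y) p i = u (take (N - n) (path w 0 N) @ y) p i"
    using Cs_agree[of "subtree (path w N N') v" N0 u "path w 0 N" "N - n" y p i] uv(1) path_in_Ts[OF w, of N] N(2)
    unfolding N0 by simp
  then show ?thesis using path_append[OF N(1,3), of w] unfolding take_path[OF N(1)] subtree_def
    by (metis append_assoc)
qed

lemma lim_eq:
  assumes "adm w" "n \<le> N" "to_nat (y, p, i) < N" "u \<in> Cs N"
  shows "lim n w y p i = u (path w n N @ y) p i"
  unfolding lim_def Let_def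
  by (rule stable[symmetric, OF assms(1) _ _ _ rep_in assms(4)]) (use assms in auto)

lemma lim_in:
  assumes w: "adm w"
  shows "lim n w \<in> Cs n"
proof (rule Lim_in_closed_set[OF closed_Cs])
  let ?f = "\<lambda>N. subtree (path w n N) (rep N)"
  show "\<forall>\<^sub>F N in sequentially. ?f N \<in> Cs n"
    using eventually_ge_at_top[of n] by eventually_elim (rule subtree_path_in[OF w _ rep_in])
  show "?f \<longlonglongrightarrow> lim n w"
  proof (intro tendsto_fun)
    fix y p i
    have "\<forall>\<^sub>F N in sequentially. ?f N y p i = lim n w y p i"
      using eventually_ge_at_top[of n] eventually_gt_at_top[of "to_nat (y, p, i)"]
      by eventually_elim (simp add: subtree_def lim_eq[OF w _ _ rep_in])
    then show "(\<lambda>N. ?f N y p i) \<longlonglongrightarrow> lim n w y p i" by (rule tendsto_eventually)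
  qed
qed simp

lemma lim_subtree:
  assumes w: "adm w" and n: "n \<le> N"
  shows "subtree (path w n N) (lim N w) = lim n w"
proof (intro ext)
  fix y :: "nat list" and p :: idx and i :: nat
  define M where "M = Suc (max N (max (to_nat (y, p, i)) (to_nat (path w n N @ y, p, i))))"
  have "subtree (path w n N) (lim N w) y p i = rep M (path w N M @ path w n N @ y) p i"
    unfolding subtree_def by (rule lim_eq[OF w _ _ rep_in]) (auto simp: M_def)
  also have "path w N M @ path w n N @ y = path w n M @ y"
    using path_append[OF n, of M w] by (metis M_def append_assoc max.cobounded1 le_SucI)
  also have "rep M (path w n M @ y) p i = lim n w y p i"
    by (rule lim_eq[symmetric, OF w _ _ rep_in]) (use n in \<open>auto simp: M_def\<close>)
  finally show "subtree (path w n N) (lim N w) y p i = lim n w y p i" .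
qed

lemma lim_cong: "(\<And>j. n \<le> j \<Longrightarrow> w j = w' j) \<Longrightarrow> lim n w = lim n w'"
  unfolding lim_def Let_def using path_cong[of n _ w w'] by simp

text \<open>Cantor space maps onto the admissible sequences: block \<open>N\<close> of \<open>ms N\<close> bits is read in unary.\<close>

fun ell :: "nat \<Rightarrow> nat" where
  "ell 0 = 0"
| "ell (Suc N) = ell N + ms N"

definition zeta :: "cantor \<Rightarrow> nat \<Rightarrow> nat" where
  "zeta z N = (LEAST j. ms N - 1 \<le> j \<or> z (ell N + j))"

lemma ell_mono: "N \<le> N' \<Longrightarrow> ell N \<le> ell N'"
  by (induction N' rule: dec_induct) auto

lemma le_ell: "n \<le> ell n"
proof (induction n)
  case (Suc n)
  then show ?case using ms_pos[of n] by simp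
qed simp

lemma zeta_less: "zeta z N < ms N"
proof -
  have "zeta z N \<le> ms N - 1" unfolding zeta_def by (rule Least_le) simp
  then show ?thesis using ms_pos[of N] by linarith
qed

lemma adm_zeta: "adm (zeta z)"
  by (simp add: adm_def zeta_less)

lemma zeta_cong:
  assumes "\<And>j. ell N \<le> j \<Longrightarrow> j < ell (Suc N) \<Longrightarrow> z j = z' j"
  shows "zeta z N = zeta z' N"
proof -
  have "(ms N - 1 \<le> j \<or> z (ell N + j)) = (ms N - 1 \<le> j \<or> z' (ell N + j))" for j
    using assms[of "ell N + j"] by (cases "j < ms N") auto
  then show ?thesis unfolding zeta_def by simp
qed

lemma zeta_mix:
  "zeta (mix (ell N) x z) j = (if j < N then zeta x j else zeta z j)"
proof -
  have "zeta (mix (ell N) x z) j = zeta x j" if "j < N"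
    using ell_mono[of "Suc j" N] that by (intro zeta_cong) (auto simp: mix_def)
  moreover have "zeta (mix (ell N) x z) j = zeta z j" if "\<not> j < N"
    using ell_mono[of N j] that by (intro zeta_cong) (auto simp: mix_def)
  ultimately show ?thesis by simp
qed

lemma block_unique:
  assumes "ell N + a = ell N' + b" "a < ms N" "b < ms N'"
  shows "N = N'"
proof (rule ccontr)
  assume "N \<noteq> N'"
  then consider "Suc N \<le> N'" | "Suc N' \<le> N" by linarith
  then show False
  proof cases
    case 1 then show False using ell_mono[OF 1] assms by simp
  next
    case 2 then show False using ell_mono[OF 2] assms by simp
  qed
qed

text \<open>Placing a single true bit in each later block realizes any prescribed continuation of
  the address without leaving the neighbourhood of length \<open>ell n\<close>.\<close>

lemma zeta_onto:
  assumes t: "t \<in> Ts M" "n \<le> M" "t = r @ path (zeta x) 0 n"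
  shows "\<exists>x'. (\<forall>j<ell n. x' j = x j) \<and> path (zeta x') 0 M = t"
proof -
  obtain w where w: "adm w" "path w 0 M = t" using Ts_path[OF t(1)] by blast
  define x' where "x' j = (if j < ell n then x j else \<exists>N\<ge>n. j = ell N + w N)" for j
  have low: "zeta x' j = zeta x j" if "j < n" for j
    using ell_mono[of "Suc j" n] that by (intro zeta_cong) (auto simp: x'_def)
  have high: "zeta x' N = w N" if N: "n \<le> N" for N
    unfolding zeta_def
  proof (rule Least_equality)
    have "ell n \<le> ell N" using ell_mono N by blast
    then show "ms N - 1 \<le> w N \<or> x' (ell N + w N)" using N by (auto simp: x'_def)
  next
    fix j assume j: "ms N - 1 \<le> j \<or> x' (ell N + j)"
    show "w N \<le> j"
    proof (rule ccontr)
      assume lt: "\<not> w N \<le> j"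
      have wN: "w N < ms N" using w(1) by (simp add: adm_def)
      then have "x' (ell N + j)" using j lt by auto
      moreover have "ell n \<le> ell N" using ell_mono N by blast
      ultimately obtain N' where N': "ell N + j = ell N' + w N'" by (auto simp: x'_def)
      have "N = N'" using block_unique[OF N'] lt wN w(1) by (auto simp: adm_def)
      then show False using N' lt by simp
    qed
  qed
  have "path w n M @ path w 0 n = r @ path (zeta x) 0 n"
    using path_append[of 0 n M w] w(2) t(2,3) by simp
  then have "path w 0 n = path (zeta x) 0 n" by simp
  moreover have "path (zeta x') 0 n = path (zeta x) 0 n" by (rule path_cong) (simp add: low)
  moreover have "path (zeta x') n M = path w n M" by (rule path_cong) (simp add: high)
  ultimately have "path (zeta x') 0 M = t"
    using path_append[of 0 n M w] path_append[of 0 n M "zeta x'"] w(2) t(2) by simp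
  moreover have "\<forall>j<ell n. x' j = x j" by (simp add: x'_def)
  ultimately show ?thesis by blast
qed

lemma Ts_zeta: "t \<in> Ts N \<Longrightarrow> \<exists>x. path (zeta x) 0 N = t"
  using zeta_onto[of t N 0 t] by auto

definition phi :: "cantor \<Rightarrow> nat \<Rightarrow> nat" where
  "phi z = leaf [] (lim 0 (zeta z))"

text \<open>The bits before \<open>ell N\<close> only select a leaf; the stage-\<open>N\<close>
  configuration depends on the later bits alone. So points with a common tail are leaves of one
  configuration.\<close>

lemma phi_mix: "phi (mix (ell N) x z) = leaf (path (zeta x) 0 N) (lim N (zeta z))"
proof -
  let ?w = "zeta (mix (ell N) x z)"
  have "lim 0 ?w = subtree (path ?w 0 N) (lim N ?w)" by (rule lim_subtree[symmetric, OF adm_zeta]) simp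
  moreover have "path ?w 0 N = path (zeta x) 0 N" by (rule path_cong) (simp add: zeta_mix)
  moreover have "lim N ?w = lim N (zeta z)" by (rule lim_cong) (simp add: zeta_mix)
  ultimately show ?thesis by (simp add: phi_def leaf_def subtree_def)
qed

lemma continuous_lim: "continuous_on UNIV (\<lambda>z. lim N (zeta z) y p)"
proof (rule continuous_on_coordinatewise_then_product)
  fix i :: nat
  define M where "M = max N (Suc (to_nat (y, p, i)))"
  have "lim N (zeta z) y p i = lim N (zeta z') y p i" if "\<forall>j<ell M. z j = z' j" for z z'
  proof -
    have "path (zeta z) N M = path (zeta z') N M"
    proof (rule path_cong)
      fix j assume "N \<le> j" "j < M"
      then have "ell (Suc j) \<le> ell M" by (intro ell_mono) simp
      then show "zeta z j = zeta z' j" using that by (intro zeta_cong) auto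
    qed
    then show ?thesis by (simp add: lim_def M_def Let_def)
  qed
  then show "continuous_on UNIV (\<lambda>z. lim N (zeta z) y p i)" by (rule continuous_finite_dep)
qed

lemma continuous_phi: "continuous_on UNIV phi"
  using continuous_lim[of 0 "[]" "Vx 0"] by (simp add: phi_def[abs_def] leaf_def)

definition cw :: "nat \<Rightarrow> baire set" where
  "cw = (\<lambda>j. \<Union>N. cs N j)"

lemma cs_le_cw: "cs N \<le> cw"
  unfolding cw_def by (rule chain_le_UN)

lemma good_cw: "good cw"
  unfolding cw_def by (rule good_UN_chain[of cs, OF cs_Suc good_cs])

text \<open>Stated for a colouring \<open>h\<close> of the indices because it is also applied to one
  glued from two colourings of the points.\<close>

lemma copies_not_constant:
  assumes u: "u \<in> Cs (Suc N)" and h: "\<And>a. h a < k"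
    and E: "\<And>a b. (a, b) \<in> set (Es N) \<Longrightarrow> h a \<noteq> h b"
    and M: "\<And>a j. (a, j) \<in> set (Ms N) \<Longrightarrow> h a = j"
  shows "\<exists>l<ms N. h l \<noteq> cl N"
proof (rule ccontr)
  assume "\<not> ?thesis"
  then have "\<forall>l<ms N. h l = cl N" by simp
  moreover have "\<forall>(a, b)\<in>set (Es N). h a \<noteq> h b" "\<forall>(a, j)\<in>set (Ms N). h a = j" "\<forall>a. h a < k"
    using E M h by auto
  ultimately show False using valid_EM[of N] unfolding valid_def
    by (elim conjE notE) (intro exI[of _ h] conjI)
qed

lemma Cs_mem_col:
  assumes "u \<in> Cs (Suc N)" "cs (Suc N) \<le> c" "col c d" "(a, j) \<in> set (Ms N)"
  shows "d (u [] (Vx a)) = j"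
proof -
  have "u [] (Vx a) \<in> cs (Suc N) j" by (rule Cs_mem[OF assms(1,4)])
  then have "u [] (Vx a) \<in> c j" using assms(2) by (auto simp: le_fun_def)
  moreover have "j < k" using valid_EM[of N] assms(4) by (auto simp: valid_def)
  ultimately show ?thesis using assms(3) by (simp add: col_def)
qed

lemma copies_not_constant_col:
  assumes u: "u \<in> Cs (Suc N)" and c: "cs (Suc N) \<le> c" "col c d"
  shows "\<exists>l<ms N. d (u [] (Vx l)) \<noteq> cl N"
proof (rule copies_not_constant[OF u])
  show "d (u [] (Vx a)) < k" for a using c(2) by (simp add: col_def)
  show "d (u [] (Vx a)) \<noteq> d (u [] (Vx b))" if "(a, b) \<in> set (Es N)" for a b
    using Cs_par[OF u that] c(2) by (simp add: col_def)
  show "d (u [] (Vx a)) = j" if "(a, j) \<in> set (Ms N)" for a j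
    by (rule Cs_mem_col[OF u c that])
qed

text \<open>The copies at scale \<open>N\<close> cannot all receive the colour \<open>cl N\<close>; since these scales are dense, no Borel
  piece of an extending colouring is non-meager.\<close>

lemma phi_avoid:
  assumes c': "cw \<le> c'" "good c'"
  shows "meager (phi -` cdom c')"
proof -
  have "meager (phi -` c' j)" if j: "j < k" for j
  proof (rule ccontr)
    assume nm: "\<not> meager (phi -` c' j)"
    have "c' j \<in> sigma_sets UNIV {U. open U}" using c'(2) by (simp add: good_def sets_borel)
    then have "decided (phi -` c' j)" by (rule decided_sigma_sets[OF continuous_phi])
    moreover have "\<not> meager (phi -` c' j \<inter> nbhd 0 x)" for x using nm by (simp add: nbhd_def)
    ultimately obtain n x where x: "meager (nbhd n x - phi -` c' j)" using decided_not_meager by blast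
    obtain N r where N: "n \<le> N" "cl N = j" "ss N = r @ path (zeta x) 0 n"
      using dense_ss[OF j path_in_Ts[OF adm_zeta]] by blast
    \<comment> \<open>Inside the neighbourhood where the class \<open>j\<close> is comeager there
      are heads that reach each copy of the leaf \<open>ss N\<close>; a generic common tail then
      puts all copies into this class.\<close>
    have "\<exists>x'. (\<forall>i<ell n. x' i = x i) \<and> path (zeta x') 0 (Suc N) = l # ss N" if "l < ms N" for l
      by (rule zeta_onto[of _ _ _ "l # r"]) (use that ss_in[of N] N in \<open>auto simp: Ts_Suc\<close>)
    then obtain X where X: "\<And>l i. l < ms N \<Longrightarrow> i < ell n \<Longrightarrow> X l i = x i"
      "\<And>l. l < ms N \<Longrightarrow> path (zeta (X l)) 0 (Suc N) = l # ss N" by metis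
    have "meager {y. mix (ell (Suc N)) (X l) y \<notin> phi -` c' j}" if l: "l < ms N" for l
    proof (rule meager_subset[OF meager_vimage_mix[OF x, of "ell (Suc N)" "X l"]])
      have "X l \<in> nbhd n x" using X(1)[OF l] le_ell[of n] by (auto simp: nbhd_def)
      moreover have "n \<le> ell (Suc N)" using le_ell[of n] ell_mono[of n "Suc N"] N(1) by linarith
      ultimately have "mix (ell (Suc N)) (X l) y \<in> nbhd n x" for y by (intro mix_in_nbhd)
      then show "{y. mix (ell (Suc N)) (X l) y \<notin> phi -` c' j} \<subseteq>
          {y. mix (ell (Suc N)) (X l) y \<in> nbhd n x - phi -` c' j}" by blast
    qed
    then have "meager (\<Union>l\<in>{..<ms N}. {y. mix (ell (Suc N)) (X l) y \<notin> phi -` c' j})"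
      by (intro meager_UN) auto
    moreover have "\<not> meager (UNIV :: cantor set)" using not_meager_nbhd[of 0] by (simp add: nbhd_def)
    ultimately have "(\<Union>l\<in>{..<ms N}. {y. mix (ell (Suc N)) (X l) y \<notin> phi -` c' j}) \<noteq> UNIV" by metis
    then obtain y where "y \<notin> (\<Union>l\<in>{..<ms N}. {y. mix (ell (Suc N)) (X l) y \<notin> phi -` c' j})" by (auto simp del: UN_iff)
    then have y: "phi (mix (ell (Suc N)) (X l) y) \<in> c' j" if "l < ms N" for l using that by simp
    define u where "u = lim (Suc N) (zeta y)"
    have u: "u \<in> Cs (Suc N)" unfolding u_def by (rule lim_in[OF adm_zeta])
    obtain d where d: "col c' d" using c'(2) by (auto simp: good_def)
    have le: "cs (Suc N) \<le> c'" using cs_le_cw c'(1) by (rule order_trans)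
    have v: "\<forall>l<ms N. d (u [] (Vx l)) = cl N"
    proof (intro allI impI)
      fix l assume l: "l < ms N"
      have "u [] (Vx l) = phi (mix (ell (Suc N)) (X l) y)"
        unfolding phi_mix X(2)[OF l] u_def[symmetric] by (rule Cs_copy[OF u l])
      then have "u [] (Vx l) \<in> c' j" using y[OF l] by simp
      then show "d (u [] (Vx l)) = cl N" using d j N(2) by (simp add: col_def)
    qed
    show False using copies_not_constant_col[OF u le d] v by blast
  qed
  then have "meager (\<Union>j\<in>{..<k}. phi -` c' j)" by (intro meager_UN) auto
  moreover have "phi -` cdom c' = (\<Union>j\<in>{..<k}. phi -` c' j)" by (auto simp: cdom_def)
  ultimately show ?thesis by simp
qed

lemma leaf_avoid:
  assumes "cw \<le> c'" "good c'" "t \<in> Ts N"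
  shows "meager {z. leaf t (lim N (zeta z)) \<in> cdom c'}"
proof -
  obtain x where x: "path (zeta x) 0 N = t" using Ts_zeta[OF assms(3)] by blast
  have "meager {z. mix (ell N) x z \<in> phi -` cdom c'}" by (rule meager_vimage_mix[OF phi_avoid[OF assms(1,2)]])
  then show ?thesis using x by (simp add: phi_mix)
qed

text \<open>With one copy at each stage there would be one branch and one point; a stage whose
  colour is that of this point would have a false certificate.\<close>

lemma ex_branching: "\<exists>n. ms n \<ge> 2"
proof (rule ccontr)
  assume "\<not> ?thesis"
  then have one: "ms n = 1" for n using ms_pos[of n] by (metis One_nat_def Suc_1 le_antisym not_less_eq_eq)
  define w :: "nat \<Rightarrow> nat" where "w = (\<lambda>_. 0)"
  have w: "adm w" by (simp add: adm_def w_def one)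
  obtain d where d: "col cw d" using good_cw by (auto simp: good_def)
  have dk: "d (leaf [] (lim 0 w)) < k" using d by (simp add: col_def)
  obtain N where N: "cl N = d (leaf [] (lim 0 w))" using dense_ss[OF dk path_in_Ts[OF w]] by blast
  define u where "u = lim (Suc N) w"
  have u: "u \<in> Cs (Suc N)" unfolding u_def by (rule lim_in[OF w])
  have single: "t = path w 0 M" if "t \<in> Ts M" for t M
    using that by (induction M arbitrary: t) (auto simp: Ts_0 Ts_Suc one path_Suc w_def)
  have "0 # ss N = path w 0 (Suc N)" using ss_in[of N] by (intro single) (auto simp: Ts_Suc one)
  then have "u [] (Vx 0) = leaf [] (lim 0 w)"
    using Cs_copy[OF u, of 0] lim_subtree[OF w, of 0 "Suc N"] unfolding u_def[symmetric]
    by (simp add: one leaf_def subtree_def) (metis append_Nil2)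
  then have v: "\<forall>l<ms N. d (u [] (Vx l)) = cl N" using N by (simp add: one)
  show False using copies_not_constant_col[OF u cs_le_cw d] v by blast
qed

end

section \<open>Possible colours and the contradiction\<close>

context fusion
begin

definition vtx :: "nat \<Rightarrow> nat list \<times> nat \<Rightarrow> cantor \<Rightarrow> nat \<Rightarrow> nat" where
  "vtx N j z = lim N (zeta z) (fst j) (Vx (snd j))"

text \<open>A vertex that is one of the copies is named by the leaf it equals, so that certificates
  at different nodes share vertices and their connections can be composed.\<close>

definition key :: "nat \<Rightarrow> nat list \<Rightarrow> nat \<Rightarrow> nat list \<times> nat" where
  "key n p a = (if a < ms n then (p @ a # ss n, 0) else (p, a))"

definition idxs :: "nat \<Rightarrow> nat set" where
  "idxs n = {..<ms n} \<union> fst ` set (Es n) \<union> snd ` set (Es n) \<union> fst ` set (Ms n)"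

definition upper :: "nat \<Rightarrow> nat \<Rightarrow> nat list set" where
  "upper n N = {path w n N |w. adm w}"

definition keys :: "nat \<Rightarrow> (nat list \<times> nat) set" where
  "keys N = (\<lambda>t. (t, 0)) ` Ts N \<union> (\<Union>n<N. \<Union>p\<in>upper (Suc n) N. key n p ` idxs n)"

definition poss :: "pcol \<Rightarrow> baire \<Rightarrow> nat set" where
  "poss c v = {d v |d. col c d}"

lemma finite_keys: "finite (keys N)"
proof -
  have "upper n N \<subseteq> (\<lambda>(t, r). take r t) ` (Ts N \<times> {..N})" if "n \<le> N" for n
  proof
    fix p assume "p \<in> upper n N"
    then obtain w where "adm w" "p = path w n N" by (auto simp: upper_def)
    then show "p \<in> (\<lambda>(t, r). take r t) ` (Ts N \<times> {..N})"
      using path_in_Ts[of w N] take_path[OF that, of w]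
      by (intro image_eqI[of _ _ "(path w 0 N, N - n)"]) auto
  qed
  then have "finite (upper n N)" if "n \<le> N" for n
    using that finite_Ts[of N] by (meson finite_SigmaI finite_atMost finite_imageI finite_subset)
  moreover have "finite (idxs n)" for n by (simp add: idxs_def)
  ultimately show ?thesis
    unfolding keys_def by (intro finite_UnI finite_imageI finite_Ts finite_UN_I) auto
qed

lemma poss_less: "poss c v \<subseteq> {..<k}"
  by (auto simp: poss_def col_def)

lemma poss_antimono: "c \<le> c' \<Longrightarrow> poss c' v \<subseteq> poss c v"
  unfolding poss_def using col_antimono by blast

lemma continuous_vtx: "continuous_on UNIV (vtx N j)"
  unfolding vtx_def by (rule continuous_lim)

lemma upper_in:
  assumes "p \<in> upper n N" "n \<le> N" "u \<in> Cs N"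
  shows "subtree p u \<in> Cs n"
  using assms subtree_path_in by (auto simp: upper_def)

lemma upper_append:
  assumes "p \<in> upper n N" "n \<le> N" "t \<in> Ts n"
  shows "p @ t \<in> Ts N"
proof -
  obtain w where w: "adm w" "p = path w n N" using assms(1) by (auto simp: upper_def)
  obtain v where v: "adm v" "t = path v 0 n" using Ts_path[OF assms(3)] by blast
  let ?w = "\<lambda>j. if j < n then v j else w j"
  have "adm ?w" using w(1) v(1) by (simp add: adm_def)
  moreover have "path ?w n N = p" unfolding w(2) by (rule path_cong) simp
  moreover have "path ?w 0 n = t" unfolding v(2) by (rule path_cong) simp
  ultimately show ?thesis using path_in_Ts[of ?w N] path_append[of 0 n N ?w] assms(2) by simp
qed

lemma upper_snoc:
  assumes "p \<in> upper (Suc n) N" "Suc n \<le> N" "l < ms n"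
  shows "p @ [l] \<in> upper n N"
proof -
  obtain w where w: "adm w" "p = path w (Suc n) N" using assms(1) by (auto simp: upper_def)
  let ?w = "w(n := l)"
  have "adm ?w" using w(1) assms(3) by (simp add: adm_def)
  moreover have "path ?w (Suc n) N = p" unfolding w(2) by (rule path_cong) simp
  moreover have "path ?w n (Suc n) = [l]" by (simp add: path_def)
  ultimately show ?thesis
    using path_append[of n "Suc n" N ?w] assms(2) unfolding upper_def by fastforce
qed

lemma vtx_key:
  assumes p: "p \<in> upper (Suc n) N" "Suc n \<le> N"
  shows "vtx N (key n p a) z = subtree p (lim N (zeta z)) [] (Vx a)"
proof (cases "a < ms n")
  case True
  have "subtree p (lim N (zeta z)) \<in> Cs (Suc n)" by (rule upper_in[OF p lim_in[OF adm_zeta]])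
  from Cs_copy[OF this True] True show ?thesis
    by (simp add: vtx_def key_def leaf_def subtree_def)
qed (simp add: vtx_def key_def subtree_def)

lemma key_in_keys: "n < N \<Longrightarrow> p \<in> upper (Suc n) N \<Longrightarrow> a \<in> idxs n \<Longrightarrow> key n p a \<in> keys N"
  unfolding keys_def by blast

text \<open>On \<open>B\<close> all vertices have constant sets of possible colours.
  \<open>B\<close> is only required to be non-meager in every smaller neighbourhood, since a set
  given by possible colours is not known to be comeager anywhere.\<close>

definition tame :: "nat \<Rightarrow> pcol \<Rightarrow> nat \<Rightarrow> cantor \<Rightarrow> cantor set \<Rightarrow>
    (nat list \<times> nat \<Rightarrow> nat set) \<Rightarrow> bool" where
  "tame N c n x B \<Lambda> \<longleftrightarrow> cw \<le> c \<and> good c \<and> B \<subseteq> nbhd n x \<and>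
     (\<forall>m y. nbhd m y \<subseteq> nbhd n x \<longrightarrow> \<not> meager (B \<inter> nbhd m y)) \<and>
     (\<forall>z\<in>B. \<forall>j\<in>keys N. poss c (vtx N j z) = \<Lambda> j)"

text \<open>Finitely many vertices and colours allow only finitely many types, so one of them is
  non-meager and can be localized.\<close>

lemma tame_exists:
  assumes c: "cw \<le> c" "good c" and B0: "B0 \<subseteq> nbhd n x" "\<not> meager B0"
  shows "\<exists>n' x' B \<Lambda>. B \<subseteq> B0 \<and> nbhd n' x' \<subseteq> nbhd n x \<and> tame N c n' x' B \<Lambda>"
proof -
  define type where "type z = restrict (\<lambda>j. poss c (vtx N j z)) (keys N)" for z
  have fin: "finite (PiE (keys N) (\<lambda>_. Pow {..<k}))" by (intro finite_PiE finite_keys) auto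
  have "type z \<in> PiE (keys N) (\<lambda>_. Pow {..<k})" for z using poss_less by (auto simp: type_def)
  then have "B0 = (\<Union>\<Lambda>\<in>PiE (keys N) (\<lambda>_. Pow {..<k}). {z\<in>B0. type z = \<Lambda>})" by blast
  moreover have "countable (PiE (keys N) (\<lambda>_. Pow {..<k}))" using fin by (rule countable_finite)
  ultimately obtain \<Lambda> where \<Lambda>: "\<not> meager {z\<in>B0. type z = \<Lambda>}"
    using B0(2) meager_UN[of "PiE (keys N) (\<lambda>_. Pow {..<k})" "\<lambda>\<Lambda>. {z\<in>B0. type z = \<Lambda>}"] by auto
  define A where "A = {z\<in>B0. type z = \<Lambda>}"
  obtain n1 x1 where loc: "\<And>m y. nbhd m y \<subseteq> nbhd n1 x1 \<Longrightarrow> \<not> meager (A \<inter> nbhd m y)"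
    using not_meager_localize[OF \<Lambda>] unfolding A_def by blast
  have "A \<inter> nbhd n1 x1 \<noteq> {}" using loc[OF order_refl] by (metis meager_empty)
  then obtain y where y: "y \<in> nbhd n x" "y \<in> nbhd n1 x1" using B0(1) by (auto simp: A_def)
  let ?V = "nbhd (max n n1) y"
  have V: "?V \<subseteq> nbhd n x" "?V \<subseteq> nbhd n1 x1" using nbhd_max_subset[OF y] by auto
  have "tame N c (max n n1) y (A \<inter> ?V) \<Lambda>"
    unfolding tame_def
  proof (intro conjI allI impI ballI)
    fix m w assume "nbhd m w \<subseteq> ?V"
    then have "A \<inter> ?V \<inter> nbhd m w = A \<inter> nbhd m w" "nbhd m w \<subseteq> nbhd n1 x1" using V(2) by auto
    then show "\<not> meager (A \<inter> ?V \<inter> nbhd m w)" using loc by simp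
  next
    fix z j assume "z \<in> A \<inter> ?V" "j \<in> keys N"
    then have "type z = \<Lambda>" "j \<in> keys N" by (auto simp: A_def)
    then show "poss c (vtx N j z) = \<Lambda> j" unfolding type_def by auto
  qed (use c in auto)
  moreover have "A \<inter> ?V \<subseteq> B0" by (auto simp: A_def)
  ultimately show ?thesis using V(1) by blast
qed

text \<open>A type of minimal size: fixing the colour of one more point \<open>v\<close> cannot remove a colour from a
  vertex at non-meagerly many places.\<close>

lemma minimal_tame:
  "\<exists>c n x B \<Lambda>. tame N c n x B \<Lambda> \<and>
    (\<forall>j\<in>keys N. \<forall>v. poss c v \<inter> \<Lambda> j \<noteq> {} \<longrightarrow> meager {z\<in>nbhd n x. par (vtx N j z) v})"
proof -
  have "\<not> meager (nbhd 0 (\<lambda>_. False))" by (rule not_meager_nbhd)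
  from tame_exists[OF order_refl good_cw order_refl this]
  have "\<exists>s c n x B \<Lambda>. tame N c n x B \<Lambda> \<and> s = (\<Sum>j\<in>keys N. card (\<Lambda> j))" by blast
  then have ex: "\<exists>s. \<exists>c n x B \<Lambda>. tame N c n x B \<Lambda> \<and> s = (\<Sum>j\<in>keys N. card (\<Lambda> j))" .
  define s where "s = (LEAST s. \<exists>c n x B \<Lambda>. tame N c n x B \<Lambda> \<and> s = (\<Sum>j\<in>keys N. card (\<Lambda> j)))"
  have "\<exists>c n x B \<Lambda>. tame N c n x B \<Lambda> \<and> s = (\<Sum>j\<in>keys N. card (\<Lambda> j))"
    unfolding s_def by (rule LeastI_ex[OF ex])
  then obtain c n x B \<Lambda> where t: "tame N c n x B \<Lambda>" and s: "s = (\<Sum>j\<in>keys N. card (\<Lambda> j))" by blast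
  have least: "s \<le> (\<Sum>j\<in>keys N. card (\<Lambda>' j))" if "tame N c' n' x' B' \<Lambda>'" for c' n' x' B' \<Lambda>'
    unfolding s_def by (rule Least_le) (use that in blast)
  have "meager {z\<in>nbhd n x. par (vtx N j z) v}" if j: "j \<in> keys N" and v: "poss c v \<inter> \<Lambda> j \<noteq> {}" for j v
  proof (rule ccontr)
    assume nm: "\<not> meager {z\<in>nbhd n x. par (vtx N j z) v}"
    obtain i where i: "i \<in> poss c v" "i \<in> \<Lambda> j" using v by blast
    then have ik: "i < k" using poss_less by blast
    have "decided {z. vtx N j z \<preceq> v}" "decided {z. v \<preceq> vtx N j z}"
      by (rule decided_le; intro continuous_vtx continuous_on_const)+
    then have "decided (- {z. vtx N j z \<preceq> v} \<inter> - {z. v \<preceq> vtx N j z})"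
      by (intro decided_Int decided_Compl)
    moreover have "- {z. vtx N j z \<preceq> v} \<inter> - {z. v \<preceq> vtx N j z} = {z. par (vtx N j z) v}"
      by (auto simp: par_def)
    ultimately have dec: "decided {z. par (vtx N j z) v}" by simp
    have "{z. par (vtx N j z) v} \<inter> nbhd n x = {z\<in>nbhd n x. par (vtx N j z) v}" by auto
    then obtain m y where my: "nbhd m y \<subseteq> nbhd n x" "meager (nbhd m y - {z. par (vtx N j z) v})"
      using decided_not_meager[OF dec, of n x] nm by auto
    \<comment> \<open>Once \<open>v\<close> has the colour \<open>i\<close>, no vertex incomparable
      to \<open>v\<close> can have it; a type found among those \<open>z\<close> loses
      \<open>i\<close> at \<open>j\<close> and gains nothing elsewhere.\<close>
    define c1 where "c1 = add c i {v}"
    have cgood: "cw \<le> c" "good c" using t by (auto simp: tame_def)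
    have c1: "c \<le> c1" "cw \<le> c1" using cgood(1) le_add order_trans unfolding c1_def by blast+
    have "\<exists>d. col c1 d" using i(1) col_add[OF ik] by (auto simp: c1_def poss_def)
    moreover have "{v} \<in> sets borel"
      using closedin_Hausdorff_sing_eq[OF Hausdorff_baire, of v] by (intro borel_closed) simp
    ultimately have c1good: "good c1" using cgood(2) by (auto simp: good_def c1_def add_def simp del: Un_insert_right intro!: sets.Un)
    define B0 where "B0 = B \<inter> nbhd m y \<inter> {z. par (vtx N j z) v}"
    have "\<not> meager B0"
    proof
      assume "meager B0"
      then have "meager (B0 \<union> (nbhd m y - {z. par (vtx N j z) v}))" using my(2) by (rule meager_Un)
      then have "meager (B \<inter> nbhd m y)" by (rule meager_subset) (auto simp: B0_def)
      then show False using t my(1) by (auto simp: tame_def)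
    qed
    moreover have "B0 \<subseteq> nbhd m y" by (auto simp: B0_def)
    ultimately obtain n' x' B' \<Lambda>' where t': "B' \<subseteq> B0" "tame N c1 n' x' B' \<Lambda>'"
      using tame_exists[OF c1(2) c1good, of B0 m y N] by blast
    have "\<not> meager (B' \<inter> nbhd n' x')" using t'(2) by (simp add: tame_def)
    then have "B' \<noteq> {}" by (metis Int_empty_left meager_empty)
    then obtain z where z: "z \<in> B'" by blast
    then have zB: "z \<in> B" "par (vtx N j z) v" using t'(1) by (auto simp: B0_def)
    have \<Lambda>': "\<Lambda>' l = poss c1 (vtx N l z)" if "l \<in> keys N" for l using t'(2) z that by (auto simp: tame_def)
    have \<Lambda>: "\<Lambda> l = poss c (vtx N l z)" if "l \<in> keys N" for l using t zB(1) that by (auto simp: tame_def)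
    have sub: "\<Lambda>' l \<subseteq> \<Lambda> l" if "l \<in> keys N" for l using \<Lambda>[OF that] \<Lambda>'[OF that] poss_antimono[OF c1(1)] by simp
    have "i \<notin> \<Lambda>' j"
    proof
      assume "i \<in> \<Lambda>' j"
      then obtain d where d: "col c1 d" "d (vtx N j z) = i" using \<Lambda>'[OF j] by (auto simp: poss_def)
      have "d v = i" using d(1) col_add[OF ik] by (auto simp: c1_def)
      then show False using d zB(2) by (auto simp: col_def)
    qed
    have fin\<Lambda>: "finite (\<Lambda> l)" if "l \<in> keys N" for l
      unfolding \<Lambda>[OF that] by (rule finite_subset[OF poss_less]) simp
    have "(\<Sum>l\<in>keys N. card (\<Lambda>' l)) < (\<Sum>l\<in>keys N. card (\<Lambda> l))"
    proof (rule sum_strict_mono_ex1[OF finite_keys])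
      show "\<forall>l\<in>keys N. card (\<Lambda>' l) \<le> card (\<Lambda> l)" using sub fin\<Lambda> card_mono by blast
      have "\<Lambda>' j \<subset> \<Lambda> j" using sub[OF j] i(2) \<open>i \<notin> \<Lambda>' j\<close> by blast
      then show "\<exists>l\<in>keys N. card (\<Lambda>' l) < card (\<Lambda> l)" using j fin\<Lambda> psubset_card_mono by blast
    qed
    then show False using least[OF t'(2)] s by simp
  qed
  then show ?thesis using t by blast
qed

text \<open>Edges that are incomparable at one and the same \<open>z\<close> but share a possible
  colour. By minimality of the type the two vertices become comparable at different generic
  points.\<close>

definition adj :: "nat \<Rightarrow> (nat list \<times> nat \<Rightarrow> nat set) \<Rightarrow> ((nat list \<times> nat) \<times> (nat list \<times> nat)) set" where
  "adj N \<Lambda> = {(j, l). j \<in> keys N \<and> l \<in> keys N \<and> (\<forall>z. par (vtx N j z) (vtx N l z)) \<and> \<Lambda> j \<inter> \<Lambda> l \<noteq> {}}"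

text \<open>Otherwise split the copies into two nonempty classes. Fewer than \<open>ms n\<close> copies can receive the colour
  \<open>cl n\<close>, so each class can; as no possible colour is shared across an edge between the classes, the
  two colourings combine, contrary to the certificate.\<close>

lemma copies_connected:
  assumes t: "tame N c n0 x B \<Lambda>" and n: "n < N" and p: "p \<in> upper (Suc n) N"
    and l: "l < ms n" "l' < ms n"
  shows "(key n p l, key n p l') \<in> (adj N \<Lambda>)\<^sup>*"
proof (rule ccontr)
  assume not: "\<not> ?thesis"
  have c: "cw \<le> c" "good c" using t by (auto simp: tame_def)
  have csc: "cs (Suc n) \<le> c" using cs_le_cw c(1) by (rule order_trans)
  \<comment> \<open>In \<open>c1\<close> every family of fewer than \<open>ms n\<close> uncoloured
    copies can receive the colour \<open>cl n\<close>; its possible colours are among those of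
    \<open>c\<close>.\<close>
  obtain c1 where c1: "c \<le> c1" "good c1"
    and free: "\<And>U. U \<subseteq> Cs n \<Longrightarrow> finite U \<Longrightarrow> card U < ms n \<Longrightarrow> (\<forall>u\<in>U. avoid (Ts n) u c1) \<Longrightarrow>
      \<not> inc c1 (cl n) (leaf (ss n) ` U)"
    using small_free[OF csc c(2)] by auto
  have cw1: "cw \<le> c1" using c(1) c1(1) by (rule order_trans)
  have csc1: "cs (Suc n) \<le> c1" using cs_le_cw cw1 by (rule order_trans)
  have "meager (\<Union>s\<in>Ts N. {z. leaf s (lim N (zeta z)) \<in> cdom c1})"
    by (intro meager_UN countable_finite finite_Ts leaf_avoid[OF cw1 c1(2)])
  moreover have "\<not> meager B"
  proof
    assume "meager B"
    then have "meager (B \<inter> nbhd n0 x)" by (rule meager_subset) auto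
    then show False using t by (auto simp: tame_def)
  qed
  ultimately have "\<not> B \<subseteq> (\<Union>s\<in>Ts N. {z. leaf s (lim N (zeta z)) \<in> cdom c1})" using meager_subset by blast
  then obtain z where z: "z \<in> B" "\<And>s. s \<in> Ts N \<Longrightarrow> leaf s (lim N (zeta z)) \<notin> cdom c1" by blast
  have nN: "Suc n \<le> N" using n by simp
  define u where "u = subtree p (lim N (zeta z))"
  have u: "u \<in> Cs (Suc n)" unfolding u_def by (rule upper_in[OF p nN lim_in[OF adm_zeta]])
  define v where "v a = u [] (Vx a)" for a
  have v: "vtx N (key n p a) z = v a" for a unfolding vtx_key[OF p nN] v_def u_def ..
  define I where "I = {i. i < ms n \<and> (key n p l, key n p i) \<in> (adj N \<Lambda>)\<^sup>*}"
  have ex: "\<exists>d. col c1 d \<and> (\<forall>i\<in>I'. d (v i) = cl n)" if I': "I' \<subset> {..<ms n}" for I'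
  proof -
    let ?U = "(\<lambda>i. subtree [i] u) ` I'"
    have finI: "finite I'" using I' finite_subset by blast
    have "card ?U \<le> card I'" by (rule card_image_le[OF finI])
    also have "card I' < ms n" using psubset_card_mono[OF _ I'] by simp
    finally have 1: "card ?U < ms n" .
    have 2: "?U \<subseteq> Cs n" using Cs_subtree[OF u] I' by auto
    have 3: "\<forall>w\<in>?U. avoid (Ts n) w c1"
    proof
      fix w assume "w \<in> ?U"
      then obtain i where i: "i < ms n" "w = subtree [i] u" using I' by auto
      have "leaf s w \<notin> cdom c1" if "s \<in> Ts n" for s
      proof -
        have "i # s \<in> Ts (Suc n)" using i(1) that by (auto simp: Ts_Suc)
        then have "p @ i # s \<in> Ts N" using upper_append[OF p nN] by simp
        then show ?thesis using z(2)[of "p @ i # s"] by (simp add: i(2) u_def leaf_def subtree_def)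
      qed
      then show "avoid (Ts n) w c1" by (simp add: avoid_def)
    qed
    have "\<not> inc c1 (cl n) (leaf (ss n) ` ?U)" using free[OF 2 _ 1 3] finI by simp
    then obtain d where d: "col c1 d" "\<forall>x\<in>leaf (ss n) ` ?U. d x = cl n" by (auto simp: inc_def)
    have "d (v i) = cl n" if i: "i \<in> I'" for i
    proof -
      have "v i = leaf (ss n) (subtree [i] u)"
        using Cs_copy[OF u, of i] i I' by (auto simp: v_def leaf_def subtree_def)
      then show ?thesis using d(2) i by simp
    qed
    then show ?thesis using d(1) by blast
  qed
  have I: "I \<subset> {..<ms n}" "{..<ms n} - I \<subset> {..<ms n}" using l not by (auto simp: I_def)
  obtain d1 where d1: "col c1 d1" "\<forall>i\<in>I. d1 (v i) = cl n" using ex[OF I(1)] by blast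
  obtain d2 where d2: "col c1 d2" "\<forall>i\<in>{..<ms n} - I. d2 (v i) = cl n" using ex[OF I(2)] by blast
  \<comment> \<open>Inside a class both ends of an edge use one colouring of the points; between the
    classes the sets of possible colours are disjoint.\<close>
  define h where "h a = (if (key n p l, key n p a) \<in> (adj N \<Lambda>)\<^sup>* then d1 (v a) else d2 (v a))" for a
  have d\<Lambda>: "d (v a) \<in> \<Lambda> (key n p a)" if "col c1 d" "a \<in> idxs n" for d a
  proof -
    have "d (v a) \<in> poss c (v a)" using col_antimono[OF c1(1) that(1)] by (auto simp: poss_def)
    moreover have "key n p a \<in> keys N" by (rule key_in_keys[OF n p that(2)])
    moreover have "poss c (vtx N j z) = \<Lambda> j" if "j \<in> keys N" for j using t z(1) that by (simp add: tame_def)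
    ultimately show ?thesis using v[of a] by metis
  qed
  have hE: "h a \<noteq> h b" if ab: "(a, b) \<in> set (Es n)" for a b
  proof -
    have idx: "a \<in> idxs n" "b \<in> idxs n" using ab by (force simp: idxs_def)+
    have par: "par (vtx N (key n p a) z') (vtx N (key n p b) z')" for z'
      unfolding vtx_key[OF p nN] by (rule Cs_par[OF upper_in[OF p nN lim_in[OF adm_zeta]] ab])
    have parv: "par (v a) (v b)" using par[of z] by (simp add: v)
    show ?thesis
    proof (cases "\<Lambda> (key n p a) \<inter> \<Lambda> (key n p b) = {}")
      case True
      have "h a \<in> \<Lambda> (key n p a)" "h b \<in> \<Lambda> (key n p b)"
        using d\<Lambda>[OF d1(1)] d\<Lambda>[OF d2(1)] idx by (auto simp: h_def)
      then show ?thesis using True by auto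
    next
      case False
      have "(key n p a, key n p b) \<in> adj N \<Lambda>" "(key n p b, key n p a) \<in> adj N \<Lambda>"
        using False par par_sym key_in_keys[OF n p] idx by (auto simp: adj_def)
      then have "(key n p l, key n p a) \<in> (adj N \<Lambda>)\<^sup>* \<longleftrightarrow> (key n p l, key n p b) \<in> (adj N \<Lambda>)\<^sup>*"
        by (meson rtrancl.rtrancl_into_rtrancl)
      then show ?thesis using parv d1(1) d2(1) by (auto simp: h_def col_def)
    qed
  qed
  have hk: "h a < k" for a using d1(1) d2(1) by (simp add: h_def col_def)
  have hM: "h a = j" if "(a, j) \<in> set (Ms n)" for a j
    using Cs_mem_col[OF u csc1 d1(1) that] Cs_mem_col[OF u csc1 d2(1) that] by (simp add: h_def v_def)
  have "h i = cl n" if "i < ms n" for i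
    using d1(2) d2(2) that by (auto simp: h_def I_def)
  then show False using copies_not_constant[where h = h, OF u] hk hE hM by blast
qed

text \<open>From a leaf of copy \<open>l\<close> go to the leaf \<open>ss n\<close> of the same
  copy, cross over to copy \<open>l'\<close>, and go on to the target inside it.\<close>

lemma leaves_connected_aux:
  assumes t: "tame N c n0 x B \<Lambda>"
  shows "n \<le> N \<Longrightarrow> p \<in> upper n N \<Longrightarrow> s \<in> Ts n \<Longrightarrow> s' \<in> Ts n \<Longrightarrow> ((p @ s, 0), (p @ s', 0)) \<in> (adj N \<Lambda>)\<^sup>*"
proof (induction n arbitrary: p s s')
  case 0
  then show ?case by (simp add: Ts_0)
next
  case (Suc n)
  obtain l r where s: "s = l # r" "l < ms n" "r \<in> Ts n" using Suc.prems(3) by (auto simp: Ts_Suc)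
  obtain l' r' where s': "s' = l' # r'" "l' < ms n" "r' \<in> Ts n" using Suc.prems(4) by (auto simp: Ts_Suc)
  have "(((p @ [l]) @ r, 0), ((p @ [l]) @ ss n, 0)) \<in> (adj N \<Lambda>)\<^sup>*"
    by (rule Suc.IH) (use Suc.prems s upper_snoc ss_in in auto)
  moreover have "(key n p l, key n p l') \<in> (adj N \<Lambda>)\<^sup>*"
    by (rule copies_connected[OF t]) (use Suc.prems s s' in auto)
  moreover have "(((p @ [l']) @ ss n, 0), ((p @ [l']) @ r', 0)) \<in> (adj N \<Lambda>)\<^sup>*"
    by (rule Suc.IH) (use Suc.prems s' upper_snoc ss_in in auto)
  ultimately show ?case using s s' by (simp add: key_def)
qed

lemma leaves_connected:
  assumes "tame N c n0 x B \<Lambda>" "s \<in> Ts N" "s' \<in> Ts N"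
  shows "((s, 0), (s', 0)) \<in> (adj N \<Lambda>)\<^sup>*"
proof -
  have "[] \<in> upper N N" using adm_zeta by (auto simp: upper_def)
  then show ?thesis using leaves_connected_aux[OF assms(1), of N "[]" s s'] assms(2,3) by simp
qed

text \<open>The order between two values of \<open>phi\<close> is decided in a neighbourhood of an
  interleaved point. Keeping that prefix and freeing the tails turns this into a statement about two
  fixed leaves of every late stage.\<close>

lemma rectangle_decided:
  "\<exists>n x b. \<forall>N\<ge>n. meager {y. (vtx N (path (zeta (\<lambda>j. x (2 * j))) 0 N, 0) (\<lambda>j. y (2 * j)) \<preceq>
      vtx N (path (zeta (\<lambda>j. x (Suc (2 * j)))) 0 N, 0) (\<lambda>j. y (Suc (2 * j)))) \<noteq> b}"
proof -
  define Q where "Q = {y. phi (\<lambda>j. y (2 * j)) \<preceq> phi (\<lambda>j. y (Suc (2 * j)))}"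
  have "decided Q"
    unfolding Q_def
    by (rule decided_le; rule continuous_on_compose2[OF continuous_phi];
        (rule continuous_on_coordinatewise_then_product, rule continuous_on_product_coordinates | simp))
  then obtain n x where nx: "meager (nbhd n x \<inter> Q) \<or> meager (nbhd n x - Q)" by (rule decidedE)
  obtain b where b: "meager {y\<in>nbhd n x. (y \<in> Q) \<noteq> b}"
  proof (cases "meager (nbhd n x \<inter> Q)")
    case True
    moreover have "nbhd n x \<inter> Q = {y\<in>nbhd n x. (y \<in> Q) \<noteq> False}" by auto
    ultimately show ?thesis using that[of False] by simp
  next
    case False
    moreover have "nbhd n x - Q = {y\<in>nbhd n x. (y \<in> Q) \<noteq> True}" by auto
    ultimately show ?thesis using that[of True] nx by simp
  qed
  have "meager {y. (vtx N (path (zeta (\<lambda>j. x (2 * j))) 0 N, 0) (\<lambda>j. y (2 * j)) \<preceq>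
      vtx N (path (zeta (\<lambda>j. x (Suc (2 * j)))) 0 N, 0) (\<lambda>j. y (Suc (2 * j)))) \<noteq> b}" if N: "N \<ge> n" for N
  proof (rule meager_subset[OF meager_vimage_mix[OF b, of "2 * ell N" x]], intro subsetI)
    fix y assume "y \<in> {y. (vtx N (path (zeta (\<lambda>j. x (2 * j))) 0 N, 0) (\<lambda>j. y (2 * j)) \<preceq>
      vtx N (path (zeta (\<lambda>j. x (Suc (2 * j)))) 0 N, 0) (\<lambda>j. y (Suc (2 * j)))) \<noteq> b}"
    then have y: "(vtx N (path (zeta (\<lambda>j. x (2 * j))) 0 N, 0) (\<lambda>j. y (2 * j)) \<preceq>
      vtx N (path (zeta (\<lambda>j. x (Suc (2 * j)))) 0 N, 0) (\<lambda>j. y (Suc (2 * j)))) \<noteq> b" by (rule CollectD)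
    let ?y = "mix (2 * ell N) x y"
    have ev: "(\<lambda>j. ?y (2 * j)) = mix (ell N) (\<lambda>j. x (2 * j)) (\<lambda>j. y (2 * j))" by (auto simp: mix_def fun_eq_iff)
    have od: "(\<lambda>j. ?y (Suc (2 * j))) = mix (ell N) (\<lambda>j. x (Suc (2 * j))) (\<lambda>j. y (Suc (2 * j)))"
      by (auto simp: mix_def fun_eq_iff)
    have "(?y \<in> Q) \<noteq> b" using y by (simp add: Q_def ev od phi_mix vtx_def leaf_def)
    moreover have "n \<le> 2 * ell N" using le_ell[of N] N by linarith
    then have "?y \<in> nbhd n x" by (intro mix_in_nbhd) auto
    ultimately show "y \<in> {y. mix (2 * ell N) x y \<in> {y\<in>nbhd n x. (y \<in> Q) \<noteq> b}}" by blast
  qed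
  then show ?thesis by blast
qed

lemma contradiction: False
proof -
  obtain n x b where rect: "\<And>N. n \<le> N \<Longrightarrow> meager {y. (vtx N (path (zeta (\<lambda>j. x (2 * j))) 0 N, 0) (\<lambda>j. y (2 * j)) \<preceq>
      vtx N (path (zeta (\<lambda>j. x (Suc (2 * j)))) 0 N, 0) (\<lambda>j. y (Suc (2 * j)))) \<noteq> b}"
    using rectangle_decided by blast
  obtain n1 where n1: "ms n1 \<ge> 2" using ex_branching by blast
  \<comment> \<open>Late enough for the rectangle and past a branching stage, so that
    \<open>t1\<close> is not the only leaf and has a neighbour. The leaves \<open>t1\<close> and
    \<open>t2\<close> themselves may coincide.\<close>
  define N where "N = max n (Suc n1)"
  define t1 where "t1 = path (zeta (\<lambda>j. x (2 * j))) 0 N"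
  define t2 where "t2 = path (zeta (\<lambda>j. x (Suc (2 * j)))) 0 N"
  define R where "R = {y. (vtx N (t1, 0) (\<lambda>j. y (2 * j)) \<preceq> vtx N (t2, 0) (\<lambda>j. y (Suc (2 * j)))) \<noteq> b}"
  have R: "meager R"
    using rect[of N] by (simp add: R_def N_def[symmetric] t1_def[symmetric] t2_def[symmetric]) (simp add: N_def)
  have t12: "t1 \<in> Ts N" "t2 \<in> Ts N" unfolding t1_def t2_def by (rule path_in_Ts[OF adm_zeta])+
  obtain c n0 x0 B \<Lambda> where t: "tame N c n0 x0 B \<Lambda>"
    and hub: "\<And>j v. j \<in> keys N \<Longrightarrow> poss c v \<inter> \<Lambda> j \<noteq> {} \<Longrightarrow> meager {z\<in>nbhd n0 x0. par (vtx N j z) v}"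
    using minimal_tame[of N] by blast
  let ?A = "adj N \<Lambda>"
  have "\<exists>t'\<in>Ts N. t' \<noteq> t1"
  proof (rule ccontr)
    assume H: "\<not> ?thesis"
    define w where "w i = (\<lambda>j. if j = n1 then i else 0)" for i :: nat
    have w: "adm (w i)" if "i < 2" for i using ms_pos n1 that by (auto simp: adm_def w_def Suc_le_eq)
    have "path (w 0) 0 N = path (w 1) 0 N" using H path_in_Ts[OF w] by (metis one_less_numeral_iff pos2 semiring_norm(76))
    then have "\<forall>j\<in>set (rev [0..<N]). w 0 j = w 1 j" unfolding path_def by (simp add: map_eq_conv)
    then have "w 0 n1 = w 1 n1" by (rule bspec) (simp add: N_def)
    then show False by (simp add: w_def)
  qed
  then obtain t' where t': "t' \<in> Ts N" "t' \<noteq> t1" by blast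
  have "((t1, 0), (t', 0)) \<in> ?A\<^sup>*" by (rule leaves_connected[OF t t12(1) t'(1)])
  then obtain j0 where j0: "((t1, 0), j0) \<in> ?A" using t'(2) by (auto elim: converse_rtranclE)
  obtain q where q: "((t1, 0), (t2, 0)) \<in> ?A ^^ q"
    using leaves_connected[OF t t12] rtrancl_imp_relpow by blast
  have B: "B \<subseteq> nbhd n0 x0" "\<not> meager B" and cgood: "good c"
    and ty: "\<And>z j. z \<in> B \<Longrightarrow> j \<in> keys N \<Longrightarrow> poss c (vtx N j z) = \<Lambda> j"
    using t unfolding tame_def by (auto dest: meager_subset[of B "B \<inter> nbhd n0 x0"])
  \<comment> \<open>Both orders of interleaving are needed: the sequence is built with the new point
    generic over the old ones, but the relation is used in both directions.\<close>
  define S where "S = (\<Union>b. {w. \<not> meager {z. join b z w \<in> R}})"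
  have "meager S" unfolding S_def by (intro meager_UN kuratowski_ulam R) auto
  then have nmBS: "\<not> meager (B - S)"
    using B(2) meager_Un[of "B - S" S] meager_subset[of "(B - S) \<union> S" B] by blast
  define gp where "gp z w \<longleftrightarrow> (\<forall>(j, l)\<in>?A. \<not> par (vtx N j z) (vtx N l w) \<and> \<not> par (vtx N j z) (vtx N j w)) \<and>
    join True z w \<notin> R \<and> join False z w \<notin> R" for z w
  have finA: "finite ?A" by (rule finite_subset[of _ "keys N \<times> keys N"]) (auto simp: adj_def finite_keys)
  have new: "\<exists>z\<in>B - S. \<forall>w\<in>W. gp z w" if W: "finite W" "W \<subseteq> B - S" for W
  proof -
    have m1: "meager {z\<in>nbhd n0 x0. \<not> gp z w}" if w: "w \<in> B - S" for w
    proof -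
      \<comment> \<open>For \<open>w\<close> in \<open>B\<close> the vertex at \<open>w\<close> has
        its constant set of possible colours, and along an edge this set meets that of
        \<open>fst e\<close>.\<close>
      have "meager {z\<in>nbhd n0 x0. par (vtx N (fst e) z) (vtx N (snd e) w)}"
        "meager {z\<in>nbhd n0 x0. par (vtx N (fst e) z) (vtx N (fst e) w)}" if e: "e \<in> ?A" for e
      proof -
        have k: "fst e \<in> keys N" "snd e \<in> keys N" "\<Lambda> (fst e) \<inter> \<Lambda> (snd e) \<noteq> {}" using e by (auto simp: adj_def)
        show "meager {z\<in>nbhd n0 x0. par (vtx N (fst e) z) (vtx N (snd e) w)}"
          by (rule hub[OF k(1)]) (use ty[of w "snd e"] w k in auto)
        show "meager {z\<in>nbhd n0 x0. par (vtx N (fst e) z) (vtx N (fst e) w)}"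
          by (rule hub[OF k(1)]) (use ty[of w "fst e"] w k in auto)
      qed
      then have "meager (\<Union>e\<in>?A. {z\<in>nbhd n0 x0. par (vtx N (fst e) z) (vtx N (snd e) w)} \<union>
          {z\<in>nbhd n0 x0. par (vtx N (fst e) z) (vtx N (fst e) w)})"
        by (intro meager_UN countable_finite finA meager_Un)
      moreover have "meager {z. join True z w \<in> R}" "meager {z. join False z w \<in> R}"
        using w by (auto simp: S_def)
      ultimately have "meager ((\<Union>e\<in>?A. {z\<in>nbhd n0 x0. par (vtx N (fst e) z) (vtx N (snd e) w)} \<union>
          {z\<in>nbhd n0 x0. par (vtx N (fst e) z) (vtx N (fst e) w)}) \<union> ({z. join True z w \<in> R} \<union> {z. join False z w \<in> R}))"
        by (intro meager_Un)
      then show ?thesis by (rule meager_subset) (fastforce simp: gp_def)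
    qed
    have "meager (\<Union>w\<in>W. {z\<in>nbhd n0 x0. \<not> gp z w})"
      using W m1 by (intro meager_UN countable_finite) auto
    then have "\<not> B - S \<subseteq> (\<Union>w\<in>W. {z\<in>nbhd n0 x0. \<not> gp z w})" using nmBS meager_subset by blast
    then obtain z where "z \<in> B - S" "z \<notin> (\<Union>w\<in>W. {z\<in>nbhd n0 x0. \<not> gp z w})" by blast
    then show ?thesis using B(1) by blast
  qed
  have "\<exists>zs. \<forall>i::nat. zs i \<in> B - S \<and> (\<forall>i'<i. gp (zs i) (zs i'))"
  proof (rule dependent_wf_choice[OF wf_less_than, where P = "\<lambda>f i z. z \<in> B - S \<and> (\<forall>i'<i. gp z (f i'))"])
    fix f g :: "nat \<Rightarrow> nat \<Rightarrow> bool" and i r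
    assume "\<And>z. (z, i) \<in> less_than \<Longrightarrow> f z = g z"
    then show "(r \<in> B - S \<and> (\<forall>i'<i. gp r (f i'))) = (r \<in> B - S \<and> (\<forall>i'<i. gp r (g i')))" by auto
  next
    fix i and f :: "nat \<Rightarrow> nat \<Rightarrow> bool"
    assume "\<And>y. (y, i) \<in> less_than \<Longrightarrow> f y \<in> B - S \<and> (\<forall>i'<y. gp (f y) (f i'))"
    then have "f ` {..<i} \<subseteq> B - S" by auto
    from new[OF _ this] show "\<exists>r. r \<in> B - S \<and> (\<forall>i'<i. gp r (f i'))" by auto
  qed
  then obtain zs :: "nat \<Rightarrow> nat \<Rightarrow> bool" where zs: "\<And>i i'. i' < i \<Longrightarrow> gp (zs i) (zs i')" by blast
  have asym: "(l, j) \<in> ?A" if "(j, l) \<in> ?A" for j l using that par_sym by (auto simp: adj_def)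
  have np: "\<not> par (vtx N j (zs i)) (vtx N l (zs i'))" "\<not> par (vtx N j (zs i)) (vtx N j (zs i'))"
    if "i \<noteq> i'" "(j, l) \<in> ?A" for i i' j l
  proof -
    have "i < i' \<or> i' < i" using that(1) by linarith
    then show "\<not> par (vtx N j (zs i)) (vtx N l (zs i'))" "\<not> par (vtx N j (zs i)) (vtx N j (zs i'))"
      using zs[of i i'] zs[of i' i] that(2) asym[OF that(2)] par_sym unfolding gp_def by blast+
  qed
  have rel: "vtx N (t1, 0) (zs i) \<preceq> vtx N (t2, 0) (zs i') \<longleftrightarrow> b" if ne: "i \<noteq> i'" for i i'
  proof -
    have J: "vtx N (t1, 0) z \<preceq> vtx N (t2, 0) w \<longleftrightarrow> b" if "join True z w \<notin> R" for z w
      using that by (simp add: R_def)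
    consider "i' < i" | "i < i'" using ne by linarith
    then show ?thesis
    proof cases
      case 1
      then show ?thesis using zs[OF 1] J by (simp add: gp_def)
    next
      case 2
      then have "join True (zs i) (zs i') \<notin> R" using zs[OF 2] join_flip[of True "zs i'" "zs i"] by (simp add: gp_def)
      then show ?thesis by (rule J)
    qed
  qed
  show False
  proof (rule order_core[of ?A "vtx N" "(t1, 0)" "(t2, 0)" q j0 zs b])
    show "(l, j) \<in> ?A" if "(j, l) \<in> ?A" for j l by (rule asym[OF that])
    show "par (vtx N j z) (vtx N l z)" if "(j, l) \<in> ?A" for j l z using that by (simp add: adj_def)
    show "\<not> par (vtx N j (zs i)) (vtx N l (zs i'))" if "i \<noteq> i'" "(j, l) \<in> ?A" for i i' j l by (rule np(1)[OF that])
    show "\<not> par (vtx N j (zs i)) (vtx N j (zs i'))" if "i \<noteq> i'" "(j, l) \<in> ?A" for i i' j l by (rule np(2)[OF that])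
    show "vtx N (t1, 0) (zs i) \<preceq> vtx N (t2, 0) (zs i') \<longleftrightarrow> b" if "i \<noteq> i'" for i i' by (rule rel[OF that])
  qed (use q j0 in simp_all)
qed

end

section \<open>Transfer to Hausdorff spaces\<close>

lemma (in analytic_quasi_order) ex_total_good: "\<exists>c. good c \<and> cdom c = UNIV"
  using ex_fusion fusion.contradiction by blast

text \<open>\<open>N x\<close> is the first length at which the neighbourhood of \<open>x\<close>
  misses \<open>F\<close>. A point outside \<open>F\<close> goes to a chosen point of
  \<open>F\<close> that agrees with it just before that length.\<close>

lemma closed_retract:
  fixes F :: "baire set"
  assumes F: "closed F" "F \<noteq> {}"
  shows "\<exists>\<rho>. continuous_on UNIV \<rho> \<and> range \<rho> \<subseteq> F \<and> (\<forall>x\<in>F. \<rho> x = x)"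
proof -
  define N where "N x = (LEAST n. F \<inter> nbhd n x = {})" for x
  define \<rho> where "\<rho> x = (if x \<in> F then x else SOME y. y \<in> F \<inter> nbhd (N x - 1) x)" for x
  have out: "\<rho> x = (SOME y. y \<in> F \<inter> nbhd (N x - 1) x)" if "x \<notin> F" for x
    using that by (simp add: \<rho>_def)
  have N: "F \<inter> nbhd (N x) x = {}" if x: "x \<notin> F" for x
  proof -
    obtain n where "nbhd n x \<subseteq> - F" using open_imp_nbhd[of "- F" x] F(1) x by (auto simp: open_Compl)
    then have "F \<inter> nbhd n x = {}" by blast
    then show ?thesis unfolding N_def by (rule LeastI)
  qed
  have before: "F \<inter> nbhd n x \<noteq> {}" if "n < N x" for n x
    using not_less_Least[of n] that unfolding N_def by blast
  have in_nbhd: "\<rho> x \<in> F \<inter> nbhd (N x - 1) x" if x: "x \<notin> F" for x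
  proof -
    have "N x \<noteq> 0" using N[OF x] F(2) by (auto simp: nbhd_def)
    then have "F \<inter> nbhd (N x - 1) x \<noteq> {}" by (intro before) simp
    then have "\<exists>y. y \<in> F \<inter> nbhd (N x - 1) x" by blast
    from someI_ex[OF this] show ?thesis using x by (simp add: \<rho>_def)
  qed
  have near: "\<exists>n. \<forall>x'\<in>nbhd n x. \<rho> x' \<in> nbhd m (\<rho> x)" for x m
  proof (cases "x \<in> F")
    case True
    have "\<rho> x' \<in> nbhd m x" if x': "x' \<in> nbhd m x" for x'
    proof (cases "x' \<in> F")
      case False
      have "m < N x'"
      proof (rule ccontr)
        assume "\<not> m < N x'"
        then have "nbhd m x' \<subseteq> nbhd (N x') x'" by (intro nbhd_antimono) simp
        moreover have "x \<in> nbhd m x'" using x' by (simp add: nbhd_def)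
        ultimately show False using N[OF False] True by blast
      qed
      then have "nbhd (N x' - 1) x' \<subseteq> nbhd m x'" by (intro nbhd_antimono) simp
      then show ?thesis using in_nbhd[OF False] x' by (auto simp: nbhd_def)
    qed (use x' in \<open>simp add: \<rho>_def\<close>)
    moreover have "\<rho> x = x" using True by (simp add: \<rho>_def)
    ultimately show ?thesis by auto
  next
    case False
    \<comment> \<open>The choice depends only on \<open>N x\<close> and on the neighbourhood of
      length \<open>N x - 1\<close>, and both are the same for all points of
      \<open>nbhd (N x) x\<close>.\<close>
    have "\<rho> x' = \<rho> x" if x': "x' \<in> nbhd (N x) x" for x'
    proof -
      have eq: "nbhd n x' = nbhd n x" if "n \<le> N x" for n using x' that by (auto simp: nbhd_def)
      have "x' \<notin> F" using N[OF False] x' by (simp only: disjoint_iff) blast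
      moreover have "N x' = N x"
        unfolding N_def[of x']
      proof (rule Least_equality)
        show "F \<inter> nbhd (N x) x' = {}" using N[OF False] eq[OF order_refl] by simp
        show "N x \<le> n" if "F \<inter> nbhd n x' = {}" for n
        proof (rule ccontr)
          assume "\<not> N x \<le> n"
          then have "F \<inter> nbhd n x \<noteq> {}" "nbhd n x' = nbhd n x" using before eq by simp_all
          then show False using that by simp
        qed
      qed
      ultimately show ?thesis 
        using eq[OF diff_le_self[of _ 1]] by (simp only: out[OF False] out not_False_eq_True)
    qed
    then have "\<forall>x'\<in>nbhd (N x) x. \<rho> x' \<in> nbhd m (\<rho> x)" by (metis nbhd_self)
    then show ?thesis by (rule exI)
  qed
  have "continuous_on UNIV \<rho>"
    unfolding continuous_on_open_vimage[OF open_UNIV]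
  proof (intro allI impI)
    fix U :: "baire set" assume U: "open U"
    have "\<exists>n. nbhd n x \<subseteq> \<rho> -` U" if x: "\<rho> x \<in> U" for x
    proof -
      obtain m where "nbhd m (\<rho> x) \<subseteq> U" using open_imp_nbhd[OF U x] by blast
      moreover obtain n where "\<forall>x'\<in>nbhd n x. \<rho> x' \<in> nbhd m (\<rho> x)" using near by blast
      ultimately have "nbhd n x \<subseteq> \<rho> -` U" by auto
      then show ?thesis by (rule exI)
    qed
    then obtain n where n: "\<And>x. \<rho> x \<in> U \<Longrightarrow> nbhd (n x) x \<subseteq> \<rho> -` U" by metis
    then have "\<rho> -` U = (\<Union>x\<in>\<rho> -` U. nbhd (n x) x)" by auto
    also have "open \<dots>" by (intro open_UN ballI open_nbhd)
    finally show "open (\<rho> -` U \<inter> UNIV)" by simp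
  qed
  moreover have "range \<rho> \<subseteq> F" using in_nbhd by (auto simp: \<rho>_def split: if_splits)
  ultimately show ?thesis by (intro exI[of _ \<rho>]) (auto simp: \<rho>_def)
qed

text \<open>The retraction makes the parametrization total, so that the relation can be pulled back
  to all of Baire space.\<close>

lemma analytic_in_range:
  assumes A: "analytic_in Z A" and "A \<noteq> {}"
  shows "\<exists>f :: baire \<Rightarrow> 'a. continuous_map euclidean Z f \<and> range f = A"
proof -
  obtain F :: "baire set" and f where F: "closed F" "continuous_map (top_of_set F) Z f" "f ` F = A"
    using A unfolding analytic_in_def by blast
  have "F \<noteq> {}" using F(3) assms(2) by blast
  then obtain \<rho> where \<rho>: "continuous_on UNIV \<rho>" "range \<rho> \<subseteq> F" "\<forall>x\<in>F. \<rho> x = x"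
    using closed_retract[OF F(1)] by blast
  have "continuous_map euclidean (top_of_set F) \<rho>"
    using \<rho>(1,2) by (auto simp: continuous_map_in_subtopology)
  from continuous_map_compose[OF this F(2)] have "continuous_map euclidean Z (f \<circ> \<rho>)" .
  moreover have "range \<rho> = F" using \<rho>(2,3) by (metis UNIV_I image_eqI subsetI subset_antisym)
  then have "range (f \<circ> \<rho>) = A" using F(3) by (metis image_comp)
  ultimately show ?thesis by (intro exI[of _ "f \<circ> \<rho>"] conjI)
qed

text \<open>The Hausdorff property makes the set of pairs with equal values closed, and the preimage
  is its projection.\<close>

lemma suslin_vimage_analytic:
  fixes g :: "baire \<Rightarrow> 'a"
  assumes Z: "Hausdorff_space Z" and g: "continuous_map euclidean Z g" and A: "analytic_in Z A"
  shows "suslin (g -` A)"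
proof (cases "A = {}")
  case True
  then show ?thesis using suslin_closed[OF closed_empty] by simp
next
  case False
  obtain h :: "baire \<Rightarrow> 'a" where h: "continuous_map euclidean Z h" "range h = A"
    using analytic_in_range[OF A False] by blast
  let ?K = "{p :: baire \<times> baire. g (fst p) = h (snd p)}"
  have "continuous_map euclidean euclidean (fst :: baire \<times> baire \<Rightarrow> _)"
    "continuous_map euclidean euclidean (snd :: baire \<times> baire \<Rightarrow> _)"
    by (simp_all add: continuous_on_fst[OF continuous_on_id] continuous_on_snd[OF continuous_on_id])
  then have "continuous_map euclidean Z (g \<circ> fst :: baire \<times> baire \<Rightarrow> _)"
    "continuous_map euclidean Z (h \<circ> snd :: baire \<times> baire \<Rightarrow> _)"
    using continuous_map_compose g h(1) by blast+
  from closedin_continuous_maps_eq[OF Z this] have "closed ?K" by simp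
  moreover have "g -` A = fst ` ?K"
  proof (intro set_eqI iffI)
    fix x assume "x \<in> g -` A"
    then obtain y where "g x = h y" using h(2) by blast
    then show "x \<in> fst ` ?K" by (intro image_eqI[of _ _ "(x, y)"]) simp_all
  next
    fix x assume "x \<in> fst ` ?K"
    then show "x \<in> g -` A" using h(2) by auto
  qed
  ultimately show ?thesis unfolding suslin_def by blast
qed

lemma borel_in_vimage:
  fixes g :: "'b::topological_space \<Rightarrow> 'a"
  assumes g: "continuous_map euclidean Z g" and D: "borel_in Z D"
  shows "g -` D \<in> sets borel"
  using D unfolding borel_in_def
proof (induction rule: sigma_sets.induct)
  case (Basic U)
  then have "open (g -` U)" using openin_continuous_map_preimage[OF g, of U] by (simp add: vimage_def)
  then show ?case by (rule borel_open)
next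
  case (Compl D)
  have "g -` (topspace Z - D) = - (g -` D)" using g by (auto simp: continuous_map_def)
  then show ?case using Compl by (simp add: Compl_in_sets_lebesgue borel_comp)
next
  case (Union D)
  then show ?case by (simp add: vimage_UN sets.countable_UN)
qed simp

lemma incomparability_sym: "(x, y) \<in> incomparability X R \<Longrightarrow> (y, x) \<in> incomparability X R"
  by (auto simp: incomparability_def)

text \<open>Separate first \<open>A\<close> from the points incomparable to a point of \<open>A\<close>, then \<open>A\<close> from the points
  incomparable to a point of the Borel set obtained.\<close>

lemma borel_chain_hull:
  fixes f :: "baire \<Rightarrow> 'a \<times> 'a"
  assumes X: "Hausdorff_space X" and f: "continuous_map euclidean (prod_topology X X) f"
    and range_f: "range f = incomparability (topspace X) R"
    and A: "analytic_in X A" "A \<in> Chains R"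
  shows "\<exists>D. borel_in X D \<and> A \<subseteq> D \<and> D \<in> Chains R"
proof -
  have fst_f: "continuous_map euclidean X (fst \<circ> f)" and snd_f: "continuous_map euclidean X (snd \<circ> f)"
    using f by (auto simp: continuous_map_pairwise)
  \<comment> \<open>The points incomparable to a point of \<open>D\<close>, written through the
    parametrization so that analyticity is inherited from \<open>D\<close>.\<close>
  define N where "N D = (snd \<circ> f) ` ((fst \<circ> f) -` D)" for D
  have N_iff: "y \<in> N D \<longleftrightarrow> (\<exists>x\<in>D. (x, y) \<in> incomparability (topspace X) R)" for y D
    
  proof
    assume "y \<in> N D"
    then obtain \<gamma> where "fst (f \<gamma>) \<in> D" "y = snd (f \<gamma>)" by (auto simp: N_def)
    then show "\<exists>x\<in>D. (x, y) \<in> incomparability (topspace X) R"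
      unfolding range_f[symmetric] by (intro bexI[of _ "fst (f \<gamma>)"]) auto
  next
    assume "\<exists>x\<in>D. (x, y) \<in> incomparability (topspace X) R"
    then obtain x \<gamma> where "x \<in> D" "f \<gamma> = (x, y)" unfolding range_f[symmetric] by (metis imageE)
    then show "y \<in> N D" unfolding N_def by (intro image_eqI[of _ _ \<gamma>]) auto
  qed
  have "suslin ((fst \<circ> f) -` A)" by (rule suslin_vimage_analytic[OF X fst_f A(1)])
  then have "analytic_in X (N A)" unfolding N_def by (rule analytic_in_image_suslin[OF _ snd_f])
  moreover have "A \<inter> N A = {}" using A(2) by (fastforce simp: N_iff incomparability_def Chains_def)
  ultimately obtain D1 where D1: "borel_in X D1" "A \<subseteq> D1" "N A \<inter> D1 = {}"
    using lusin_separation[OF X A(1)] by blast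
  have "suslin ((fst \<circ> f) -` D1)" by (rule suslin_borel[OF borel_in_vimage[OF fst_f D1(1)]])
  then have "analytic_in X (N D1)" unfolding N_def by (rule analytic_in_image_suslin[OF _ snd_f])
  moreover have "A \<inter> N D1 = {}" using D1(3) incomparability_sym unfolding disjoint_iff N_iff by metis
  ultimately obtain D2 where D2: "borel_in X D2" "A \<subseteq> D2" "N D1 \<inter> D2 = {}"
    using lusin_separation[OF X A(1)] by blast
  interpret sigma_algebra "topspace X" "{D. borel_in X D}" by (rule borel_in_sigma_algebra)
  have D: "borel_in X (D1 \<inter> D2)" using Int[of D1 D2] D1(1) D2(1) by simp
  have "(x, y) \<in> R \<or> (y, x) \<in> R" if xy: "x \<in> D1 \<inter> D2" "y \<in> D1 \<inter> D2" for x y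
  proof -
    have "(x, y) \<notin> incomparability (topspace X) R" using D2(3) xy N_iff[of y D1] by blast
    moreover have "x \<in> topspace X" "y \<in> topspace X" using xy sets_into_space[of D1] D1(1) by auto
    ultimately show ?thesis by (simp add: incomparability_def)
  qed
  then have "D1 \<inter> D2 \<in> Chains R" by (auto simp: Chains_def)
  then show ?thesis using D D1(2) D2(2) by blast
qed

lemma antichain_card_le:
  assumes "antichain_on X R A" "\<forall>i<k. C i \<in> Chains R" "A \<subseteq> (\<Union>i<k. C i)"
  shows "card A \<le> k"
proof -
  have "\<forall>a\<in>A. \<exists>i<k. a \<in> C i" using assms(3) by blast
  then obtain i where i: "\<forall>a\<in>A. i a < k \<and> a \<in> C (i a)" by metis
  have "inj_on i A"
  proof (rule inj_onI, rule ccontr)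
    fix a b assume ab: "a \<in> A" "b \<in> A" "i a = i b" "a \<noteq> b"
    then have "(a, b) \<in> incomparability X R" using assms(1) by (simp add: antichain_on_def)
    moreover have "a \<in> C (i a)" "b \<in> C (i a)" "C (i a) \<in> Chains R" using i ab assms(2) by auto
    ultimately show False by (auto simp: incomparability_def Chains_def)
  qed
  moreover have "i ` A \<subseteq> {..<k}" using i by auto
  ultimately show ?thesis using card_inj_on_le[of i A "{..<k}"] by simp
qed

text \<open>The relation is pulled back along the first coordinate of a parametrization of the
  incomparable pairs. Its values are exactly the points with an incomparable partner; all other
  points are comparable to everything and can be put into any one chain.\<close>

lemma borel_chain_cover:
  fixes X :: "'a topology"
  assumes k: "k > 0" and X: "Hausdorff_space X" and R: "preorder_on (topspace X) R"
    and uB: "aleph0_universally_Baire_in (prod_topology X X) R"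
    and an: "analytic_in (prod_topology X X) (incomparability (topspace X) R)"
    and no: "\<not> (\<exists>A. antichain_on (topspace X) R A \<and> finite A \<and> card A = k + 1)"
  shows "\<exists>C :: nat \<Rightarrow> 'a set. (\<forall>i<k. borel_in X (C i) \<and> C i \<in> Chains R) \<and> (\<Union>i<k. C i) = topspace X"
proof (cases "incomparability (topspace X) R = {}")
  case True
  then have "topspace X \<in> Chains R" by (auto simp: incomparability_def Chains_def)
  then show ?thesis using k by (intro exI[of _ "\<lambda>_. topspace X"]) (auto intro: borel_in_openin)
next
  case False
  let ?I = "incomparability (topspace X) R"
  obtain f :: "baire \<Rightarrow> 'a \<times> 'a" where f: "continuous_map euclidean (prod_topology X X) f" "range f = ?I"
    using analytic_in_range[OF an False] by blast
  define g where "g = fst \<circ> f"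
  have g: "continuous_map euclidean X g" using f(1) by (simp add: g_def continuous_map_pairwise)
  have gX: "g x \<in> topspace X" for x using g by (auto simp: continuous_map_def)
  have refl: "(p, p) \<in> R" if "p \<in> topspace X" for p
    using R that by (auto simp: preorder_on_def refl_on_def)
  define le where "le x y \<longleftrightarrow> (g x, g y) \<in> R" for x y
  interpret quasi_order le
  proof
    show "le x x" for x by (simp add: le_def refl gX)
    show "le x z" if "le x y" "le y z" for x y z
      using R that by (auto simp: preorder_on_def le_def dest: transD)
  qed
  have par_I: "par x y \<longleftrightarrow> (g x, g y) \<in> ?I" for x y
    by (simp add: par_def le_def incomparability_def gX)
  \<comment> \<open>The code is a parameter at which \<open>f\<close> takes the pair of images as
    value.\<close>
  define K :: "(baire \<times> baire \<times> baire) set"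
    where "K = {p. f (snd (snd p)) = (g (fst p), g (fst (snd p)))}"
  interpret analytic_quasi_order le k K
  proof
    show "k > 0" by (rule k)
    have "continuous_map euclidean (prod_topology X X) (f \<circ> (\<lambda>p :: baire \<times> baire \<times> baire. snd (snd p)))"
      by (rule continuous_map_compose[OF _ f(1)]) (simp add: continuous_intros)
    moreover have "continuous_map euclidean X (g \<circ> (\<lambda>p :: baire \<times> baire \<times> baire. fst p))"
      by (rule continuous_map_compose[OF _ g]) (simp add: continuous_intros)
    moreover have "continuous_map euclidean X (g \<circ> (\<lambda>p :: baire \<times> baire \<times> baire. fst (snd p)))"
      by (rule continuous_map_compose[OF _ g]) (simp add: continuous_intros)
    moreover have "Hausdorff_space (prod_topology X X)" using X by (simp add: Hausdorff_space_prod_topology)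
    ultimately show "closed K"
      using closedin_continuous_maps_eq[of "prod_topology X X" euclidean
          "f \<circ> (\<lambda>p :: baire \<times> baire \<times> baire. snd (snd p))" "\<lambda>p. (g (fst p), g (fst (snd p)))"]
      by (simp add: K_def continuous_map_paired o_def)
    show "par x y \<longleftrightarrow> (\<exists>\<gamma>. (x, y, \<gamma>) \<in> K)" for x y
      unfolding par_I f(2)[symmetric] K_def by (auto simp: image_iff eq_commute)
    show "decided {z. le (u z) (v z)}" if uv: "continuous_on UNIV u" "continuous_on UNIV v" for u v :: "cantor \<Rightarrow> nat \<Rightarrow> nat"
    proof (rule decided_baire_property)
      have "continuous_map euclidean X (g \<circ> u)" "continuous_map euclidean X (g \<circ> v)"
        using uv by (simp_all add: continuous_map_compose[OF _ g])
      then have "continuous_map euclidean (prod_topology X X) (\<lambda>z. (g (u z), g (v z)))"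
        by (simp add: continuous_map_paired o_def)
      then have "baire_property ((\<lambda>z. (g (u z), g (v z))) -` R)"
        using uB by (simp add: aleph0_universally_Baire_in_def)
      then show "baire_property {z. le (u z) (v z)}" by (simp add: le_def vimage_def)
    qed
    show "card A \<le> k" if A: "finite A" "anti A" for A
    proof (rule ccontr)
      assume "\<not> card A \<le> k"
      then have "k + 1 \<le> card A" by simp
      then obtain B where B: "B \<subseteq> A" "card B = k + 1" "finite B" by (rule obtain_subset_with_card_n)
      have I: "(g x, g y) \<in> ?I" if "x \<in> B" "y \<in> B" "x \<noteq> y" for x y
        using A(2) B(1) that par_I unfolding anti_def by blast
      \<comment> \<open>By reflexivity equal images would be comparable, so the antichain keeps its
        size in the space \<open>X\<close>.\<close>
      have "inj_on g B" using I refl by (fastforce simp: inj_on_def incomparability_def)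
      then have "card (g ` B) = k + 1" using B(2) by (simp add: card_image)
      moreover have "antichain_on (topspace X) R (g ` B)" using I gX by (fastforce simp: antichain_on_def)
      ultimately show False using no B(3) by blast
    qed
  qed
  obtain c where c: "good c" "cdom c = UNIV" using ex_total_good by blast
  obtain d where d: "col c d" using c(1) by (auto simp: good_def)
  have "\<exists>D. borel_in X D \<and> g ` c j \<subseteq> D \<and> D \<in> Chains R" if j: "j < k" for j
  proof (rule borel_chain_hull[OF X f])
    show "analytic_in X (g ` c j)"
      using c(1) by (intro analytic_in_image_suslin[OF suslin_borel g]) (simp add: good_def)
    have "le x y \<or> le y x" if "x \<in> c j" "y \<in> c j" for x y
      using d j that unfolding col_def par_def by metis
    then show "g ` c j \<in> Chains R" by (auto simp: Chains_def le_def)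
  qed
  then obtain D where D: "\<And>j. j < k \<Longrightarrow> borel_in X (D j) \<and> g ` c j \<subseteq> D j \<and> D j \<in> Chains R" by metis
  define L where "L = topspace X - (\<Union>j<k. D j)"
  have L: "(p, q) \<in> R \<or> (q, p) \<in> R" if "p \<in> L" "q \<in> topspace X" for p q
  proof (rule ccontr)
    assume "\<not> ?thesis"
    then have "(p, q) \<in> ?I" using that by (simp add: incomparability_def L_def)
    then obtain x where x: "p = g x" using f(2) by (metis comp_apply fst_conv g_def imageE)
    have "x \<in> cdom c" using c(2) by simp
    then obtain j where "j < k" "x \<in> c j" by (auto simp: cdom_def)
    then show False using D x that(1) by (auto simp: L_def)
  qed
  interpret sigma_algebra "topspace X" "{D. borel_in X D}" by (rule borel_in_sigma_algebra)
  have DX: "D j \<subseteq> topspace X" if "j < k" for j using sets_into_space[of "D j"] D that by blast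
  have LB: "borel_in X L"
    using Diff[OF top, of "\<Union>j<k. D j"] finite_UN[of "{..<k}" D] D by (auto simp: L_def)
  \<comment> \<open>The points of \<open>L\<close> are comparable to all points, so the first class
    stays a chain; it exists because \<open>k\<close> is positive.\<close>
  let ?C = "\<lambda>i. if i = 0 then D 0 \<union> L else D i"
  have "borel_in X (?C i) \<and> ?C i \<in> Chains R" if i: "i < k" for i
  proof -
    have "borel_in X (D 0 \<union> L)" using Un[of "D 0" L] D[OF k] LB by simp
    have "(p, q) \<in> R \<or> (q, p) \<in> R" if pq: "p \<in> D 0 \<union> L" "q \<in> D 0 \<union> L" for p q
    proof (cases "p \<in> L \<or> q \<in> L")
      case True
      have "p \<in> topspace X" "q \<in> topspace X" using pq DX[OF k] by (auto simp: L_def)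
      then show ?thesis using True L by blast
    next
      case False
      then show ?thesis using pq D[OF k] by (auto simp: Chains_def)
    qed
    then have "D 0 \<union> L \<in> Chains R" by (simp only: Chains_def mem_Collect_eq) blast
    with \<open>borel_in X (D 0 \<union> L)\<close> show ?thesis using D[OF i] by simp
  qed
  moreover have "(\<Union>i<k. ?C i) = topspace X"
  proof
    show "(\<Union>i<k. ?C i) \<subseteq> topspace X" using DX k by (auto simp: L_def split: if_splits)
    have "D j \<subseteq> ?C j" for j by auto
    then have "(\<Union>j<k. D j) \<subseteq> (\<Union>i<k. ?C i)" by blast
    moreover have "L \<subseteq> ?C 0" by simp
    then have "L \<subseteq> (\<Union>i<k. ?C i)" using k by blast
    ultimately show "topspace X \<subseteq> (\<Union>i<k. ?C i)" unfolding L_def by blast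
  qed
  ultimately show ?thesis by (intro exI[of _ ?C]) blast
qed

theorem theorem1:
  fixes k :: nat and X :: "'a topology" and R :: "('a \<times> 'a) set"
  assumes "k > 0"
    and "Hausdorff_space X"
    and "preorder_on (topspace X) R"
    and "aleph0_universally_Baire_in (prod_topology X X) R"
    and "analytic_in (prod_topology X X) (incomparability (topspace X) R)"
  defines "cover_by_chains \<equiv>
      \<exists>C :: nat \<Rightarrow> 'a set. (\<forall>i<k. borel_in X (C i) \<and> C i \<in> Chains R) \<and> (\<Union>i<k. C i) = topspace X"
    and "large_antichain \<equiv> \<exists>A. antichain_on (topspace X) R A \<and> finite A \<and> card A = k + 1"
  shows "(cover_by_chains \<or> large_antichain) \<and> \<not> (cover_by_chains \<and> large_antichain)"
proof
  show "cover_by_chains \<or> large_antichain"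
    using borel_chain_cover[OF assms(1-5)] unfolding cover_by_chains_def large_antichain_def by blast
  show "\<not> (cover_by_chains \<and> large_antichain)"
  proof
    assume "cover_by_chains \<and> large_antichain"
    then obtain C :: "nat \<Rightarrow> 'a set" and A where
      C: "\<forall>i<k. borel_in X (C i) \<and> C i \<in> Chains R" "(\<Union>i<k. C i) = topspace X"
      and A: "antichain_on (topspace X) R A" "card A = k + 1"
      unfolding cover_by_chains_def large_antichain_def by blast
    have "card A \<le> k"
      by (rule antichain_card_le[OF A(1), of k C]) (use C A(1) in \<open>auto simp: antichain_on_def\<close>)
    then show False using A(2) by simp
  qed
qed

end
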